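(* Let $x\in 2^\omega$, let $B\subseteq\mathbb{R}$ be a $\Sigma^0_2(x)$ additive subgroup of $\mathbb{R}$, let $d=\dim_{\mathrm H} B$, and let $\xi\in\mathbb{R}$ be irrational. Then there is an additive subgroup $A$ of $\mathbb{R}$ with $A\in\Sigma^0_2(x\oplus d\oplus\xi)$ such that $$B\subseteq A,\qquad \dim_{\mathrm H} A=d,\qquad A+\xi A=\mathbb{R}.$$ In particular, if $B$ is lightface $\Sigma^0_2$ with $\dim_{\mathrm H} B=0$ and $\xi$ is a computable irrational, then $A$ can be chosen lightface $\Sigma^0_2$ with $\dim_{\mathrm H} A=0$. Moreover, with the same effective bounds, the extension $A$ may also be chosen to be a $\mathbb{Q}$-vector subspace of $\mathbb{R}$.
   Context: $\dim_{\mathrm H}$ denotes Hausdorff dimension with respect to the Euclidean metric. For $A\subseteq\mathbb{R}$ and $\xi\in\mathbb{R}$, $A+\xi A=\{a+\xi b: a,b\in A\}$. Effective pointclasses: for an oracle $z\in 2^\omega$, a set $U\subseteq\mathbb{R}$ is $\Sigma^0_1(z)$ (effectively open relative to $z$) if it is the union of a family of rational open intervals that is computably enumerable relative to $z$; a set is $\Pi^0_1(z)$ if its complement is $\Sigma^0_1(z)$. A sequence of sets is uniformly $\Pi^0_1(z)$ if the enumerations of the complements are given by a single algorithm with oracle $z$ taking the index as input. A set is $\Sigma^0_2(z)$ if it is the union of a uniformly $\Pi^0_1(z)$ sequence of sets. Lightface $\Sigma^0_2$ means $\Sigma^0_2(z)$ with $z$ computable (no oracle). Real numbers such as $d$ and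 $\xi$ used as oracles are given by standard codes in $2^\omega$ (for example, coding the integer part and the binary expansion of the fractional part), and $\oplus$ is the usual effective join of oracles. *)

theory Defs
  imports "HOL-Analysis.Analysis" "HOL-Library.Countable" "HOL-Library.Nat_Bijection"
begin

section \<open>Relative computability\<close>

text \<open>
  Oracles are elements of Cantor space, represented as \<^typ>\<open>nat \<Rightarrow> bool\<close>.  Partial recursive
  functions are unary; several arguments are passed through the (bijective) Cantor pairing
  \<^const>\<open>prod_encode\<close>.  In primitive recursion and minimization a pair \<open>(a, m)\<close> consists of
  the parameter \<open>a\<close> and the recursion or search variable \<open>m\<close>.
\<close>

fun rec_val :: "(nat \<Rightarrow> nat option) \<Rightarrow> (nat \<Rightarrow> nat option) \<Rightarrow> nat \<Rightarrow> nat \<Rightarrow> nat option" where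
  "rec_val f g a 0 = f a"
| "rec_val f g a (Suc m) =
     Option.bind (rec_val f g a m) (\<lambda>r. g (prod_encode (a, prod_encode (m, r))))"

definition mu_val :: "(nat \<Rightarrow> nat option) \<Rightarrow> nat option" where
  "mu_val p =
     (if \<exists>n. p n = Some 0 \<and> (\<forall>m<n. p m \<noteq> None) then Some (LEAST n. p n = Some 0) else None)"

text \<open>
  The partial functions that are partial recursive relative to the set \<open>G\<close> of given functions.
  The identity is the pairing of the two projections.
\<close>

inductive partial_recursive :: "(nat \<Rightarrow> nat option) set \<Rightarrow> (nat \<Rightarrow> nat option) \<Rightarrow> bool"
  for G :: "(nat \<Rightarrow> nat option) set" where
  given: "g \<in> G \<Longrightarrow> partial_recursive G g"
| zero: "partial_recursive G (\<lambda>_. Some 0)"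
| succ: "partial_recursive G (\<lambda>n. Some (Suc n))"
| proj1: "partial_recursive G (\<lambda>n. Some (fst (prod_decode n)))"
| proj2: "partial_recursive G (\<lambda>n. Some (snd (prod_decode n)))"
| pair: "partial_recursive G f \<Longrightarrow> partial_recursive G g \<Longrightarrow>
    partial_recursive G
      (\<lambda>n. Option.bind (f n) (\<lambda>a. Option.bind (g n) (\<lambda>b. Some (prod_encode (a, b)))))"
| comp: "partial_recursive G f \<Longrightarrow> partial_recursive G g \<Longrightarrow>
    partial_recursive G (\<lambda>n. Option.bind (g n) f)"
| prec: "partial_recursive G f \<Longrightarrow> partial_recursive G g \<Longrightarrow>
    partial_recursive G (\<lambda>n. rec_val f g (fst (prod_decode n)) (snd (prod_decode n)))"
| minim: "partial_recursive G f \<Longrightarrow>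
    partial_recursive G (\<lambda>a. mu_val (\<lambda>m. f (prod_encode (a, m))))"

definition char_fun :: "(nat \<Rightarrow> bool) \<Rightarrow> nat \<Rightarrow> nat option" where
  "char_fun z n = Some (of_bool (z n))"

definition ce_in :: "(nat \<Rightarrow> bool) \<Rightarrow> nat set \<Rightarrow> bool" where
  "ce_in z W \<longleftrightarrow> (\<exists>f. partial_recursive {char_fun z} f \<and> W = dom f)"

definition computable_oracle :: "(nat \<Rightarrow> bool) \<Rightarrow> bool" where
  "computable_oracle z \<longleftrightarrow> partial_recursive {} (char_fun z)"

definition oracle_join :: "(nat \<Rightarrow> bool) \<Rightarrow> (nat \<Rightarrow> bool) \<Rightarrow> nat \<Rightarrow> bool" (infixr "\<oplus>\<^sub>T" 65) where
  "(x \<oplus>\<^sub>T y) n = (if even n then x (n div 2) else y (n div 2))"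

text \<open>
  The code of a real joins the singleton of its (encoded) integer part with the binary digits
  of its fractional part; the expansion is the one that is not eventually 1.
\<close>

definition real_code :: "real \<Rightarrow> nat \<Rightarrow> bool" where
  "real_code r = (\<lambda>n. n = int_encode \<lfloor>r\<rfloor>) \<oplus>\<^sub>T (\<lambda>k. odd \<lfloor>2 ^ Suc k * frac r\<rfloor>)"

definition computable_real :: "real \<Rightarrow> bool" where
  "computable_real r \<longleftrightarrow> computable_oracle (real_code r)"


section \<open>Effective pointclasses\<close>

text \<open>
  \<^const>\<open>nat_to_rat_surj\<close> is the explicit, computable enumeration of the rationals as
  fractions.  Codes whose endpoints are not in increasing order denote the empty set.
\<close>

definition rat_interval :: "nat \<Rightarrow> real set" where
  "rat_interval n =
     {of_rat (nat_to_rat_surj (fst (prod_decode n)))<..<of_rat (nat_to_rat_surj (snd (prod_decode n)))}"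

definition uniformly_Pi01 :: "(nat \<Rightarrow> bool) \<Rightarrow> (nat \<Rightarrow> real set) \<Rightarrow> bool" where
  "uniformly_Pi01 z P \<longleftrightarrow>
     (\<exists>W. ce_in z W \<and> (\<forall>i. - P i = (\<Union>n\<in>{n. prod_encode (i, n) \<in> W}. rat_interval n)))"

definition Sigma02 :: "(nat \<Rightarrow> bool) \<Rightarrow> real set \<Rightarrow> bool" where
  "Sigma02 z S \<longleftrightarrow> (\<exists>P. uniformly_Pi01 z P \<and> S = (\<Union>i. P i))"

definition lightface_Sigma02 :: "real set \<Rightarrow> bool" where
  "lightface_Sigma02 S \<longleftrightarrow> (\<exists>z. computable_oracle z \<and> Sigma02 z S)"


section \<open>Hausdorff dimension\<close>

text \<open>
  The convention \<open>0\<^sup>0 = 1\<close> for nonempty sets is made explicit because \<open>0 powr 0 = 0\<close>.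
\<close>

definition diam_pow :: "real \<Rightarrow> real set \<Rightarrow> ennreal" where
  "diam_pow s U = (if U = {} then 0 else if s = 0 then 1 else ennreal (diameter U powr s))"

text \<open>
  Boundedness is required separately since \<^const>\<open>diameter\<close> is unspecified on unbounded sets.
\<close>

definition hausdorff_content :: "real \<Rightarrow> real \<Rightarrow> real set \<Rightarrow> ennreal" where
  "hausdorff_content s \<delta> E =
     (INF U\<in>{U :: nat \<Rightarrow> real set. E \<subseteq> (\<Union>i. U i) \<and> (\<forall>i. bounded (U i) \<and> diameter (U i) \<le> \<delta>)}.
        (\<Sum>i. diam_pow s (U i)))"

definition hausdorff_measure :: "real \<Rightarrow> real set \<Rightarrow> ennreal" where
  "hausdorff_measure s E = (SUP \<delta>\<in>{0<..}. hausdorff_content s \<delta> E)"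

text \<open>
  For a set of reals the infimum is over a nonempty set, as the measure vanishes for \<open>s > 1\<close>.
\<close>

definition hausdorff_dim :: "real set \<Rightarrow> real" where
  "hausdorff_dim E = Inf {s. 0 \<le> s \<and> hausdorff_measure s E = 0}"


section \<open>Subgroups and rational subspaces of the reals\<close>

definition additive_subgroup_real :: "real set \<Rightarrow> bool" where
  "additive_subgroup_real S \<longleftrightarrow>
     0 \<in> S \<and> (\<forall>a\<in>S. \<forall>b\<in>S. a + b \<in> S) \<and> (\<forall>a\<in>S. - a \<in> S)"

definition rat_scale :: "rat \<Rightarrow> real \<Rightarrow> real" where
  "rat_scale q r = of_rat q * r"

lemma vector_space_rat_scale: "vector_space rat_scale"
  by unfold_locales (auto simp: rat_scale_def algebra_simps of_rat_add of_rat_mult)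

abbreviation rat_subspace :: "real set \<Rightarrow> bool" where
  "rat_subspace \<equiv> module.subspace rat_scale"

end

theory Submission
  imports Defs
begin

text \<open>
  The task is to enlarge \<open>B\<close> without increasing its dimension \<open>d\<close> until \<open>A + \<xi> A\<close> is everything.  If
  \<open>d = 1\<close>, the real line itself will do.  Suppose that \<open>d < 1\<close>.

  To every number \<open>y\<close> in the unit interval a pair \<open>(a, b)\<close> with \<open>a + \<xi> b = y\<close> is assigned by writing
  digits in blocks and using, in each block, the digits of the block as a multiple of some integer
  direction \<open>(\<alpha>, \<beta>)\<close> with \<open>\<alpha> + \<xi> \<beta> > 0\<close> (\<open>greedy_expansion\<close>).  The numbers \<open>a\<close> and \<open>b\<close> generate, together
  with \<open>B\<close>, a group whose rational hull is \<open>A\<close>.  The direction may depend on the previous digits, and it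
  is here that the irrationality of \<open>\<xi>\<close> enters: every nonzero integer form \<open>r a + s b\<close> vanishes on some
  direction with \<open>\<alpha> + \<xi> \<beta> > 0\<close>.  A whole block with this direction is invisible to the form, so that the
  value of \<open>r a + s b\<close> is known with the precision of the end of the block from the digits before its
  beginning (\<open>killed_block\<close>).

  An element of the group generated by all \<open>a\<close> and \<open>b\<close> is a sum of values of finitely many such forms
  on different digit sequences, which have different prefixes of some length
  (\<open>path_group_combination_list\<close>).  The directions are arranged in such a way that every assignment
  of directions to finitely many prefixes is realised in infinitely many blocks
  (\<open>directions_recur\<close>).  In these blocks all forms of the given element are invisible
  simultaneously.

  It remains to choose the lengths of the blocks.  When a block begins at digit \<open>s\<close>, the sums of \<open>m\<close>
  invisible forms take at most \<open>2 ^ (m * s)\<close> values up to the precision of the end of the block.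
  Since \<open>B\<close> is null for exponents above \<open>d\<close>, compact parts of \<open>B\<close> have finite covers
  whose weight is small even after multiplication by this number (\<open>cheap_cover_exists\<close>).  The block is
  made so long that its end is finer than every member of such a cover.  Translates of the cover then
  show that the enlarged group is null for the same exponents (\<open>dim_piece_null\<close>).

  All this is effective.  A cover is found by a search, for which it is decidable whether a
  dyadic cell has been recognised as disjoint from a compact part of \<open>B\<close>; the exponents are rational
  approximations to \<open>d\<close>, and the admissible directions are found from rational approximations to \<open>\<xi>\<close>.
  The group is a union of compact sets that are computable images of closed pieces of \<open>B\<close> and digit sequences,
  hence uniformly effectively closed (\<open>pieces_uniformly_Pi01\<close>).
\<close>

section \<open>Total recursive functions relative to an oracle\<close>

definition recf :: "(nat \<Rightarrow> nat option) set \<Rightarrow> (nat \<Rightarrow> nat) \<Rightarrow> bool" where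
  "recf G f \<longleftrightarrow> partial_recursive G (\<lambda>n. Some (f n))"

abbreviation pfst :: "nat \<Rightarrow> nat" where "pfst n \<equiv> fst (prod_decode n)"
abbreviation psnd :: "nat \<Rightarrow> nat" where "psnd n \<equiv> snd (prod_decode n)"

definition recp :: "(nat \<Rightarrow> nat option) set \<Rightarrow> (nat \<Rightarrow> bool) \<Rightarrow> bool" where
  "recp G P \<longleftrightarrow> recf G (\<lambda>n. of_bool (P n))"

text \<open>
  Integers enter through their positive and negative parts, so that arithmetic on them reduces to
  arithmetic on natural numbers without fixing a coding of \<open>\<int>\<close>.
\<close>

definition recz :: "(nat \<Rightarrow> nat option) set \<Rightarrow> (nat \<Rightarrow> int) \<Rightarrow> bool" where
  "recz G f \<longleftrightarrow> recf G (\<lambda>n. nat (f n)) \<and> recf G (\<lambda>n. nat (- f n))"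

text \<open>
  The rules below are closed under substitution: they conclude that \<open>\<lambda>n. F (f n) (g n)\<close> is recursive
  whenever \<open>f\<close> and \<open>g\<close> are.  A bound variable of a sum or quantifier is turned into a component of
  the single argument.  Hence the recursiveness of an explicit arithmetical expression follows by
  applying them along its syntax.
\<close>

named_theorems recI

lemma recf_comp: "recf G f \<Longrightarrow> recf G g \<Longrightarrow> recf G (\<lambda>n. f (g n))"
  unfolding recf_def by (drule (1) partial_recursive.comp) simp

lemma recp_comp: "recp G P \<Longrightarrow> recf G g \<Longrightarrow> recp G (\<lambda>n. P (g n))"
  unfolding recp_def by (rule recf_comp)

lemma recf_pair [recI]: "recf G f \<Longrightarrow> recf G g \<Longrightarrow> recf G (\<lambda>n. prod_encode (f n, g n))"
  unfolding recf_def by (drule (1) partial_recursive.pair) simp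

lemma recf_id [recI]: "recf G (\<lambda>n. n)"
  using partial_recursive.pair[OF partial_recursive.proj1 partial_recursive.proj2, of G]
  by (simp add: recf_def)

lemma recf_pfst [recI]: "recf G f \<Longrightarrow> recf G (\<lambda>n. pfst (f n))"
  by (rule recf_comp) (simp add: recf_def partial_recursive.proj1)

lemma recf_psnd [recI]: "recf G f \<Longrightarrow> recf G (\<lambda>n. psnd (f n))"
  by (rule recf_comp) (simp add: recf_def partial_recursive.proj2)

lemma recf_Suc [recI]: "recf G f \<Longrightarrow> recf G (\<lambda>n. Suc (f n))"
  by (rule recf_comp) (simp add: recf_def partial_recursive.succ)

lemma recf_const [recI]: "recf G (\<lambda>n. k)"
proof (induction k)
  case 0 then show ?case by (simp add: recf_def partial_recursive.zero)
next
  case (Suc k) then show ?case by (rule recf_Suc)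
qed

lemma recf_rec_nat [recI]:
  assumes "recf G f" "recf G (\<lambda>p. g (pfst p) (pfst (psnd p)) (psnd (psnd p)))" "recf G h"
  shows "recf G (\<lambda>n. rec_nat (f n) (\<lambda>m r. g n m r) (h n))"
proof -
  let ?f = "\<lambda>n. Some (f n)" and ?g = "\<lambda>p. Some (g (pfst p) (pfst (psnd p)) (psnd (psnd p)))"
  have "rec_val ?f ?g a m = Some (rec_nat (f a) (\<lambda>m r. g a m r) m)" for a m
    by (induction m) auto
  then have "recf G (\<lambda>n. rec_nat (f (pfst n)) (\<lambda>m r. g (pfst n) m r) (psnd n))"
    using partial_recursive.prec[of G ?f ?g] assms(1,2) by (simp add: recf_def)
  from recf_comp[OF this recf_pair[OF recf_id assms(3)]] show ?thesis by simp
qed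

lemma recf_add [recI]: "recf G f \<Longrightarrow> recf G g \<Longrightarrow> recf G (\<lambda>n. f n + g n)"
proof -
  assume "recf G f" "recf G g"
  then have "recf G (\<lambda>n. rec_nat (f n) (\<lambda>m r. Suc r) (g n))" by (intro recI)
  moreover have "rec_nat a (\<lambda>m r. Suc r) b = a + b" for a b :: nat by (induction b) auto
  ultimately show ?thesis by simp
qed

lemma recf_sub [recI]: "recf G f \<Longrightarrow> recf G g \<Longrightarrow> recf G (\<lambda>n. f n - g n)"
proof -
  have "recf G (\<lambda>n. rec_nat 0 (\<lambda>m r. m) n)" by (intro recI)
  moreover have "rec_nat 0 (\<lambda>m r. m) b = b - Suc 0" for b by (cases b) auto
  ultimately have pred: "recf G (\<lambda>n. n - Suc 0)" by simp
  assume "recf G f" "recf G g"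
  then have "recf G (\<lambda>n. rec_nat (f n) (\<lambda>m r. r - Suc 0) (g n))"
    by (intro recI recf_comp[OF pred])
  moreover have "rec_nat a (\<lambda>m r. r - Suc 0) b = a - b" for a b :: nat by (induction b) auto
  ultimately show ?thesis by simp
qed

lemma recf_mult [recI]: "recf G f \<Longrightarrow> recf G g \<Longrightarrow> recf G (\<lambda>n. f n * g n)"
proof -
  assume fg: "recf G f" "recf G g"
  then have "recf G (\<lambda>n. rec_nat 0 (\<lambda>m r. r + f n) (g n))"
    by (intro recI recf_comp[OF fg(1)])
  moreover have "rec_nat 0 (\<lambda>m r. r + a) b = a * b" for a b :: nat by (induction b) auto
  ultimately show ?thesis by simp
qed

lemma recf_power [recI]: "recf G f \<Longrightarrow> recf G g \<Longrightarrow> recf G (\<lambda>n. f n ^ g n)"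
proof -
  assume fg: "recf G f" "recf G g"
  then have "recf G (\<lambda>n. rec_nat 1 (\<lambda>m r. r * f n) (g n))"
    by (intro recI recf_comp[OF fg(1)])
  moreover have "rec_nat 1 (\<lambda>m r. r * a) b = a ^ b" for a b :: nat by (induction b) auto
  ultimately show ?thesis by simp
qed

lemma recf_sum [recI]:
  assumes "recf G h" "recf G (\<lambda>p. f (pfst p) (psnd p))"
  shows "recf G (\<lambda>n. \<Sum>k<h n. f n k)"
proof -
  have "recf G (\<lambda>p. prod_encode (pfst p, pfst (psnd p)))" by (intro recI)
  from recf_comp[OF assms(2) this] have "recf G (\<lambda>p. f (pfst p) (pfst (psnd p)))" by simp
  then have "recf G (\<lambda>n. rec_nat 0 (\<lambda>m r. r + f n m) (h n))" by (intro recI assms)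
  moreover have "rec_nat 0 (\<lambda>m r. r + f n m) b = (\<Sum>k<b. f n k)" for n b by (induction b) auto
  ultimately show ?thesis by simp
qed

lemma recf_of_bool [recI]: "recp G P \<Longrightarrow> recf G (\<lambda>n. of_bool (P n))"
  by (simp add: recp_def)

lemma recp_not [recI]: "recp G P \<Longrightarrow> recp G (\<lambda>n. \<not> P n)"
proof -
  assume "recp G P"
  then have "recf G (\<lambda>n. 1 - of_bool (P n))" by (intro recI)
  moreover have "1 - of_bool b = (of_bool (\<not> b) :: nat)" for b by simp
  ultimately show ?thesis by (simp only: recp_def)
qed

lemma recp_conj [recI]: "recp G P \<Longrightarrow> recp G Q \<Longrightarrow> recp G (\<lambda>n. P n \<and> Q n)"
proof -
  assume "recp G P" "recp G Q"
  then have "recf G (\<lambda>n. of_bool (P n) * of_bool (Q n))" by (intro recI)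
  then show ?thesis by (simp add: recp_def of_bool_conj)
qed

lemma recp_disj [recI]: "recp G P \<Longrightarrow> recp G Q \<Longrightarrow> recp G (\<lambda>n. P n \<or> Q n)"
  using recp_not[OF recp_conj[OF recp_not recp_not], of G P Q] by simp

lemma recp_imp [recI]: "recp G P \<Longrightarrow> recp G Q \<Longrightarrow> recp G (\<lambda>n. P n \<longrightarrow> Q n)"
  unfolding imp_conv_disj by (intro recp_disj recp_not)

lemma recp_less [recI]: "recf G f \<Longrightarrow> recf G g \<Longrightarrow> recp G (\<lambda>n. f n < g n)"
proof -
  assume "recf G f" "recf G g"
  then have "recf G (\<lambda>n. 1 - (1 - (g n - f n)))" by (intro recI)
  moreover have "1 - (1 - (b - a)) = of_bool (a < b)" for a b :: nat by auto
  ultimately show ?thesis by (simp add: recp_def)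
qed

lemma recp_le [recI]: "recf G f \<Longrightarrow> recf G g \<Longrightarrow> recp G (\<lambda>n. f n \<le> g n)"
  using recp_not[OF recp_less, of G g f] by (simp add: not_less)

lemma recp_eq [recI]: "recf G f \<Longrightarrow> recf G g \<Longrightarrow> recp G (\<lambda>n. f n = g n)"
  using recp_conj[OF recp_le recp_le, of G f g g f] by (simp add: eq_iff)

lemma recf_if [recI]:
  assumes "recp G P" "recf G f" "recf G g"
  shows "recf G (\<lambda>n. if P n then f n else g n)"
proof -
  have "recf G (\<lambda>n. of_bool (P n) * f n + of_bool (\<not> P n) * g n)" using assms by (intro recI)
  moreover have "(\<lambda>n. of_bool (P n) * f n + of_bool (\<not> P n) * g n) = (\<lambda>n. if P n then f n else g n)"
    by auto
  ultimately show ?thesis by simp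
qed

lemma recp_ball [recI]:
  assumes "recf G h" "recp G (\<lambda>p. P (pfst p) (psnd p))"
  shows "recp G (\<lambda>n. \<forall>k<h n. P n k)"
proof -
  have "recp G (\<lambda>n. (\<Sum>k<h n. of_bool (\<not> P n k)) = (0::nat))" using assms by (intro recI)
  moreover have "(\<Sum>k<b. of_bool (\<not> P n k)) = (0::nat) \<longleftrightarrow> (\<forall>k<b. P n k)" for n b by auto
  ultimately show ?thesis by simp
qed

lemma recp_bex [recI]:
  assumes "recf G h" "recp G (\<lambda>p. P (pfst p) (psnd p))"
  shows "recp G (\<lambda>n. \<exists>k<h n. P n k)"
  using recp_not[OF recp_ball[OF assms(1) recp_not[OF assms(2)]]] by simp

lemma recf_div [recI]: "recf G f \<Longrightarrow> recf G g \<Longrightarrow> recf G (\<lambda>n. f n div g n)"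
proof -
  assume fg: "recf G f" "recf G g"
  then have "recf G (\<lambda>n. if g n = 0 then 0 else \<Sum>k<f n. of_bool (Suc k * g n \<le> f n))"
    by (intro recI recf_comp[OF fg(1)] recf_comp[OF fg(2)])
  moreover have "(if b = 0 then 0 else \<Sum>k<a. of_bool (Suc k * b \<le> a)) = a div b" for a b :: nat
  proof (cases "b = 0")
    case False
    have "(\<Sum>k<a. of_bool (Suc k * b \<le> a)) = card ({..<a} \<inter> {k. Suc k * b \<le> a})"
      by simp
    also have "{..<a} \<inter> {k. Suc k * b \<le> a} = {..<a div b}"
    proof (rule set_eqI)
      fix k
      have "Suc k * b \<le> a \<longleftrightarrow> k < a div b"
        using False by (metis Suc_le_eq less_eq_div_iff_mult_less_eq neq0_conv)
      moreover have "k < a div b \<Longrightarrow> k < a" by (meson div_le_dividend order.strict_trans2)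
      ultimately show "k \<in> {..<a} \<inter> {k. Suc k * b \<le> a} \<longleftrightarrow> k \<in> {..<a div b}" by auto
    qed
    finally show ?thesis using False by simp
  qed simp
  ultimately show ?thesis by simp
qed

lemma recf_mod [recI]: "recf G f \<Longrightarrow> recf G g \<Longrightarrow> recf G (\<lambda>n. f n mod g n)"
proof -
  assume "recf G f" "recf G g"
  then have "recf G (\<lambda>n. f n - g n * (f n div g n))" by (intro recI)
  then show ?thesis by (simp add: minus_mult_div_eq_mod)
qed

lemma recp_even [recI]: "recf G f \<Longrightarrow> recp G (\<lambda>n. even (f n))"
proof -
  assume "recf G f"
  then have "recp G (\<lambda>n. f n mod 2 = 0)" by (intro recI)
  then show ?thesis by (simp add: even_iff_mod_2_eq_zero)
qed

lemma recf_Least: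
  assumes "recp G (\<lambda>p. P (pfst p) (psnd p))" "\<And>n. \<exists>m. P n m"
  shows "recf G (\<lambda>n. LEAST m. P n m)"
proof -
  have "partial_recursive G (\<lambda>p. Some (of_bool (\<not> P (pfst p) (psnd p))))"
    using recp_not[OF assms(1)] by (simp add: recp_def recf_def)
  from partial_recursive.minim[OF this] show ?thesis
    using assms(2) by (simp add: recf_def mu_val_def)
qed

lemma recz_of_parts:
  "recf G f \<Longrightarrow> recf G g \<Longrightarrow> recz G (\<lambda>n. int (f n) - int (g n))"
proof -
  assume a: "recf G f" "recf G g"
  have e: "nat (int a - int b) = a - b" "nat (- (int a - int b)) = b - a" for a b by simp_all
  show ?thesis unfolding recz_def e using a by (intro conjI recI)
qed

lemma int_parts: "int (nat k) - int (nat (- k)) = k" by simp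

lemma recz_diff [recI]: "recz G f \<Longrightarrow> recz G g \<Longrightarrow> recz G (\<lambda>n. f n - g n)"
proof -
  assume a: "recz G f" "recz G g"
  have "recz G (\<lambda>n. int (nat (f n) + nat (- g n)) - int (nat (- f n) + nat (g n)))"
    using a unfolding recz_def by (intro recz_of_parts[unfolded recz_def] recI) auto
  moreover have "int (nat x + nat (- y)) - int (nat (- x) + nat y) = x - y" for x y by simp
  ultimately show ?thesis by (simp only:)
qed

lemma recz_const [recI]: "recz G (\<lambda>n. k)"
  by (simp add: recz_def recf_const)

lemma recz_of_nat [recI]: "recf G f \<Longrightarrow> recz G (\<lambda>n. int (f n))"
  by (simp add: recz_def recf_const)

lemma recz_minus [recI]: "recz G f \<Longrightarrow> recz G (\<lambda>n. - f n)"
  by (simp add: recz_def)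

lemma recz_add [recI]: "recz G f \<Longrightarrow> recz G g \<Longrightarrow> recz G (\<lambda>n. f n + g n)"
  using recz_diff[OF _ recz_minus, of G f g] by simp

lemma recz_mult [recI]: "recz G f \<Longrightarrow> recz G g \<Longrightarrow> recz G (\<lambda>n. f n * g n)"
proof -
  assume a: "recz G f" "recz G g"
  have "recz G (\<lambda>n. int (nat (f n) * nat (g n) + nat (- f n) * nat (- g n))
      - int (nat (- f n) * nat (g n) + nat (f n) * nat (- g n)))"
    using a unfolding recz_def by (intro recz_of_parts[unfolded recz_def] recI) auto
  moreover have "int (nat x * nat y + nat (- x) * nat (- y))
      - int (nat (- x) * nat y + nat x * nat (- y)) = x * y" for x y
  proof -
    have "x * y = (int (nat x) - int (nat (- x))) * (int (nat y) - int (nat (- y)))"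
      by (simp only: int_parts)
    then show ?thesis by (simp only: of_nat_add of_nat_mult left_diff_distrib right_diff_distrib)
  qed
  ultimately show ?thesis by (simp only:)
qed

lemma recz_sum [recI]:
  assumes "recf G h" "recz G (\<lambda>p. f (pfst p) (psnd p))"
  shows "recz G (\<lambda>n. \<Sum>k<h n. f n k)"
proof -
  have "recz G (\<lambda>n. int (\<Sum>k<h n. nat (f n k)) - int (\<Sum>k<h n. nat (- f n k)))"
    using assms unfolding recz_def by (intro recz_of_parts[unfolded recz_def] recI) auto
  moreover have "int (\<Sum>k<b. nat (f n k)) - int (\<Sum>k<b. nat (- f n k)) = (\<Sum>k<b. f n k)" for b n
    by (simp only: of_nat_sum sum_subtractf[symmetric] int_parts)
  ultimately show ?thesis by (simp only:)
qed

lemma recz_if [recI]: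
  assumes "recp G P" "recz G f" "recz G g"
  shows "recz G (\<lambda>n. if P n then f n else g n)"
  using assms recf_if[of G P "\<lambda>n. nat (f n)" "\<lambda>n. nat (g n)"]
    recf_if[of G P "\<lambda>n. nat (- f n)" "\<lambda>n. nat (- g n)"]
  by (simp add: recz_def if_distrib[of nat] if_distrib[of uminus])

lemma recp_zless [recI]: "recz G f \<Longrightarrow> recz G g \<Longrightarrow> recp G (\<lambda>n. f n < g n)"
proof -
  assume a: "recz G f" "recz G g"
  have "recp G (\<lambda>n. nat (f n) + nat (- g n) < nat (- f n) + nat (g n))"
    using a unfolding recz_def by (intro recI) auto
  moreover have "nat x + nat (- y) < nat (- x) + nat y \<longleftrightarrow> x < y" for x y by arith
  ultimately show ?thesis by simp
qed

lemma recp_zle [recI]: "recz G f \<Longrightarrow> recz G g \<Longrightarrow> recp G (\<lambda>n. f n \<le> g n)"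
  using recp_not[OF recp_zless, of G g f] by (simp add: not_less)

lemma recp_zeq [recI]: "recz G f \<Longrightarrow> recz G g \<Longrightarrow> recp G (\<lambda>n. f n = g n)"
  using recp_conj[OF recp_zle recp_zle, of G f g g f] by (simp add: eq_iff)

lemma recz_abs [recI]: "recz G f \<Longrightarrow> recz G (\<lambda>n. \<bar>f n\<bar>)"
  unfolding abs_if by (intro recI)

lemma recz_int_decode [recI]: "recf G f \<Longrightarrow> recz G (\<lambda>n. int_decode (f n))"
proof -
  assume "recf G f"
  then have "recz G (\<lambda>n. if even (f n) then int (f n div 2) else - int (f n div 2) - 1)"
    by (intro recI)
  then show ?thesis by (simp add: int_decode_def sum_decode_def if_distrib cong: if_cong)
qed

lemma recf_int_encode [recI]: "recz G f \<Longrightarrow> recf G (\<lambda>n. int_encode (f n))"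
proof -
  assume a: "recz G f"
  then have "recf G (\<lambda>n. if 0 \<le> f n then 2 * nat (f n) else Suc (2 * (nat (- f n) - 1)))"
    using a[unfolded recz_def] by (intro recI) auto
  moreover have "(if 0 \<le> x then 2 * nat x else Suc (2 * (nat (- x) - 1))) = int_encode x" for x
    by (auto simp: int_encode_def sum_encode_def nat_diff_distrib')
  ultimately show ?thesis by simp
qed

section \<open>Stages of partial computations\<close>

lemma partial_recursive_relativize:
  assumes "partial_recursive G f" "\<And>g. g \<in> G \<Longrightarrow> partial_recursive G' g"
  shows "partial_recursive G' f"
  using assms(1)
proof induction
  case (given g) then show ?case by (rule assms(2))
next
  case zero show ?case by (rule partial_recursive.zero)
next
  case succ show ?case by (rule partial_recursive.succ)
next
  case proj1 show ?case by (rule partial_recursive.proj1)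
next
  case proj2 show ?case by (rule partial_recursive.proj2)
next
  case (pair f g) from pair.IH show ?case by (rule partial_recursive.pair)
next
  case (comp f g) from comp.IH show ?case by (rule partial_recursive.comp)
next
  case (prec f g) from prec.IH show ?case by (rule partial_recursive.prec)
next
  case (minim f) from minim.IH show ?case by (rule partial_recursive.minim)
qed

text \<open>
  \<open>T n s\<close> is what is known about \<open>f n\<close> after \<open>s\<close> steps: \<open>0\<close> while nothing is known, and \<open>Suc v\<close> once the
  value \<open>v\<close> has been found.  Since \<open>T\<close> is total recursive, this is the normal form theorem: an
  enumerable set is the projection of a decidable one.  It is proved along the generation of the
  partial recursive functions, the step number serving as a common fuel.
\<close>

definition stages :: "(nat \<Rightarrow> nat option) set \<Rightarrow> (nat \<Rightarrow> nat option) \<Rightarrow> (nat \<Rightarrow> nat \<Rightarrow> nat) \<Rightarrow> bool" where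
  "stages G f T \<longleftrightarrow> recf G (\<lambda>p. T (pfst p) (psnd p)) \<and>
     (\<forall>n s t v. T n s = Suc v \<longrightarrow> s \<le> t \<longrightarrow> T n t = Suc v) \<and>
     (\<forall>n v. f n = Some v \<longleftrightarrow> (\<exists>s. T n s = Suc v))"

lemma stages_recf:
  assumes "stages G f T" "recf G g" "recf G h" shows "recf G (\<lambda>n. T (g n) (h n))"
proof -
  have "recf G (\<lambda>p. T (pfst p) (psnd p))" using assms(1) unfolding stages_def by (rule conjunct1)
  from recf_comp[OF this recf_pair[OF assms(2,3)]] show ?thesis by simp
qed

lemma stages_mono: "stages G f T \<Longrightarrow> T n s = Suc v \<Longrightarrow> s \<le> t \<Longrightarrow> T n t = Suc v"
  unfolding stages_def by blast

lemma stages_iff: "stages G f T \<Longrightarrow> f n = Some v \<longleftrightarrow> (\<exists>s. T n s = Suc v)"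
  unfolding stages_def by blast

lemma stages_total:
  assumes "recf G f" shows "stages G (\<lambda>n. Some (f n)) (\<lambda>n s. Suc (f n))"
proof -
  have "recf G (\<lambda>p. Suc (f (pfst p)))" by (intro recI recf_comp[OF assms])
  then show ?thesis by (simp add: stages_def)
qed

lemma stages_pair:
  assumes f: "stages G f F" and g: "stages G g H"
  shows "stages G (\<lambda>n. Option.bind (f n) (\<lambda>a. Option.bind (g n) (\<lambda>b. Some (prod_encode (a, b)))))
     (\<lambda>n s. if F n s = 0 \<or> H n s = 0 then 0 else Suc (prod_encode (F n s - 1, H n s - 1)))"
    (is "stages G ?f ?T")
  unfolding stages_def
proof (intro conjI allI impI)
  show "recf G (\<lambda>p. ?T (pfst p) (psnd p))"
    by (intro recI stages_recf[OF f] stages_recf[OF g])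
next
  fix n s t v assume T: "?T n s = Suc v" and st: "s \<le> t"
  from T obtain a b where ab: "F n s = Suc a" "H n s = Suc b"
    by (cases "F n s"; cases "H n s") auto
  from T ab stages_mono[OF f ab(1) st] stages_mono[OF g ab(2) st] show "?T n t = Suc v" by simp
next
  fix n v
  show "?f n = Some v \<longleftrightarrow> (\<exists>s. ?T n s = Suc v)"
  proof
    assume "?f n = Some v"
    then obtain a b where ab: "f n = Some a" "g n = Some b" "v = prod_encode (a, b)"
      by (auto simp: bind_eq_Some_conv)
    then obtain s t where "F n s = Suc a" "H n t = Suc b"
      using stages_iff[OF f] stages_iff[OF g] by metis
    then have "F n (max s t) = Suc a" "H n (max s t) = Suc b"
      by (blast intro: stages_mono[OF f _ max.cobounded1] stages_mono[OF g _ max.cobounded2])+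
    then show "\<exists>s. ?T n s = Suc v" using ab(3) by (intro exI[of _ "max s t"]) simp
  next
    assume "\<exists>s. ?T n s = Suc v"
    then obtain s where s: "?T n s = Suc v" ..
    then obtain a b where "F n s = Suc a" "H n s = Suc b"
      by (cases "F n s"; cases "H n s") auto
    then have "f n = Some a" "g n = Some b" using stages_iff[OF f] stages_iff[OF g] by blast+
    with s \<open>F n s = Suc a\<close> \<open>H n s = Suc b\<close> show "?f n = Some v" by simp
  qed
qed

lemma stages_comp:
  assumes f: "stages G f F" and g: "stages G g H"
  shows "stages G (\<lambda>n. Option.bind (g n) f)
     (\<lambda>n s. if H n s = 0 then 0 else F (H n s - 1) s)"
    (is "stages G ?f ?T")
  unfolding stages_def
proof (intro conjI allI impI)
  show "recf G (\<lambda>p. ?T (pfst p) (psnd p))"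
    by (intro recI stages_recf[OF f] stages_recf[OF g])
next
  fix n s t v assume T: "?T n s = Suc v" and st: "s \<le> t"
  from T obtain b where b: "H n s = Suc b"
    by (cases "H n s") auto
  with T have "F b s = Suc v" by simp
  from stages_mono[OF f this st] stages_mono[OF g b st] show "?T n t = Suc v" by simp
next
  fix n v
  show "?f n = Some v \<longleftrightarrow> (\<exists>s. ?T n s = Suc v)"
  proof
    assume "?f n = Some v"
    then obtain b where ab: "g n = Some b" "f b = Some v"
      by (auto simp: bind_eq_Some_conv)
    then obtain s t where "F b s = Suc v" "H n t = Suc b"
      using stages_iff[OF f] stages_iff[OF g] by metis
    then have "F b (max s t) = Suc v" "H n (max s t) = Suc b"
      by (blast intro: stages_mono[OF f _ max.cobounded1] stages_mono[OF g _ max.cobounded2])+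
    then show "\<exists>s. ?T n s = Suc v" by (intro exI[of _ "max s t"]) simp
  next
    assume "\<exists>s. ?T n s = Suc v"
    then obtain s where s: "?T n s = Suc v" ..
    then obtain b where "H n s = Suc b"
      by (cases "H n s") auto
    with s have "F b s = Suc v" by simp
    with \<open>H n s = Suc b\<close> have "f b = Some v" "g n = Some b"
      using stages_iff[OF f] stages_iff[OF g] by blast+
    then show "?f n = Some v" by simp
  qed
qed

lemma stages_prec:
  assumes f: "stages G f F" and g: "stages G g H"
  shows "stages G (\<lambda>n. rec_val f g (pfst n) (psnd n))
     (\<lambda>n s. rec_nat (F (pfst n) s)
        (\<lambda>m r. if r = 0 then 0 else H (prod_encode (pfst n, prod_encode (m, r - 1))) s) (psnd n))"
    (is "stages G ?f ?T")
proof -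
  define R where "R a s m = rec_nat (F a s)
        (\<lambda>m r. if r = 0 then 0 else H (prod_encode (a, prod_encode (m, r - 1))) s) m" for a s m
  have R0: "R a s 0 = F a s" and
    RS: "R a s (Suc m) = (if R a s m = 0 then 0 else H (prod_encode (a, prod_encode (m, R a s m - 1))) s)"
    for a s m by (simp_all add: R_def)
  have T: "?T n s = R (pfst n) s (psnd n)" for n s by (simp add: R_def)
  have mono: "R a s m = Suc v \<Longrightarrow> s \<le> t \<Longrightarrow> R a t m = Suc v" for a s m v t
  proof (induction m arbitrary: v)
    case 0
    from stages_mono[OF f 0(1)[unfolded R0] 0(2)] show ?case by (simp add: R0)
  next
    case (Suc m)
    then obtain r where r: "R a s m = Suc r" by (cases "R a s m") (auto simp: RS)
    then have Rt: "R a t m = Suc r" using Suc by blast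
    have "H (prod_encode (a, prod_encode (m, r))) s = Suc v" using Suc.prems(1) r by (simp add: RS)
    from stages_mono[OF g this Suc.prems(2)] Rt show ?case by (simp add: RS)
  qed
  have eq: "rec_val f g a m = Some v \<longleftrightarrow> (\<exists>s. R a s m = Suc v)" for a m v
  proof (induction m arbitrary: v)
    case 0 show ?case using stages_iff[OF f, of a v] by (simp only: R0 rec_val.simps)
  next
    case (Suc m)
    show ?case
    proof
      assume "rec_val f g a (Suc m) = Some v"
      then obtain r where r: "rec_val f g a m = Some r" "g (prod_encode (a, prod_encode (m, r))) = Some v"
        by (auto simp: bind_eq_Some_conv)
      then obtain s t where "R a s m = Suc r" "H (prod_encode (a, prod_encode (m, r))) t = Suc v"
        using Suc.IH stages_iff[OF g] by metis
      then have "R a (max s t) m = Suc r" "H (prod_encode (a, prod_encode (m, r))) (max s t) = Suc v"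
        by (blast intro: mono[OF _ max.cobounded1] stages_mono[OF g _ max.cobounded2])+
      then show "\<exists>s. R a s (Suc m) = Suc v" by (intro exI[of _ "max s t"]) (simp add: RS)
    next
      assume "\<exists>s. R a s (Suc m) = Suc v"
      then obtain s where s: "R a s (Suc m) = Suc v" ..
      then obtain r where r: "R a s m = Suc r"
        by (cases "R a s m") (auto simp: RS)
      with s have "H (prod_encode (a, prod_encode (m, r))) s = Suc v" by (simp add: RS)
      moreover have "rec_val f g a m = Some r" using Suc.IH r by blast
      moreover from calculation have "g (prod_encode (a, prod_encode (m, r))) = Some v"
        using stages_iff[OF g] by blast
      ultimately show "rec_val f g a (Suc m) = Some v" by simp
    qed
  qed
  show ?thesis unfolding stages_def
  proof (intro conjI allI impI)
    show "recf G (\<lambda>p. ?T (pfst p) (psnd p))"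
      by (intro recI stages_recf[OF f] stages_recf[OF g])
  next
    fix n s t v assume "?T n s = Suc v" "s \<le> t"
    then show "?T n t = Suc v" unfolding T by (rule mono)
  next
    fix n v show "?f n = Some v \<longleftrightarrow> (\<exists>s. ?T n s = Suc v)" unfolding T by (rule eq)
  qed
qed

lemma mu_val_eq_Some:
  "mu_val p = Some v \<longleftrightarrow> p v = Some 0 \<and> (\<forall>k<v. \<exists>r. p k = Some (Suc r))"
proof
  assume mu: "mu_val p = Some v"
  have ex: "\<exists>n. p n = Some 0 \<and> (\<forall>m<n. p m \<noteq> None)"
  proof (rule ccontr)
    assume "\<not> ?thesis"
    then have "mu_val p = None" unfolding mu_val_def by (rule if_not_P)
    with mu show False by simp
  qed
  then have v: "v = (LEAST n. p n = Some 0)" using mu unfolding mu_val_def by simp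
  from ex obtain n where n: "p n = Some 0" "\<forall>m<n. p m \<noteq> None" by blast
  have v0: "p v = Some 0" unfolding v using n(1) by (rule LeastI)
  have "v \<le> n" unfolding v using n(1) by (rule Least_le)
  have "\<exists>r. p k = Some (Suc r)" if "k < v" for k
  proof -
    have "p k \<noteq> Some 0" using that unfolding v by (rule not_less_Least)
    moreover have "p k \<noteq> None" using n(2) that \<open>v \<le> n\<close> by simp
    ultimately show ?thesis by (cases "p k"; cases "the (p k)") auto
  qed
  with v0 show "p v = Some 0 \<and> (\<forall>k<v. \<exists>r. p k = Some (Suc r))" by blast
next
  assume p: "p v = Some 0 \<and> (\<forall>k<v. \<exists>r. p k = Some (Suc r))"
  have "p m \<noteq> None" if "m < v" for m using p that by auto
  with p have ex: "\<exists>n. p n = Some 0 \<and> (\<forall>m<n. p m \<noteq> None)" by blast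
  have "(LEAST n. p n = Some 0) = v"
  proof (rule Least_equality)
    show "p v = Some 0" using p by simp
    fix k assume k: "p k = Some 0"
    show "v \<le> k"
    proof (rule ccontr)
      assume "\<not> v \<le> k"
      then obtain r where "p k = Some (Suc r)" using p by (auto simp: not_le)
      with k show False by simp
    qed
  qed
  with ex show "mu_val p = Some v" unfolding mu_val_def by simp
qed

text \<open>
  Within the fuel \<open>s\<close> at most one \<open>m\<close> is a zero preceded by positive values only, so that a sum over
  all \<open>m < s\<close> performs the case distinction.
\<close>

lemma stages_minim:
  assumes f: "stages G f F"
  shows "stages G (\<lambda>a. mu_val (\<lambda>m. f (prod_encode (a, m))))
     (\<lambda>a s. \<Sum>m<s. of_bool (F (prod_encode (a, m)) s = 1 \<and> (\<forall>k<m. 1 < F (prod_encode (a, k)) s)) * Suc m)"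
    (is "stages G ?f ?T")
proof -
  define Q where "Q a s m \<longleftrightarrow> F (prod_encode (a, m)) s = 1 \<and> (\<forall>k<m. 1 < F (prod_encode (a, k)) s)"
    for a s m
  have uniq: "m = m'" if m: "Q a s m" and m': "Q a s m'" for a s m m'
  proof (rule linorder_cases)
    assume "m < m'"
    then show ?thesis using m m' unfolding Q_def by (metis less_irrefl)
  next
    assume "m' < m"
    then show ?thesis using m m' unfolding Q_def by (metis less_irrefl)
  qed
  have TQ: "?T a s = (\<Sum>m<s. of_bool (Q a s m) * Suc m)" for a s by (simp only: Q_def)
  have T: "?T a s = Suc v \<longleftrightarrow> v < s \<and> Q a s v" for a s v
  proof (cases "\<exists>m<s. Q a s m")
    case True
    then obtain m where m: "m < s" "Q a s m" by blast
    have Q: "Q a s k \<longleftrightarrow> k = m" for k using uniq[OF m(2)] m(2) by blast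
    have "(\<Sum>k<s. of_bool (Q a s k) * Suc k) = (\<Sum>k<s. if k = m then Suc m else 0)"
      unfolding Q by (rule sum.cong[OF refl]) simp
    also have "\<dots> = Suc m" using m(1) by simp
    finally have T1: "(\<Sum>k<s. of_bool (Q a s k) * Suc k) = Suc m" .
    show ?thesis unfolding TQ T1 unfolding Q using m(1) by auto
  next
    case False
    then have T0: "(\<Sum>k<s. of_bool (Q a s k) * Suc k) = 0" by (intro sum.neutral) simp
    show ?thesis unfolding TQ T0 using False by blast
  qed
  have one: "F n t = Suc 0" if "F n s = Suc 0" "s \<le> t" for n s t
    using stages_mono[OF f that] .
  have above: "1 < F n t" if "1 < F n s" "s \<le> t" for n s t
  proof -
    from that(1) obtain r where "F n s = Suc (Suc r)" unfolding less_iff_Suc_add by auto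
    from stages_mono[OF f this that(2)] show ?thesis by simp
  qed
  have Qmono: "Q a t v" if Q: "Q a s v" and st: "s \<le> t" for a s t v
  proof -
    have "F (prod_encode (a, v)) t = 1"
      using one[OF _ st] Q unfolding Q_def One_nat_def by blast
    moreover have "\<forall>k<v. 1 < F (prod_encode (a, k)) t"
      using above[OF _ st] Q unfolding Q_def by blast
    ultimately show ?thesis unfolding Q_def by blast
  qed
  have eq: "?f a = Some v \<longleftrightarrow> (\<exists>s. v < s \<and> Q a s v)" for a v
    unfolding mu_val_eq_Some
  proof
    let ?p = "\<lambda>m. f (prod_encode (a, m))"
    assume p: "?p v = Some 0 \<and> (\<forall>k<v. \<exists>r. ?p k = Some (Suc r))"
    have "\<exists>s. \<forall>k<i. 1 < F (prod_encode (a, k)) s" if "i \<le> v" for i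
      using that
    proof (induction i)
      case 0 show ?case by simp
    next
      case (Suc i)
      then obtain s where s: "\<forall>k<i. 1 < F (prod_encode (a, k)) s" by auto
      from Suc.prems p obtain r where "?p i = Some (Suc r)" by (meson Suc_le_eq)
      then obtain t where t: "F (prod_encode (a, i)) t = Suc (Suc r)" using stages_iff[OF f] by blast
      have "1 < F (prod_encode (a, k)) (max s t)" if "k < Suc i" for k
      proof (cases "k = i")
        case True then show ?thesis using stages_mono[OF f t max.cobounded2, of s] by simp
      next
        case False
        with that have "k < i" by simp
        with s have "1 < F (prod_encode (a, k)) s" by blast
        then show ?thesis by (rule above) simp
      qed
      then show ?case by blast
    qed
    then obtain s where s: "\<forall>k<v. 1 < F (prod_encode (a, k)) s" by blast
    from p have "?p v = Some 0" ..
    then obtain t where t: "F (prod_encode (a, v)) t = Suc 0" using stages_iff[OF f] by blast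
    let ?u = "Suc (v + s + t)"
    have "F (prod_encode (a, v)) ?u = 1" using one[OF t, of ?u] by simp
    moreover have "\<forall>k<v. 1 < F (prod_encode (a, k)) ?u"
    proof (intro allI impI)
      fix k assume "k < v"
      with s have "1 < F (prod_encode (a, k)) s" by blast
      then show "1 < F (prod_encode (a, k)) ?u" by (rule above) simp
    qed
    ultimately have "v < ?u \<and> Q a ?u v" unfolding Q_def by simp
    then show "\<exists>s. v < s \<and> Q a s v" ..
  next
    let ?p = "\<lambda>m. f (prod_encode (a, m))"
    assume "\<exists>s. v < s \<and> Q a s v"
    then obtain s where "Q a s v" by blast
    then have s: "F (prod_encode (a, v)) s = Suc 0" "\<And>k. k < v \<Longrightarrow> 1 < F (prod_encode (a, k)) s"
      unfolding Q_def by simp_all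
    from s(1) have "?p v = Some 0" using stages_iff[OF f] by blast
    moreover have "\<exists>r. ?p k = Some (Suc r)" if k: "k < v" for k
    proof -
      from s(2)[OF k] obtain r where "F (prod_encode (a, k)) s = Suc (Suc r)"
        unfolding less_iff_Suc_add by auto
      then show ?thesis using stages_iff[OF f] by blast
    qed
    ultimately show "?p v = Some 0 \<and> (\<forall>k<v. \<exists>r. ?p k = Some (Suc r))" by blast
  qed
  show ?thesis unfolding stages_def
  proof (intro conjI allI impI)
    show "recf G (\<lambda>p. ?T (pfst p) (psnd p))"
      by (intro recI stages_recf[OF f])
  next
    fix n s t v assume a: "?T n s = Suc v" "s \<le> t"
    from a(1) have "v < s \<and> Q n s v" unfolding T .
    with Qmono[OF _ a(2)] a(2) have "v < t \<and> Q n t v" by simp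
    then show "?T n t = Suc v" unfolding T .
  next
    fix n v show "?f n = Some v \<longleftrightarrow> (\<exists>s. ?T n s = Suc v)" unfolding T eq ..
  qed
qed

lemma partial_recursive_stages:
  assumes "partial_recursive {char_fun z} f" shows "\<exists>T. stages {char_fun z} f T"
  using assms
proof induction
  case (given g)
  moreover have z: "char_fun z = (\<lambda>n. Some (of_bool (z n)))" by (simp add: char_fun_def fun_eq_iff)
  ultimately have "g = (\<lambda>n. Some (of_bool (z n)))" by simp
  moreover have "recf {char_fun z} (\<lambda>n. of_bool (z n))"
    unfolding recf_def z[symmetric] by (rule partial_recursive.given) simp
  ultimately show ?case using stages_total by blast
next
  case zero then show ?case using stages_total[OF recf_const] by blast
next
  case succ then show ?case using stages_total[OF recf_Suc[OF recf_id]] by blast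
next
  case proj1 then show ?case using stages_total[OF recf_pfst[OF recf_id]] by blast
next
  case proj2 then show ?case using stages_total[OF recf_psnd[OF recf_id]] by blast
next
  case (pair f g) then show ?case using stages_pair by blast
next
  case (comp f g) then show ?case using stages_comp by blast
next
  case (prec f g) then show ?case using stages_prec by blast
next
  case (minim f) then show ?case using stages_minim by blast
qed

lemma ce_in_decidable_stages:
  assumes "ce_in z W"
  obtains D where "recp {char_fun z} (\<lambda>p. D (pfst p) (psnd p))" "\<And>n. n \<in> W \<longleftrightarrow> (\<exists>s. D n s)"
    "\<And>n s t. D n s \<Longrightarrow> s \<le> t \<Longrightarrow> D n t"
proof -
  obtain f where f: "partial_recursive {char_fun z} f" "W = dom f" using assms by (auto simp: ce_in_def)
  then obtain T where T: "stages {char_fun z} f T" using partial_recursive_stages by blast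
  show ?thesis
  proof (rule that[of "\<lambda>n s. 0 < T n s"])
    show "recp {char_fun z} (\<lambda>p. 0 < T (pfst p) (psnd p))" by (intro recI stages_recf[OF T])
    show "n \<in> W \<longleftrightarrow> (\<exists>s. 0 < T n s)" for n
    proof -
      have "n \<in> W \<longleftrightarrow> (\<exists>v s. T n s = Suc v)" using stages_iff[OF T, of n] f(2) by blast
      then show ?thesis by (metis gr0_conv_Suc)
    qed
    show "0 < T n s \<Longrightarrow> s \<le> t \<Longrightarrow> 0 < T n t" for n s t
      using stages_mono[OF T, of n s _ t] by (metis gr0_conv_Suc)
  qed
qed

lemma ce_in_Ex:
  assumes "recp {char_fun z} (\<lambda>p. P (pfst p) (psnd p))"
  shows "ce_in z {n. \<exists>m. P n m}"
proof -
  have "partial_recursive {char_fun z} (\<lambda>p. Some (of_bool (\<not> P (pfst p) (psnd p))))"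
    using recp_not[OF assms] by (simp add: recp_def recf_def)
  from partial_recursive.minim[OF this]
  have "partial_recursive {char_fun z} (\<lambda>n. mu_val (\<lambda>m. Some (of_bool (\<not> P n m))))" by simp
  moreover have "{n. \<exists>m. P n m} = dom (\<lambda>n. mu_val (\<lambda>m. Some (of_bool (\<not> P n m))))"
    by (rule set_eqI) (simp add: mu_val_def dom_def)
  ultimately show ?thesis unfolding ce_in_def by blast
qed

section \<open>Hausdorff null sets\<close>

lemma hausdorff_null_iff:
  "hausdorff_measure s E = 0 \<longleftrightarrow>
     (\<forall>\<delta>>0. \<forall>\<epsilon>>0. \<exists>U :: nat \<Rightarrow> real set. E \<subseteq> (\<Union>i. U i) \<and>
        (\<forall>i. bounded (U i) \<and> diameter (U i) \<le> \<delta>) \<and> (\<Sum>i. diam_pow s (U i)) \<le> ennreal \<epsilon>)"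
  (is "_ \<longleftrightarrow> ?R")
proof -
  have "hausdorff_measure s E = 0 \<longleftrightarrow> (\<forall>\<delta>>0. hausdorff_content s \<delta> E = 0)"
    unfolding hausdorff_measure_def using SUP_bot_conv(1)[of "\<lambda>\<delta>. hausdorff_content s \<delta> E" "{0<..}"]
    by (auto simp: bot_ennreal)
  moreover have "hausdorff_content s \<delta> E = 0 \<longleftrightarrow> (\<forall>\<epsilon>>0. \<exists>U :: nat \<Rightarrow> real set. E \<subseteq> (\<Union>i. U i) \<and>
        (\<forall>i. bounded (U i) \<and> diameter (U i) \<le> \<delta>) \<and> (\<Sum>i. diam_pow s (U i)) \<le> ennreal \<epsilon>)"
    (is "?c = 0 \<longleftrightarrow> ?r") for \<delta>
  proof
    assume c: "?c = 0"
    show ?r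
    proof (intro allI impI)
      fix \<epsilon> :: real assume "\<epsilon> > 0"
      with c have "?c < ennreal \<epsilon>" by simp
      then show "\<exists>U :: nat \<Rightarrow> real set. E \<subseteq> (\<Union>i. U i) \<and>
        (\<forall>i. bounded (U i) \<and> diameter (U i) \<le> \<delta>) \<and> (\<Sum>i. diam_pow s (U i)) \<le> ennreal \<epsilon>"
        unfolding hausdorff_content_def INF_less_iff by (force intro: less_imp_le)
    qed
  next
    assume r: ?r
    have "?c \<le> 0"
    proof (rule ennreal_le_epsilon)
      fix e :: real assume "0 < e"
      with r obtain U :: "nat \<Rightarrow> real set" where U: "E \<subseteq> (\<Union>i. U i)"
        "\<forall>i. bounded (U i) \<and> diameter (U i) \<le> \<delta>" "(\<Sum>i. diam_pow s (U i)) \<le> ennreal e"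
        by blast
      have "?c \<le> (\<Sum>i. diam_pow s (U i))"
        unfolding hausdorff_content_def by (rule INF_lower) (use U in simp)
      also note U(3)
      finally show "?c \<le> 0 + ennreal e" by simp
    qed
    then show "?c = 0" by simp
  qed
  ultimately show ?thesis by simp
qed

lemma hausdorff_null_subset:
  assumes "hausdorff_measure s F = 0" "E \<subseteq> F" shows "hausdorff_measure s E = 0"
  unfolding hausdorff_null_iff
proof (intro allI impI)
  fix \<delta> \<epsilon> :: real assume "\<delta> > 0" "\<epsilon> > 0"
  with assms(1)[unfolded hausdorff_null_iff, rule_format, of \<delta> \<epsilon>]
  obtain U :: "nat \<Rightarrow> real set" where "F \<subseteq> (\<Union>i. U i)"
    "\<forall>i. bounded (U i) \<and> diameter (U i) \<le> \<delta>" "(\<Sum>i. diam_pow s (U i)) \<le> ennreal \<epsilon>"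
    by blast
  with assms(2) show "\<exists>U :: nat \<Rightarrow> real set. E \<subseteq> (\<Union>i. U i) \<and>
        (\<forall>i. bounded (U i) \<and> diameter (U i) \<le> \<delta>) \<and> (\<Sum>i. diam_pow s (U i)) \<le> ennreal \<epsilon>"
    by (intro exI[of _ U]) simp
qed

lemma hausdorff_null_UN:
  fixes E :: "nat \<Rightarrow> real set"
  assumes "\<And>k. hausdorff_measure s (E k) = 0"
  shows "hausdorff_measure s (\<Union>k. E k) = 0"
  unfolding hausdorff_null_iff
proof (intro allI impI)
  fix \<delta> \<epsilon> :: real assume pos: "\<delta> > 0" "\<epsilon> > 0"
  have "\<exists>U :: nat \<Rightarrow> real set. E k \<subseteq> (\<Union>i. U i) \<and>
        (\<forall>i. bounded (U i) \<and> diameter (U i) \<le> \<delta>) \<and> (\<Sum>i. diam_pow s (U i)) \<le> ennreal (\<epsilon> * (1/2) ^ Suc k)"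
    for k
    using assms[of k] pos unfolding hausdorff_null_iff by simp
  then obtain U :: "nat \<Rightarrow> nat \<Rightarrow> real set" where U: "\<And>k. E k \<subseteq> (\<Union>i. U k i)"
    "\<And>k i. bounded (U k i) \<and> diameter (U k i) \<le> \<delta>"
    "\<And>k. (\<Sum>i. diam_pow s (U k i)) \<le> ennreal (\<epsilon> * (1/2) ^ Suc k)"
    by metis
  let ?V = "\<lambda>n. U (fst (prod_decode n)) (snd (prod_decode n))"
  have "(\<Sum>n. diam_pow s (?V n)) = (\<Sum>k. \<Sum>i. diam_pow s (U k i))"
    using suminf_ennreal_2dimen[of "\<lambda>k. \<Sum>i. diam_pow s (U k i)" "\<lambda>(k, i). diam_pow s (U k i)"]
    by (simp add: case_prod_unfold)
  also have "\<dots> \<le> (\<Sum>k. ennreal (\<epsilon> * (1/2) ^ Suc k))"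
    by (intro suminf_le U(3)) auto
  also have "\<dots> = ennreal \<epsilon>"
  proof (rule suminf_ennreal_eq)
    show "0 \<le> \<epsilon> * (1/2) ^ Suc k" for k using pos by simp
    show "(\<lambda>k. \<epsilon> * (1/2) ^ Suc k) sums \<epsilon>" using sums_mult[OF power_half_series, of \<epsilon>] by simp
  qed
  finally have sum: "(\<Sum>n. diam_pow s (?V n)) \<le> ennreal \<epsilon>" .
  have "(\<Union>k. E k) \<subseteq> (\<Union>n. ?V n)"
  proof
    fix y assume "y \<in> (\<Union>k. E k)"
    then obtain k i where "y \<in> U k i" using U(1) by blast
    then have "y \<in> ?V (prod_encode (k, i))" by simp
    then show "y \<in> (\<Union>n. ?V n)" by blast
  qed
  with U(2) sum show "\<exists>U :: nat \<Rightarrow> real set. (\<Union>k. E k) \<subseteq> (\<Union>i. U i) \<and>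
        (\<forall>i. bounded (U i) \<and> diameter (U i) \<le> \<delta>) \<and> (\<Sum>i. diam_pow s (U i)) \<le> ennreal \<epsilon>"
    by (intro exI[of _ ?V]) simp
qed

lemma hausdorff_null_exponent_mono:
  assumes "hausdorff_measure s E = 0" "0 \<le> s" "s \<le> t"
  shows "hausdorff_measure t E = 0"
  unfolding hausdorff_null_iff
proof (intro allI impI)
  fix \<delta> \<epsilon> :: real assume pos: "\<delta> > 0" "\<epsilon> > 0"
  with assms(1)[unfolded hausdorff_null_iff, rule_format, of "min \<delta> 1" \<epsilon>]
  obtain U :: "nat \<Rightarrow> real set" where U: "E \<subseteq> (\<Union>i. U i)"
    "\<And>i. bounded (U i)" "\<And>i. diameter (U i) \<le> min \<delta> 1"
    "(\<Sum>i. diam_pow s (U i)) \<le> ennreal \<epsilon>"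
    by auto
  have "diam_pow t (U i) \<le> diam_pow s (U i)" for i
  proof -
    have d: "0 \<le> diameter (U i)" "diameter (U i) \<le> 1" using U(3)[of i] diameter_ge_0[OF U(2)] by auto
    have "diameter (U i) powr t \<le> diameter (U i) powr s"
      using d assms(3) by (rule powr_mono'[rotated])
    moreover have "diameter (U i) powr t \<le> 1"
      using d assms powr_mono2[of t "diameter (U i)" 1] by simp
    ultimately show ?thesis using assms(2,3) unfolding diam_pow_def by (auto intro!: ennreal_leI ennreal_le_1[THEN iffD2])
  qed
  then have "(\<Sum>i. diam_pow t (U i)) \<le> (\<Sum>i. diam_pow s (U i))" by (intro suminf_le) auto
  with U show "\<exists>U :: nat \<Rightarrow> real set. E \<subseteq> (\<Union>i. U i) \<and>
        (\<forall>i. bounded (U i) \<and> diameter (U i) \<le> \<delta>) \<and> (\<Sum>i. diam_pow t (U i)) \<le> ennreal \<epsilon>"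
    by (intro exI[of _ U]) auto
qed

lemma hausdorff_null_finite_cball_covers:
  fixes E :: "real set"
  assumes "0 < s"
    and "\<And>\<delta> \<epsilon>. 0 < \<delta> \<Longrightarrow> 0 < \<epsilon> \<Longrightarrow> \<exists>(I :: 'i set) c r. finite I \<and> E \<subseteq> (\<Union>i\<in>I. cball (c i) (r i)) \<and>
        (\<forall>i\<in>I. 0 \<le> r i \<and> r i \<le> \<delta>) \<and> (\<Sum>i\<in>I. (2 * r i) powr s) \<le> \<epsilon>"
  shows "hausdorff_measure s E = 0"
  unfolding hausdorff_null_iff
proof (intro allI impI)
  fix \<delta> \<epsilon> :: real assume pos: "\<delta> > 0" "\<epsilon> > 0"
  then obtain I :: "'i set" and c r where I: "finite I" "E \<subseteq> (\<Union>i\<in>I. cball (c i) (r i))"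
    "\<And>i. i \<in> I \<Longrightarrow> 0 \<le> r i \<and> r i \<le> \<delta> / 2" "(\<Sum>i\<in>I. (2 * r i) powr s) \<le> \<epsilon>"
    using assms(2)[of "\<delta> / 2" \<epsilon>] by auto
  obtain h where h: "bij_betw h {..<card I} I"
    using ex_bij_betw_nat_finite[OF I(1)] by (auto simp: atLeast0LessThan)
  define U where "U n = (if n < card I then cball (c (h n)) (r (h n)) else {})" for n
  have hI: "n < card I \<Longrightarrow> h n \<in> I" for n using h by (auto simp: bij_betw_def)
  have "E \<subseteq> (\<Union>n. U n)"
  proof
    fix y assume "y \<in> E"
    then obtain i where "i \<in> I" "y \<in> cball (c i) (r i)" using I(2) by blast
    have "i \<in> h ` {..<card I}" using \<open>i \<in> I\<close> bij_betw_imp_surj_on[OF h] by simp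
    then obtain n where "n < card I" "h n = i" by auto
    with \<open>y \<in> cball (c i) (r i)\<close> have "y \<in> U n" by (simp add: U_def)
    then show "y \<in> (\<Union>n. U n)" by blast
  qed
  moreover have "bounded (U n) \<and> diameter (U n) \<le> \<delta>" for n
    using I(3)[OF hI, of n] pos by (auto simp: U_def diameter_empty)
  moreover have "(\<Sum>n. diam_pow s (U n)) \<le> ennreal \<epsilon>"
  proof -
    have e: "diam_pow s (U n) = ennreal ((2 * r (h n)) powr s)" if "n < card I" for n
      using I(3)[OF hI[OF that]] assms(1) that by (simp add: U_def diam_pow_def)
    have "(\<Sum>n. diam_pow s (U n)) = (\<Sum>n<card I. diam_pow s (U n))"
      by (rule suminf_finite) (auto simp: U_def diam_pow_def)
    also have "\<dots> = (\<Sum>n<card I. ennreal ((2 * r (h n)) powr s))" using e by (intro sum.cong) auto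
    also have "\<dots> = ennreal (\<Sum>n<card I. (2 * r (h n)) powr s)" by (rule sum_ennreal) simp
    also have "(\<Sum>n<card I. (2 * r (h n)) powr s) = (\<Sum>i\<in>I. (2 * r i) powr s)"
      using sum.reindex_bij_betw[OF h, of "\<lambda>i. (2 * r i) powr s"] by simp
    finally show ?thesis using I(4) by (simp add: ennreal_leI)
  qed
  ultimately show "\<exists>U :: nat \<Rightarrow> real set. E \<subseteq> (\<Union>i. U i) \<and>
        (\<forall>i. bounded (U i) \<and> diameter (U i) \<le> \<delta>) \<and> (\<Sum>i. diam_pow s (U i)) \<le> ennreal \<epsilon>"
    by blast
qed

lemma hausdorff_null_UNIV:
  assumes "1 < s" shows "hausdorff_measure s (UNIV :: real set) = 0"
proof -
  have "hausdorff_measure s {- real m..real m} = 0" for m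
  proof (rule hausdorff_null_finite_cball_covers)
    show "0 < s" using assms by simp
    fix \<delta> \<epsilon> :: real assume pos: "0 < \<delta>" "0 < \<epsilon>"
    define C where "C = (2 * real m + 2) * 2 powr s"
    have "(\<lambda>N. C * real N powr (1 - s)) \<longlonglongrightarrow> C * 0"
      by (intro tendsto_mult tendsto_const tendsto_neg_powr filterlim_real_sequentially) (use assms in simp)
    then have "eventually (\<lambda>N. C * real N powr (1 - s) < \<epsilon>) sequentially"
      using pos by (intro order_tendstoD) auto
    moreover have "eventually (\<lambda>N. 1 / real N < \<delta>) sequentially"
      using pos by (intro order_tendstoD(2)[OF lim_1_over_n])
    ultimately have "eventually (\<lambda>N. C * real N powr (1 - s) < \<epsilon> \<and> 1 / real N < \<delta> \<and> 0 < N) sequentially"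
      using eventually_gt_at_top[of "0::nat"] by eventually_elim auto
    then obtain N where N: "C * real N powr (1 - s) < \<epsilon>" "1 / real N < \<delta>" "0 < N"
      by (auto simp: eventually_sequentially)
    let ?I = "{- int (m * N)..int (m * N)}"
    have "{- real m..real m} \<subseteq> (\<Union>i\<in>?I. cball (of_int i / real N) (1 / real N))"
    proof
      fix y assume y: "y \<in> {- real m..real m}"
      have "- (real m * real N) \<le> y * real N" "y * real N \<le> real m * real N"
        using y N(3) mult_right_mono[of "- real m" y "real N"] by (auto intro: mult_right_mono)
      then have "\<lfloor>y * real N\<rfloor> \<in> ?I"
        by (simp add: le_floor_iff floor_le_iff)
      moreover have "dist (of_int \<lfloor>y * real N\<rfloor> / real N) y \<le> 1 / real N"
      proof -
        have "\<bar>of_int \<lfloor>y * real N\<rfloor> - y * real N\<bar> \<le> 1" by linarith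
        then have "\<bar>of_int \<lfloor>y * real N\<rfloor> - y * real N\<bar> / real N \<le> 1 / real N"
          using N(3) by (intro divide_right_mono) auto
        moreover have "of_int \<lfloor>y * real N\<rfloor> / real N - y = (of_int \<lfloor>y * real N\<rfloor> - y * real N) / real N"
          using N(3) by (simp add: field_simps)
        ultimately show ?thesis by (simp add: dist_real_def abs_divide)
      qed
      ultimately show "y \<in> (\<Union>i\<in>?I. cball (of_int i / real N) (1 / real N))" by force
    qed
    moreover have "(\<Sum>i\<in>?I. (2 * (1 / real N)) powr s) \<le> \<epsilon>"
    proof -
      have "(\<Sum>i\<in>?I. (2 * (1 / real N)) powr s) = (2 * real m * real N + 1) * (2 / real N) powr s"
        by (simp add: algebra_simps)
      also have "\<dots> \<le> ((2 * real m + 2) * real N) * (2 / real N) powr s"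
        using N(3) by (intro mult_right_mono) (auto simp: algebra_simps)
      also have "\<dots> = C * real N powr (1 - s)"
        using N(3) by (simp add: C_def powr_divide powr_diff)
      finally show ?thesis using N(1) by simp
    qed
    ultimately show "\<exists>(I :: int set) c r. finite I \<and> {- real m..real m} \<subseteq> (\<Union>i\<in>I. cball (c i) (r i)) \<and>
        (\<forall>i\<in>I. 0 \<le> r i \<and> r i \<le> \<delta>) \<and> (\<Sum>i\<in>I. (2 * r i) powr s) \<le> \<epsilon>"
      using N(2) by (intro exI[of _ ?I] exI[of _ "\<lambda>i. of_int i / real N"] exI[of _ "\<lambda>_. 1 / real N"]) auto
  qed
  then have "hausdorff_measure s (\<Union>m. {- real m..real m}) = 0" by (rule hausdorff_null_UN)
  moreover have "(\<Union>m. {- real m..real m}) = UNIV"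
  proof -
    have "y \<in> {- real (nat \<lceil>\<bar>y\<bar>\<rceil>)..real (nat \<lceil>\<bar>y\<bar>\<rceil>)}" for y :: real by (simp; linarith)
    then show ?thesis by blast
  qed
  ultimately show ?thesis by simp
qed

lemma hausdorff_dim_exponents:
  "2 \<in> {s. 0 \<le> s \<and> hausdorff_measure s E = 0}" "bdd_below {s. 0 \<le> s \<and> hausdorff_measure s E = 0}"
proof -
  have "hausdorff_measure 2 E = 0" using hausdorff_null_UNIV[of 2] by (rule hausdorff_null_subset) auto
  then show "2 \<in> {s. 0 \<le> s \<and> hausdorff_measure s E = 0}" by simp
  show "bdd_below {s. 0 \<le> s \<and> hausdorff_measure s E = 0}" by (rule bdd_belowI[of _ 0]) simp
qed

lemma hausdorff_dim_nonneg: "0 \<le> hausdorff_dim E"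
  unfolding hausdorff_dim_def by (rule cInf_greatest) (use hausdorff_dim_exponents(1)[of E] in blast)+

lemma hausdorff_dim_mono:
  assumes "E \<subseteq> F" shows "hausdorff_dim E \<le> hausdorff_dim F"
  unfolding hausdorff_dim_def
proof (rule cInf_superset_mono)
  show "{s. 0 \<le> s \<and> hausdorff_measure s F = 0} \<noteq> {}" using hausdorff_dim_exponents(1)[of F] by blast
  show "bdd_below {s. 0 \<le> s \<and> hausdorff_measure s E = 0}" by (rule hausdorff_dim_exponents(2))
qed (use hausdorff_null_subset[OF _ assms] in blast)

lemma hausdorff_null_above_dim:
  assumes "hausdorff_dim E < t" shows "hausdorff_measure t E = 0"
proof -
  have "{s. 0 \<le> s \<and> hausdorff_measure s E = 0} \<noteq> {}" using hausdorff_dim_exponents(1)[of E] by blast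
  from cInf_lessD[OF this assms[unfolded hausdorff_dim_def]]
  obtain s where "s \<in> {s. 0 \<le> s \<and> hausdorff_measure s E = 0}" "s < t" by (elim bexE)
  then have "0 \<le> s" "hausdorff_measure s E = 0" "s < t" by simp_all
  then show ?thesis using hausdorff_null_exponent_mono[of s E t] by simp
qed

lemma hausdorff_dim_le:
  assumes "0 \<le> d" "\<And>t. d < t \<Longrightarrow> hausdorff_measure t E = 0"
  shows "hausdorff_dim E \<le> d"
proof (rule dense_ge)
  fix t assume "d < t"
  with assms show "hausdorff_dim E \<le> t"
    unfolding hausdorff_dim_def by (intro cInf_lower hausdorff_dim_exponents(2)) auto
qed

lemma hausdorff_dim_le_1: "hausdorff_dim E \<le> 1"
  by (rule hausdorff_dim_le) (auto intro: hausdorff_null_subset[OF hausdorff_null_UNIV])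

section \<open>Digit expansions with prescribed directions\<close>

text \<open>
  A path is an infinite sequence of binary digits, cut into blocks; \<open>P n\<close> is the number whose \<open>S n\<close>
  binary digits are the first \<open>n\<close> blocks of the path \<open>P\<close>.  A path represents a point of the plane: the
  number written in block \<open>n\<close> is added, with a small weight, in the direction \<open>(\<alpha> n (P n), \<beta> n (P n))\<close>,
  which may depend on the digits already read.  The bounds on the coordinates
  of the directions and the growth of \<open>S\<close> make the expansions converge.  The bounds on the values of
  \<open>a + \<xi> b\<close> on the directions make every number in the unit interval representable as \<open>a + \<xi> b\<close>
  for a represented point \<open>(a, b)\<close>.
\<close>

locale path_system =
  fixes S :: "nat \<Rightarrow> nat" and \<alpha> \<beta> :: "nat \<Rightarrow> nat \<Rightarrow> int" and \<xi> :: real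
  assumes S_0: "S 0 = 0"
    and S_step: "S n + (n + 4)\<^sup>2 \<le> S (Suc n)"
    and alpha_le: "\<bar>\<alpha> n p\<bar> \<le> 2 ^ n"
    and beta_le: "\<bar>\<beta> n p\<bar> \<le> 2 ^ n"
    and direction_ge: "1 \<le> 2 ^ n * (of_int (\<alpha> n p) + \<xi> * of_int (\<beta> n p))"
    and direction_le: "of_int (\<alpha> n p) + \<xi> * of_int (\<beta> n p) \<le> 2 ^ n"
begin

definition block :: "nat \<Rightarrow> nat" where "block n = S (Suc n) - S n"

definition paths :: "(nat \<Rightarrow> nat) set" where
  "paths = {P. P 0 = 0 \<and> (\<forall>n. P (Suc n) div 2 ^ block n = P n)}"

text \<open>
  The factor \<open>2 ^ n\<^sup>2\<close> compensates the changes of direction.  The greedy remainder after block \<open>n\<close> is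
  at most \<open>2 ^ n\<close> units of block \<open>n\<close>, while block \<open>Suc n\<close> may advance by as little as \<open>2 ^ -(n + 1)\<close>
  per unit, so that the range of the digits has to grow by \<open>2 ^ (2 * n + 1)\<close> from one block to the next.
\<close>

definition digit_weight :: "nat \<Rightarrow> real" where
  "digit_weight n = 2 ^ n\<^sup>2 / 2 ^ S (Suc n)"

definition summand :: "(nat \<Rightarrow> nat \<Rightarrow> int) \<Rightarrow> (nat \<Rightarrow> nat) \<Rightarrow> nat \<Rightarrow> real" where
  "summand \<gamma> P n = of_int (\<gamma> n (P n)) * real (P (Suc n) mod 2 ^ block n) * digit_weight n"

definition path_val :: "(nat \<Rightarrow> nat \<Rightarrow> int) \<Rightarrow> (nat \<Rightarrow> nat) \<Rightarrow> real" where
  "path_val \<gamma> P = (\<Sum>n. summand \<gamma> P n)"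

definition path_apx :: "(nat \<Rightarrow> nat \<Rightarrow> int) \<Rightarrow> nat \<Rightarrow> nat \<Rightarrow> real" where
  "path_apx \<gamma> n p = (\<Sum>k<n. summand \<gamma> (\<lambda>i. p div 2 ^ (S n - S i)) k)"

text \<open>
  Twice the largest contribution of block \<open>n\<close>; as the contributions decrease at least geometrically
  with ratio \<open>1/2\<close>, this bounds everything from block \<open>n\<close> on.
\<close>

definition path_err :: "nat \<Rightarrow> real" where
  "path_err n = 2 * (2 ^ (n\<^sup>2 + n) / 2 ^ S n)"

lemma S_Suc: "S (Suc n) = S n + block n"
  using S_step[of n] by (simp add: block_def)

lemma S_mono: "m \<le> n \<Longrightarrow> S m \<le> S n"
  by (rule lift_Suc_mono_le[of S]) (simp add: S_Suc)

lemma path_0: "P \<in> paths \<Longrightarrow> P 0 = 0" and path_Suc: "P \<in> paths \<Longrightarrow> P (Suc n) div 2 ^ block n = P n"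
  by (simp_all add: paths_def)

lemma path_div:
  assumes "P \<in> paths" "k \<le> n" shows "P n div 2 ^ (S n - S k) = P k"
  using assms(2)
proof (induction n rule: dec_induct)
  case (step n)
  have "S (Suc n) - S k = block n + (S n - S k)" using S_mono[OF step(1)] by (simp add: S_Suc)
  then have "P (Suc n) div 2 ^ (S (Suc n) - S k) = (P (Suc n) div 2 ^ block n) div 2 ^ (S n - S k)"
    by (simp add: power_add div_mult2_eq)
  then show ?case using path_Suc[OF assms(1)] step by simp
qed simp

lemma path_less: "P \<in> paths \<Longrightarrow> P n < 2 ^ S n"
proof (induction n)
  case 0 then show ?case by (simp add: path_0 S_0)
next
  case (Suc n)
  have "P (Suc n) div 2 ^ block n < 2 ^ S n" using Suc path_Suc[OF Suc(2)] by simp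
  then show ?case by (simp add: S_Suc power_add div_less_iff_less_mult)
qed

lemma path_apx_path:
  assumes "P \<in> paths" shows "path_apx \<gamma> n (P n) = (\<Sum>k<n. summand \<gamma> P k)"
  unfolding path_apx_def
proof (rule sum.cong[OF refl])
  fix k assume "k \<in> {..<n}"
  then show "summand \<gamma> (\<lambda>i. P n div 2 ^ (S n - S i)) k = summand \<gamma> P k"
    using path_div[OF assms] by (simp add: summand_def)
qed

lemma path_err_pos: "0 < path_err n" by (simp add: path_err_def)

lemma path_err_Suc: "path_err (Suc n) \<le> path_err n / 2"
proof -
  have "(Suc n)\<^sup>2 + Suc n + S n + 1 \<le> n\<^sup>2 + n + S (Suc n)"
    using S_step[of n] by (simp add: power2_eq_square algebra_simps)
  then have "(2::real) ^ ((Suc n)\<^sup>2 + Suc n + S n + 1) \<le> 2 ^ (n\<^sup>2 + n + S (Suc n))"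
    by (rule power_increasing) simp
  then have "(2::real) ^ ((Suc n)\<^sup>2 + Suc n) * 2 ^ S n * 2 \<le> 2 ^ (n\<^sup>2 + n) * 2 ^ S (Suc n)"
    by (simp only: power_add power_one_right)
  then show ?thesis unfolding path_err_def by (simp only: field_simps) (simp add: field_simps)
qed

lemma path_err_le: "path_err n \<le> 2 * (1/2) ^ n"
proof (induction n)
  case 0 then show ?case by (simp add: path_err_def S_0)
next
  case (Suc n) then show ?case using path_err_Suc[of n] by simp
qed

lemma path_err_shift: "path_err (n + k) \<le> path_err n * (1/2) ^ k"
proof (induction k)
  case (Suc k) then show ?case using path_err_Suc[of "n + k"] by simp
qed simp

lemma summand_le:
  assumes "\<And>n p. \<bar>\<gamma> n p\<bar> \<le> 2 ^ n"
  shows "\<bar>summand \<gamma> P n\<bar> \<le> path_err n / 2"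
proof -
  have g: "\<bar>real_of_int (\<gamma> n (P n))\<bar> \<le> 2 ^ n"
    using assms[of n "P n"] by (metis of_int_abs of_int_le_numeral_power_cancel_iff)
  have "P (Suc n) mod 2 ^ block n < 2 ^ block n" by simp
  then have "real (P (Suc n) mod 2 ^ block n) < 2 ^ block n"
    by (metis of_nat_less_iff of_nat_numeral of_nat_power)
  then have "\<bar>summand \<gamma> P n\<bar> \<le> 2 ^ n * 2 ^ block n * (2 ^ n\<^sup>2 / 2 ^ S (Suc n))"
    unfolding summand_def digit_weight_def abs_mult using g by (intro mult_mono) auto
  also have "\<dots> = path_err n / 2" by (simp add: path_err_def S_Suc power_add)
  finally show ?thesis .
qed

lemma summand_summable:
  assumes "\<And>n p. \<bar>\<gamma> n p\<bar> \<le> 2 ^ n" shows "summable (summand \<gamma> P)"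
proof (rule summable_comparison_test')
  show "summable (\<lambda>n. (1/2::real) ^ n)" by (rule summable_geometric) simp
  show "norm (summand \<gamma> P n) \<le> (1/2) ^ n" for n
    using summand_le[of \<gamma> P n, OF assms] path_err_le[of n] by simp
qed

lemma path_val_apx:
  assumes "\<And>n p. \<bar>\<gamma> n p\<bar> \<le> 2 ^ n" "P \<in> paths"
  shows "\<bar>path_val \<gamma> P - path_apx \<gamma> n (P n)\<bar> \<le> path_err n"
proof -
  have b: "norm (summand \<gamma> P (k + n)) \<le> path_err n / 2 * (1/2) ^ k" for k
    using summand_le[of \<gamma> P "k + n", OF assms(1)] path_err_shift[of n k]
    by (simp add: add.commute)
  have s: "(\<lambda>k. path_err n / 2 * (1/2) ^ k) sums (path_err n / 2 * 2)"
    using sums_mult[OF geometric_sums[of "1/2 :: real"], of "path_err n / 2"] by simp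
  have "path_val \<gamma> P - path_apx \<gamma> n (P n) = (\<Sum>k. summand \<gamma> P (k + n))"
    unfolding path_val_def path_apx_path[OF assms(2)]
    by (rule suminf_minus_initial_segment[OF summand_summable[OF assms(1)], symmetric])
  also have "norm \<dots> \<le> (\<Sum>k. path_err n / 2 * (1/2) ^ k)"
    by (rule norm_suminf_le[OF b sums_summable[OF s]])
  finally show ?thesis using sums_unique[OF s] by simp
qed

lemma zero_path: "(\<lambda>_. 0) \<in> paths" "path_val \<gamma> (\<lambda>_. 0) = 0"
  by (simp_all add: paths_def path_val_def summand_def)

lemma prefix_path:
  assumes "p < 2 ^ S n" shows "\<exists>P\<in>paths. P n = p"
proof -
  \<comment> \<open>The prefix is continued by zeros.\<close>
  let ?P = "\<lambda>k. p * 2 ^ S k div 2 ^ S n"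
  have "p * 2 ^ S (Suc k) div 2 ^ S n div 2 ^ block k = ?P k" for k
  proof -
    have "p * 2 ^ S (Suc k) div 2 ^ S n div 2 ^ block k = (p * 2 ^ S k) * 2 ^ block k div 2 ^ block k div 2 ^ S n"
      by (simp add: S_Suc power_add mult.assoc div_mult2_eq[symmetric] mult.commute)
    then show ?thesis by simp
  qed
  with assms have "?P \<in> paths" by (simp add: paths_def S_0)
  then show ?thesis by (rule bexI[rotated]) simp
qed

lemma continuous_on_coordinate_fun: "continuous_on A (\<lambda>P :: nat \<Rightarrow> nat. f (P n))"
  by (rule continuous_on_compose2[of UNIV f])
    (auto intro: continuous_on_subset[OF continuous_on_product_coordinates])

text \<open>
  The paths form a closed subset of a product of finite sets.
\<close>

lemma compact_paths: "compact paths"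
proof -
  have "compactin (product_topology (\<lambda>_. euclidean) UNIV) (PiE UNIV (\<lambda>n. {..<2 ^ S n} :: nat set))"
    unfolding compactin_PiE by (simp add: finite_imp_compact)
  then have c: "compact (PiE UNIV (\<lambda>n. {..<2 ^ S n} :: nat set))"
    unfolding euclidean_product_topology by simp
  have "paths = {P. P 0 = 0} \<inter> (\<Inter>n. {P. P (Suc n) div 2 ^ block n = P n})"
    by (auto simp: paths_def)
  also have "closed \<dots>"
    by (intro closed_Int closed_INT ballI closed_Collect_eq continuous_on_const
      continuous_on_coordinate_fun[of UNIV "\<lambda>x. x"]
      continuous_on_coordinate_fun[of UNIV "\<lambda>x. x div _"])
  finally have "closed paths" .
  with c have "compact (PiE UNIV (\<lambda>n. {..<2 ^ S n}) \<inter> paths)" by (rule compact_Int_closed)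
  moreover have "PiE UNIV (\<lambda>n. {..<2 ^ S n}) \<inter> paths = paths" using path_less by auto
  ultimately show ?thesis by simp
qed

text \<open>
  The partial sums depend on finitely many values of the path and converge uniformly.
\<close>

lemma compact_path_vals:
  assumes "\<And>n p. \<bar>\<gamma> n p\<bar> \<le> 2 ^ n" shows "compact (path_val \<gamma> ` paths)"
proof (rule compact_continuous_image[OF _ compact_paths])
  have ul: "uniform_limit paths (\<lambda>n P. \<Sum>i<n. summand \<gamma> P i) (\<lambda>P. \<Sum>i. summand \<gamma> P i) sequentially"
  proof (rule Weierstrass_m_test)
    show "summable (\<lambda>n. (1/2::real) ^ n)" by (rule summable_geometric) simp
    show "norm (summand \<gamma> P n) \<le> (1/2) ^ n" for n P
      using summand_le[of \<gamma> P n, OF assms] path_err_le[of n] by simp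
  qed
  have "continuous_on paths (\<lambda>P. \<Sum>i<n. summand \<gamma> P i)" for n
    unfolding summand_def
    by (intro continuous_intros continuous_on_coordinate_fun[of paths "\<lambda>x. real_of_int (\<gamma> _ x)"]
      continuous_on_coordinate_fun[of paths "\<lambda>x. real (x mod _)"])
  then have "\<forall>\<^sub>F n in sequentially. continuous_on paths (\<lambda>P. \<Sum>i<n. summand \<gamma> P i)" by simp
  from uniform_limit_theorem[OF this ul] show "continuous_on paths (path_val \<gamma>)"
    unfolding path_val_def by simp
qed

text \<open>
  The digits are chosen greedily.  If the remainder is less than \<open>bnd n\<close> before block \<open>n\<close>, then the
  lower bound on the direction guarantees that the quotient fits into the block, and the upper bound
  guarantees that the new remainder is less than \<open>bnd (Suc n)\<close>.
\<close>

lemma greedy_expansion: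
  assumes z: "0 \<le> z" "z < 1"
  shows "\<exists>P\<in>paths. path_val \<alpha> P + \<xi> * path_val \<beta> P = z"
proof -
  define c where "c n p = of_int (\<alpha> n p) + \<xi> * of_int (\<beta> n p)" for n p
  define bnd where "bnd n = (2 ^ (n\<^sup>2 - n) / 2 ^ S n :: real)" for n
  have c_pos: "0 < c n p" for n p
    using direction_ge[of n p] unfolding c_def by (smt (verit) mult_nonneg_nonpos zero_le_power)
  have w_pos: "0 < digit_weight n" for n by (simp add: digit_weight_def)
  have bnd_le: "bnd n \<le> 2 ^ block n * (digit_weight n * c n p)" for n p
  proof -
    have "(2::real) ^ n\<^sup>2 = 2 ^ (n\<^sup>2 - n) * 2 ^ n" by (simp flip: power_add add: power2_eq_square)
    then have "2 ^ block n * digit_weight n = bnd n * 2 ^ n"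
      by (simp add: digit_weight_def S_Suc power_add bnd_def)
    then have "2 ^ block n * (digit_weight n * c n p) = bnd n * (2 ^ n * c n p)"
      by (simp only: mult.assoc[symmetric])
    moreover have "bnd n * 1 \<le> bnd n * (2 ^ n * c n p)"
      using direction_ge[of n p] unfolding c_def bnd_def by (intro mult_left_mono) auto
    ultimately show ?thesis by (simp only: mult_1_right)
  qed
  have w_bnd: "digit_weight n * c n p \<le> bnd (Suc n)" for n p
  proof -
    have e: "(Suc n)\<^sup>2 - Suc n = n\<^sup>2 + n" by (simp add: power2_eq_square)
    have "digit_weight n * c n p \<le> digit_weight n * 2 ^ n"
      using direction_le[of n p] w_pos[of n] unfolding c_def by (intro mult_left_mono) auto
    also have "\<dots> = bnd (Suc n)" unfolding bnd_def e by (simp add: digit_weight_def power_add)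
    finally show ?thesis .
  qed
  define inv where "inv n x \<longleftrightarrow> 0 \<le> snd x \<and> snd x < bnd n \<and> (n = 0 \<longrightarrow> x = (0, z))" for n and x :: "nat \<times> real"
  define step where "step n x y \<longleftrightarrow> (\<exists>v<2 ^ block n. fst y = fst x * 2 ^ block n + v \<and>
      snd y = snd x - real v * (digit_weight n * c n (fst x)))" for n and x y :: "nat \<times> real"
  have "\<exists>f. \<forall>n. inv n (f n) \<and> step n (f n) (f (Suc n))"
  proof (rule dependent_nat_choice)
    have "bnd 0 = 1" by (simp add: bnd_def S_0)
    then show "\<exists>x. inv 0 x" using z by (intro exI[of _ "(0, z)"]) (simp add: inv_def)
  next
    fix x n assume x: "inv n x"
    define w where "w = digit_weight n * c n (fst x)"
    have w: "0 < w" using c_pos w_pos by (simp add: w_def)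
    define v where "v = nat \<lfloor>snd x / w\<rfloor>"
    have "0 \<le> snd x / w" using x w by (simp add: inv_def)
    then have v: "real v \<le> snd x / w" "snd x / w < real v + 1"
      unfolding v_def by (simp_all add: of_nat_nat)
    have "snd x < 2 ^ block n * w" using x bnd_le[of n "fst x"] by (simp add: inv_def w_def)
    then have "snd x / w < 2 ^ block n" using w by (simp add: pos_divide_less_eq)
    with v(1) have "real v < 2 ^ block n" by (rule le_less_trans)
    then have "v < 2 ^ block n" by (metis of_nat_less_iff of_nat_numeral of_nat_power)
    moreover have "0 \<le> snd x - real v * w" "snd x - real v * w < bnd (Suc n)"
      using v w w_bnd[of n "fst x"] by (simp_all add: field_simps w_def[symmetric])
    ultimately show "\<exists>y. inv (Suc n) y \<and> step n x y"
      by (intro exI[of _ "(fst x * 2 ^ block n + v, snd x - real v * w)"])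
        (auto simp: inv_def step_def w_def)
  qed
  then obtain f where f: "\<And>n. inv n (f n)" "\<And>n. step n (f n) (f (Suc n))" by blast
  define P where "P n = fst (f n)" for n
  have digit: "P (Suc n) div 2 ^ block n = P n \<and>
      snd (f (Suc n)) = snd (f n) - real (P (Suc n) mod 2 ^ block n) * (digit_weight n * c n (P n))" for n
  proof -
    obtain v where v: "v < 2 ^ block n" "P (Suc n) = P n * 2 ^ block n + v"
      "snd (f (Suc n)) = snd (f n) - real v * (digit_weight n * c n (P n))"
      using f(2)[of n] unfolding step_def P_def by blast
    then have "P (Suc n) mod 2 ^ block n = v" by simp
    with v show ?thesis by simp
  qed
  have f0: "f 0 = (0, z)" using f(1)[of 0] by (simp add: inv_def)
  have P: "P \<in> paths" using digit f0 by (simp add: paths_def P_def)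
  have part: "(\<Sum>k<n. summand \<alpha> P k + \<xi> * summand \<beta> P k) = z - snd (f n)" for n
  proof (induction n)
    case (Suc n)
    have "summand \<alpha> P n + \<xi> * summand \<beta> P n =
        real (P (Suc n) mod 2 ^ block n) * (digit_weight n * c n (P n))"
      by (simp add: summand_def c_def algebra_simps)
    with Suc digit[of n] show ?case by simp
  qed (simp add: f0)
  have "(\<lambda>n. snd (f n)) \<longlonglongrightarrow> 0"
  proof (rule tendsto_sandwich[OF _ _ tendsto_const])
    show "(\<lambda>n. 2 * (1/2::real) ^ n) \<longlonglongrightarrow> 0" by (auto intro!: tendsto_mult_right_zero LIMSEQ_power_zero)
    have "bnd n \<le> path_err n" for n
    proof -
      have "bnd n \<le> 2 ^ (n\<^sup>2 + n) / 2 ^ S n"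
        unfolding bnd_def by (intro divide_right_mono power_increasing) auto
      moreover have "(0::real) \<le> 2 ^ (n\<^sup>2 + n) / 2 ^ S n" by simp
      ultimately show ?thesis unfolding path_err_def by linarith
    qed
    then show "eventually (\<lambda>n. snd (f n) \<le> 2 * (1/2) ^ n) sequentially"
      using f(1) path_err_le by (intro always_eventually allI) (meson inv_def less_imp_le order_trans)
    show "eventually (\<lambda>n. 0 \<le> snd (f n)) sequentially"
      using f(1) by (simp add: inv_def)
  qed
  then have "(\<lambda>n. \<Sum>k<n. summand \<alpha> P k + \<xi> * summand \<beta> P k) \<longlonglongrightarrow> z - 0"
    unfolding part by (intro tendsto_diff tendsto_const)
  then have "(\<lambda>k. summand \<alpha> P k + \<xi> * summand \<beta> P k) sums z" by (simp add: sums_def)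
  moreover have "(\<lambda>k. summand \<alpha> P k + \<xi> * summand \<beta> P k) sums (path_val \<alpha> P + \<xi> * path_val \<beta> P)"
    unfolding path_val_def
    by (intro sums_add sums_mult summable_sums summand_summable alpha_le beta_le)
  ultimately show ?thesis using P sums_unique2 by blast
qed

text \<open>
  If the direction of block \<open>n\<close> is annihilated by the linear form \<open>r a + s b\<close>, then the value of this
  form on the path is known up to the error of block \<open>Suc n\<close> from the digits before block \<open>n\<close> alone.
  The length of block \<open>n\<close> is not bounded in terms of these digits; this is the source of small
  Hausdorff dimension.
\<close>

lemma killed_block:
  assumes P: "P \<in> paths" and kill: "r * \<alpha> n (P n) + s * \<beta> n (P n) = 0"
  shows "\<bar>of_int r * path_val \<alpha> P + of_int s * path_val \<beta> P
     - (of_int r * path_apx \<alpha> n (P n) + of_int s * path_apx \<beta> n (P n))\<bar>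
     \<le> (\<bar>of_int r\<bar> + \<bar>of_int s\<bar>) * path_err (Suc n)"
proof -
  have "of_int r * summand \<alpha> P n + of_int s * summand \<beta> P n =
      of_int (r * \<alpha> n (P n) + s * \<beta> n (P n)) * (real (P (Suc n) mod 2 ^ block n) * digit_weight n)"
    by (simp add: summand_def algebra_simps)
  then have k: "of_int r * summand \<alpha> P n + of_int s * summand \<beta> P n = 0" unfolding kill by simp
  have apx: "path_apx \<gamma> (Suc n) (P (Suc n)) = path_apx \<gamma> n (P n) + summand \<gamma> P n" for \<gamma>
    by (simp add: path_apx_path[OF P])
  have e: "of_int r * path_val \<alpha> P + of_int s * path_val \<beta> P
     - (of_int r * path_apx \<alpha> n (P n) + of_int s * path_apx \<beta> n (P n)) =
     of_int r * (path_val \<alpha> P - path_apx \<alpha> (Suc n) (P (Suc n)))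
     + of_int s * (path_val \<beta> P - path_apx \<beta> (Suc n) (P (Suc n)))"
    using k by (simp add: apx algebra_simps)
  have "\<bar>of_int r * (path_val \<alpha> P - path_apx \<alpha> (Suc n) (P (Suc n)))\<bar> \<le> \<bar>of_int r\<bar> * path_err (Suc n)"
    unfolding abs_mult by (intro mult_left_mono path_val_apx alpha_le P) auto
  moreover have "\<bar>of_int s * (path_val \<beta> P - path_apx \<beta> (Suc n) (P (Suc n)))\<bar> \<le> \<bar>of_int s\<bar> * path_err (Suc n)"
    unfolding abs_mult by (intro mult_left_mono path_val_apx beta_le P) auto
  ultimately show ?thesis unfolding e distrib_right by linarith
qed

lemma paths_separated:
  assumes "finite F" "F \<subseteq> paths" shows "\<exists>j. inj_on (\<lambda>P. P j) F"
  using assms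
proof (induction F rule: finite_induct)
  case (insert Q F)
  then obtain j where j: "inj_on (\<lambda>P. P j) F" by auto
  have "\<exists>i. P i \<noteq> Q i" if "P \<in> F" for P using that insert(2) by (metis ext)
  then obtain i where i: "\<And>P. P \<in> F \<Longrightarrow> P (i P) \<noteq> Q (i P)" by metis
  define J where "J = Max (insert j (i ` F))"
  have J: "j \<le> J" "\<And>P. P \<in> F \<Longrightarrow> i P \<le> J" using insert(1) by (auto simp: J_def)
  have late: "P J \<noteq> P' J" if "P \<in> paths" "P' \<in> paths" "P k \<noteq> P' k" "k \<le> J" for P P' k
    using that path_div[of P k J] path_div[of P' k J] by auto
  have "inj_on (\<lambda>P. P J) (insert Q F)"
  proof (rule inj_onI, rule ccontr)
    fix P P' assume a: "P \<in> insert Q F" "P' \<in> insert Q F" "P J = P' J" "P \<noteq> P'"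
    have pp: "P \<in> paths" "P' \<in> paths" using a insert(4) by auto
    consider "P = Q" "P' \<in> F" | "P' = Q" "P \<in> F" | "P \<in> F" "P' \<in> F" using a by auto
    then show False
    proof cases
      case 1 then show False using late[OF pp, of "i P'"] i J a(3) by metis
    next
      case 2 then show False using late[OF pp, of "i P"] i J a(3) by metis
    next
      case 3
      then have "P j \<noteq> P' j" using j a(4) by (auto dest: inj_onD)
      then show False using late[OF pp _ J(1)] a(3) by simp
    qed
  qed
  then show ?case ..
qed simp

text \<open>
  The signs are built into the generators, so that sums of a fixed length are the sums of elements
  of one compact set.
\<close>

definition path_gens :: "real set" where
  "path_gens = path_val \<alpha> ` paths \<union> path_val \<beta> ` paths
     \<union> uminus ` path_val \<alpha> ` paths \<union> uminus ` path_val \<beta> ` paths"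

definition path_sums :: "nat \<Rightarrow> real set" where
  "path_sums m = {\<Sum>e<m. g e | g. \<forall>e<m. g e \<in> path_gens}"

definition path_group :: "real set" where "path_group = (\<Union>m. path_sums m)"

lemma path_sums_0: "path_sums 0 = {0}" by (simp add: path_sums_def)

lemma path_sums_Suc: "path_sums (Suc m) = {x + y | x y. x \<in> path_sums m \<and> y \<in> path_gens}"
proof (intro set_eqI iffI)
  fix v assume "v \<in> path_sums (Suc m)"
  then obtain g where g: "v = (\<Sum>e<Suc m. g e)" "\<forall>e<Suc m. g e \<in> path_gens"
    unfolding path_sums_def by blast
  then have "(\<Sum>e<m. g e) \<in> path_sums m" unfolding path_sums_def by auto
  with g show "v \<in> {x + y | x y. x \<in> path_sums m \<and> y \<in> path_gens}" by auto
next
  fix v assume "v \<in> {x + y | x y. x \<in> path_sums m \<and> y \<in> path_gens}"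
  then obtain g y where g: "v = (\<Sum>e<m. g e) + y" "\<forall>e<m. g e \<in> path_gens" "y \<in> path_gens"
    unfolding path_sums_def by blast
  have "v = (\<Sum>e<Suc m. (g(m := y)) e)" using g(1) by simp
  moreover have "\<forall>e<Suc m. (g(m := y)) e \<in> path_gens" using g(2,3) by simp
  ultimately show "v \<in> path_sums (Suc m)" unfolding path_sums_def by blast
qed

lemma path_sums_add: "x \<in> path_sums m \<Longrightarrow> y \<in> path_sums n \<Longrightarrow> x + y \<in> path_sums (m + n)"
proof (induction n arbitrary: y)
  case 0 then show ?case by (simp add: path_sums_0)
next
  case (Suc n)
  then obtain u w where y: "y = u + w" "u \<in> path_sums n" "w \<in> path_gens"
    unfolding path_sums_Suc by blast
  with Suc have "x + u \<in> path_sums (m + n)" by simp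
  with y show ?case unfolding add_Suc_right path_sums_Suc
    by (intro CollectI exI[of _ "x + u"] exI[of _ w]) simp
qed

lemma path_gens_uminus: "y \<in> path_gens \<Longrightarrow> - y \<in> path_gens"
  unfolding path_gens_def by auto

lemma path_sums_uminus: "y \<in> path_sums n \<Longrightarrow> - y \<in> path_sums n"
proof (induction n arbitrary: y)
  case 0 then show ?case by (simp add: path_sums_0)
next
  case (Suc n)
  then obtain u w where y: "y = u + w" "u \<in> path_sums n" "w \<in> path_gens"
    unfolding path_sums_Suc by blast
  with Suc path_gens_uminus have "- u \<in> path_sums n" "- w \<in> path_gens" by simp_all
  with y show ?case unfolding path_sums_Suc
    by (intro CollectI exI[of _ "- u"] exI[of _ "- w"]) simp
qed

lemma path_group_subgroup: "additive_subgroup_real path_group"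
  unfolding additive_subgroup_real_def
proof (intro conjI ballI)
  have "0 \<in> path_sums 0" by (simp add: path_sums_0)
  then show "0 \<in> path_group" unfolding path_group_def by (rule UN_I[OF UNIV_I])
next
  fix x y assume "x \<in> path_group" "y \<in> path_group"
  then obtain m n where "x \<in> path_sums m" "y \<in> path_sums n" unfolding path_group_def by auto
  from path_sums_add[OF this] show "x + y \<in> path_group"
    unfolding path_group_def by (rule UN_I[OF UNIV_I])
next
  fix x assume "x \<in> path_group"
  then obtain m where "x \<in> path_sums m" unfolding path_group_def by auto
  from path_sums_uminus[OF this] show "- x \<in> path_group"
    unfolding path_group_def by (rule UN_I[OF UNIV_I])
qed

lemma compact_path_gens: "compact path_gens"
  unfolding path_gens_def
  by (intro compact_Un compact_negations[unfolded image_def[symmetric]] compact_path_vals alpha_le beta_le)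

lemma compact_path_sums: "compact (path_sums m)"
proof (induction m)
  case 0 show ?case by (simp add: path_sums_0)
next
  case (Suc m)
  from compact_sums[OF this compact_path_gens] show ?case unfolding path_sums_Suc .
qed

lemma path_val_in_group:
  assumes "P \<in> paths" shows "path_val \<alpha> P \<in> path_group" "path_val \<beta> P \<in> path_group"
proof -
  have "y \<in> path_group" if "y \<in> path_gens" for y
  proof -
    have "0 + y \<in> path_sums (Suc 0)" using that unfolding path_sums_Suc path_sums_0 by blast
    then show ?thesis unfolding path_group_def by auto
  qed
  with assms show "path_val \<alpha> P \<in> path_group" "path_val \<beta> P \<in> path_group"
    by (simp_all add: path_gens_def)
qed

lemma path_group_combination:
  assumes "y \<in> path_group"
  shows "\<exists>F r s. finite F \<and> F \<subseteq> paths \<and>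
     y = (\<Sum>P\<in>F. of_int (r P) * path_val \<alpha> P + of_int (s P) * path_val \<beta> P)"
proof -
  define comb where "comb y \<longleftrightarrow> (\<exists>F r s. finite F \<and> F \<subseteq> paths \<and>
     y = (\<Sum>P\<in>F. of_int (r P) * path_val \<alpha> P + of_int (s P) * path_val \<beta> P))" for y
  have single: "comb (of_int r * path_val \<alpha> P + of_int s * path_val \<beta> P)" if "P \<in> paths" for P r s
    unfolding comb_def using that by (intro exI[of _ "{P}"] exI[of _ "\<lambda>_. r"] exI[of _ "\<lambda>_. s"]) simp
  have add: "comb (y + y')" if yy: "comb y" "comb y'" for y y'
  proof -
    from yy(1) obtain F r s where 1: "finite F" "F \<subseteq> paths"
      "y = (\<Sum>P\<in>F. of_int (r P) * path_val \<alpha> P + of_int (s P) * path_val \<beta> P)"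
      unfolding comb_def by blast
    from yy(2) obtain F' r' s' where 2: "finite F'" "F' \<subseteq> paths"
      "y' = (\<Sum>P\<in>F'. of_int (r' P) * path_val \<alpha> P + of_int (s' P) * path_val \<beta> P)"
      unfolding comb_def by blast
    define ext where "ext G q P = (if P \<in> G then q P else 0)" for G and q :: "(nat \<Rightarrow> nat) \<Rightarrow> int" and P
    have e: "(\<Sum>P\<in>G. of_int (q P) * path_val \<alpha> P + of_int (q' P) * path_val \<beta> P) =
        (\<Sum>P\<in>F \<union> F'. of_int (ext G q P) * path_val \<alpha> P + of_int (ext G q' P) * path_val \<beta> P)"
      if "G \<subseteq> F \<union> F'" for G q q'
      using 1(1) 2(1) that by (intro sum.mono_neutral_cong_left) (auto simp: ext_def)
    have "y + y' = (\<Sum>P\<in>F \<union> F'. of_int (ext F r P + ext F' r' P) * path_val \<alpha> P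
        + of_int (ext F s P + ext F' s' P) * path_val \<beta> P)"
      unfolding 1(3) 2(3) e[OF Un_upper1] e[OF Un_upper2] sum.distrib[symmetric]
      by (rule sum.cong) (simp_all add: algebra_simps)
    then show ?thesis unfolding comb_def using 1(1,2) 2(1,2)
      by (intro exI[of _ "F \<union> F'"] exI[of _ "\<lambda>P. ext F r P + ext F' r' P"]
        exI[of _ "\<lambda>P. ext F s P + ext F' s' P"]) simp
  qed
  have gens: "comb y" if "y \<in> path_gens" for y
    using that single[of _ 1 0] single[of _ 0 1] single[of _ "-1" 0] single[of _ 0 "-1"]
    unfolding path_gens_def by auto
  have "comb y" if "y \<in> path_sums m" for m y
    using that
  proof (induction m arbitrary: y)
    case 0
    then show ?case using single[OF zero_path(1), of 0 0] by (simp add: path_sums_0)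
  next
    case (Suc m)
    then show ?case using add gens unfolding path_sums_Suc by blast
  qed
  with assms show ?thesis unfolding path_group_def comb_def by blast
qed

text \<open>
  Equal paths are merged, and finitely many different paths are told apart by their digits up to
  some block \<open>j\<close>.  Hence an element of the group is an integer combination over paths with different
  prefixes, and directions may be prescribed for each of them independently.
\<close>

lemma path_group_combination_list:
  assumes "y \<in> path_group"
  shows "\<exists>j (L :: (nat \<times> int \<times> int) list) P. distinct (map fst L) \<and>
     (\<forall>e<length L. P e \<in> paths \<and> P e j = fst (L ! e)) \<and>
     y = (\<Sum>e<length L. of_int (fst (snd (L ! e))) * path_val \<alpha> (P e)
        + of_int (snd (snd (L ! e))) * path_val \<beta> (P e))"
proof -
  obtain F r s where F: "finite F" "F \<subseteq> paths"
    "y = (\<Sum>P\<in>F. of_int (r P) * path_val \<alpha> P + of_int (s P) * path_val \<beta> P)"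
    using path_group_combination[OF assms] by blast
  obtain j where j: "inj_on (\<lambda>P. P j) F" using paths_separated[OF F(1,2)] by blast
  obtain xs where xs: "set xs = F" "distinct xs" using finite_distinct_list[OF F(1)] by blast
  define L where "L = map (\<lambda>P. (P j, r P, s P)) xs"
  have "distinct (map fst L)" using xs j by (simp add: L_def o_def distinct_map)
  moreover have "\<forall>e<length L. xs ! e \<in> paths \<and> (xs ! e) j = fst (L ! e)"
    using xs F(2) nth_mem[of _ xs] by (auto simp: L_def)
  moreover have "y = (\<Sum>e<length L. of_int (fst (snd (L ! e))) * path_val \<alpha> (xs ! e)
        + of_int (snd (snd (L ! e))) * path_val \<beta> (xs ! e))"
  proof -
    have "bij_betw (\<lambda>e. xs ! e) {..<length xs} F" using xs by (intro bij_betw_nth) auto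
    from sum.reindex_bij_betw[OF this, symmetric] show ?thesis
      unfolding F(3) by (simp add: L_def)
  qed
  ultimately show ?thesis by (intro exI[of _ j] exI[of _ L] exI[of _ "\<lambda>e. xs ! e"]) simp
qed

end

section \<open>Rational hulls\<close>

definition rat_hull :: "real set \<Rightarrow> real set" where
  "rat_hull G = {y. \<exists>k::nat. real (Suc k) * y \<in> G}"

lemma subgroup_int_mult:
  assumes "additive_subgroup_real G" "y \<in> G" shows "of_int k * y \<in> G"
proof -
  have n: "real n * y \<in> G" for n
    using assms by (induction n) (auto simp: additive_subgroup_real_def distrib_right)
  show ?thesis
  proof (cases "0 \<le> k")
    case True then show ?thesis using n[of "nat k"] by simp
  next
    case False
    have "real (nat (- k)) = - of_int k" using False by simp
    moreover have "- (real (nat (- k)) * y) \<in> G"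
      using n assms(1) unfolding additive_subgroup_real_def by blast
    ultimately show ?thesis by simp
  qed
qed

lemma subgroup_sum:
  assumes "additive_subgroup_real G" "additive_subgroup_real H"
  shows "additive_subgroup_real {g + h | g h. g \<in> G \<and> h \<in> H}"
  unfolding additive_subgroup_real_def
proof (intro conjI ballI)
  show "0 \<in> {g + h | g h. g \<in> G \<and> h \<in> H}"
    using assms unfolding additive_subgroup_real_def by force
next
  fix a b assume "a \<in> {g + h | g h. g \<in> G \<and> h \<in> H}" "b \<in> {g + h | g h. g \<in> G \<and> h \<in> H}"
  then obtain g h g' h' where "a = g + h" "b = g' + h'" "g \<in> G" "h \<in> H" "g' \<in> G" "h' \<in> H" by auto
  then show "a + b \<in> {g + h | g h. g \<in> G \<and> h \<in> H}"
    using assms unfolding additive_subgroup_real_def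
    by (intro CollectI exI[of _ "g + g'"] exI[of _ "h + h'"]) simp
next
  fix a assume "a \<in> {g + h | g h. g \<in> G \<and> h \<in> H}"
  then obtain g h where "a = g + h" "g \<in> G" "h \<in> H" by auto
  then show "- a \<in> {g + h | g h. g \<in> G \<and> h \<in> H}"
    using assms unfolding additive_subgroup_real_def
    by (intro CollectI exI[of _ "- g"] exI[of _ "- h"]) simp
qed

lemma rat_subspace_iff:
  "rat_subspace A \<longleftrightarrow> 0 \<in> A \<and> (\<forall>a\<in>A. \<forall>b\<in>A. a + b \<in> A) \<and> (\<forall>q. \<forall>a\<in>A. of_rat q * a \<in> A)"
proof -
  interpret vector_space rat_scale by (rule vector_space_rat_scale)
  show ?thesis unfolding subspace_def rat_scale_def by blast
qed

lemma rat_subspace_subgroup: "rat_subspace A \<Longrightarrow> additive_subgroup_real A"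
  unfolding rat_subspace_iff additive_subgroup_real_def
  using of_rat_minus[of 1, where ?'a = real] by (metis mult_minus1 of_rat_1)

lemma rat_hull_subset: "G \<subseteq> rat_hull G"
  unfolding rat_hull_def by (auto intro: exI[of _ 0])

lemma rat_hull_subspace:
  assumes "additive_subgroup_real G" shows "rat_subspace (rat_hull G)"
  unfolding rat_subspace_iff
proof (intro conjI ballI allI)
  show "0 \<in> rat_hull G" using assms by (simp add: rat_hull_def additive_subgroup_real_def)
next
  fix a b assume "a \<in> rat_hull G" "b \<in> rat_hull G"
  then obtain k l where kl: "real (Suc k) * a \<in> G" "real (Suc l) * b \<in> G" by (auto simp: rat_hull_def)
  have "of_int (int (Suc l)) * (real (Suc k) * a) + of_int (int (Suc k)) * (real (Suc l) * b) \<in> G"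
    using subgroup_int_mult[OF assms kl(1)] subgroup_int_mult[OF assms kl(2)] assms
    unfolding additive_subgroup_real_def by blast
  also have "of_int (int (Suc l)) * (real (Suc k) * a) + of_int (int (Suc k)) * (real (Suc l) * b)
      = real (Suc (Suc k * Suc l - 1)) * (a + b)"
    by (simp add: algebra_simps)
  finally show "a + b \<in> rat_hull G" unfolding rat_hull_def by blast
next
  fix q a assume "a \<in> rat_hull G"
  then obtain k where k: "real (Suc k) * a \<in> G" by (auto simp: rat_hull_def)
  obtain m n where q: "q = Fract m n" "n > 0" by (cases q) auto
  have "of_int m * (real (Suc k) * a) \<in> G" using subgroup_int_mult[OF assms k] .
  also have "of_int m * (real (Suc k) * a) = real (Suc (Suc k * nat n - 1)) * (of_rat q * a)"
  proof -
    have "0 < Suc k * nat n" using q(2) by simp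
    then have "Suc (Suc k * nat n - 1) = Suc k * nat n" by (rule Suc_diff_1)
    then have "real (Suc (Suc k * nat n - 1)) = real (Suc k) * of_int n"
      using q(2) by (simp add: algebra_simps)
    moreover have "of_rat q = (of_int m / of_int n :: real)" using q by (simp add: of_rat_rat)
    ultimately show ?thesis using q(2) by simp
  qed
  finally show "of_rat q * a \<in> rat_hull G" unfolding rat_hull_def by blast
qed

text \<open>
  Replacing \<open>\<xi>\<close> by \<open>\<xi> - k\<close> does not change the sum set, and homogeneity reduces everything to the unit
  interval.
\<close>

lemma rat_subspace_sum_UNIV:
  assumes A: "rat_subspace A"
    and unit: "\<And>z. 0 \<le> z \<Longrightarrow> z < 1 \<Longrightarrow> \<exists>a\<in>A. \<exists>b\<in>A. a + (\<xi> - of_int k) * b = z"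
  shows "{a + \<xi> * b | a b. a \<in> A \<and> b \<in> A} = UNIV"
proof -
  note G = rat_subspace_subgroup[OF A]
  have "\<exists>a\<in>A. \<exists>b\<in>A. z = a + \<xi> * b" for z :: real
  proof -
    define n where "n = \<lceil>\<bar>z\<bar>\<rceil> + 1"
    have n: "\<bar>z\<bar> < of_int n" unfolding n_def by linarith
    then have n0: "(0::real) < of_int n" by linarith
    have "0 \<le> \<bar>z\<bar> / of_int n" "\<bar>z\<bar> / of_int n < 1" using n n0 by (simp_all add: field_simps)
    then obtain a b where ab: "a \<in> A" "b \<in> A" "a + (\<xi> - of_int k) * b = \<bar>z\<bar> / of_int n"
      using unit by blast
    define m where "m = (if 0 \<le> z then n else - n)"
    have z: "z = of_int m * (\<bar>z\<bar> / of_int n)" using n0 by (simp add: m_def)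
    define a' where "a' = of_int m * a + - of_int k * (of_int m * b)"
    have "- of_int k * (of_int m * b) \<in> A"
      using subgroup_int_mult[OF G subgroup_int_mult[OF G ab(2)], of "- k" m] by (simp only: of_int_minus)
    then have "a' \<in> A" using subgroup_int_mult[OF G ab(1), of m] G
      unfolding a'_def additive_subgroup_real_def by blast
    moreover have "of_int m * b \<in> A" by (rule subgroup_int_mult[OF G ab(2)])
    moreover have "z = a' + \<xi> * (of_int m * b)"
      by (subst z, subst ab(3)[symmetric]) (simp add: a'_def algebra_simps)
    ultimately show ?thesis by blast
  qed
  then show ?thesis by blast
qed

section \<open>Effectively closed pieces\<close>

lemma recz_comp: "recz G f \<Longrightarrow> recf G g \<Longrightarrow> recz G (\<lambda>n. f (g n))"
  unfolding recz_def using recf_comp[of G "\<lambda>n. nat (f n)" g] recf_comp[of G "\<lambda>n. nat (- f n)" g] by blast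

lemma recf_comp2:
  "recf G (\<lambda>p. F (pfst p) (psnd p)) \<Longrightarrow> recf G g \<Longrightarrow> recf G h \<Longrightarrow> recf G (\<lambda>n. F (g n) (h n))"
  using recf_comp[of G "\<lambda>p. F (pfst p) (psnd p)" "\<lambda>n. prod_encode (g n, h n)"] recf_pair[of G g h] by simp

lemma recp_comp2:
  "recp G (\<lambda>p. F (pfst p) (psnd p)) \<Longrightarrow> recf G g \<Longrightarrow> recf G h \<Longrightarrow> recp G (\<lambda>n. F (g n) (h n))"
  using recp_comp[of G "\<lambda>p. F (pfst p) (psnd p)" "\<lambda>n. prod_encode (g n, h n)"] recf_pair[of G g h] by simp

lemma recz_comp2:
  "recz G (\<lambda>p. F (pfst p) (psnd p)) \<Longrightarrow> recf G g \<Longrightarrow> recf G h \<Longrightarrow> recz G (\<lambda>n. F (g n) (h n))"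
  using recz_comp[of G "\<lambda>p. F (pfst p) (psnd p)" "\<lambda>n. prod_encode (g n, h n)"] recf_pair[of G g h] by simp

text \<open>
  The complement is enumerated through the intervals of two units around those integers \<open>g\<close> that are
  far from all admitted centres at some precision.  The slack of \<open>2\<close> in the last hypothesis accounts
  for the rounding to \<open>g\<close> and for the length of the interval.
\<close>

lemma uniformly_Pi01I:
  fixes den E b :: "nat \<Rightarrow> nat \<Rightarrow> nat" and num :: "nat \<Rightarrow> nat \<Rightarrow> nat \<Rightarrow> int"
    and R :: "nat \<Rightarrow> nat \<Rightarrow> nat \<Rightarrow> bool" and T :: "nat \<Rightarrow> real set"
  assumes rec: "recf {char_fun z} (\<lambda>p. den (pfst p) (psnd p))" "recf {char_fun z} (\<lambda>p. E (pfst p) (psnd p))"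
      "recf {char_fun z} (\<lambda>p. b (pfst p) (psnd p))"
      "recz {char_fun z} (\<lambda>p. num (pfst p) (pfst (psnd p)) (psnd (psnd p)))"
      "recp {char_fun z} (\<lambda>p. R (pfst p) (pfst (psnd p)) (psnd (psnd p)))"
    and den: "\<And>i n. 0 < den i n"
    and sound: "\<And>i n y. y \<in> T i \<Longrightarrow> \<exists>t<b i n. R i n t \<and> \<bar>real (den i n) * y - of_int (num i n t)\<bar> \<le> real (E i n)"
    and complete: "\<And>i y. (\<And>n. \<exists>t<b i n. R i n t \<and> \<bar>real (den i n) * y - of_int (num i n t)\<bar> \<le> real (E i n) + 2)
        \<Longrightarrow> y \<in> T i"
  shows "uniformly_Pi01 z T"
proof -
  define code where "code i n g = prod_encode (prod_encode (int_encode (g - 1), int_encode (int (den i n))),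
     prod_encode (int_encode (g + 1), int_encode (int (den i n))))" for i n g
  have code: "rat_interval (code i n g) = {(of_int g - 1) / real (den i n) <..< (of_int g + 1) / real (den i n)}"
    for i n g
    using den[of i n] by (simp add: code_def rat_interval_def nat_to_rat_surj_def of_rat_rat)
  define C where "C e m \<longleftrightarrow> psnd e = code (pfst e) (pfst m) (int_decode (psnd m)) \<and>
     (\<forall>t<b (pfst e) (pfst m). R (pfst e) (pfst m) t \<longrightarrow>
        int (E (pfst e) (pfst m)) + 1 < \<bar>num (pfst e) (pfst m) t - int_decode (psnd m)\<bar>)" for e m
  have num3: "recz {char_fun z} (\<lambda>n. num (f n) (g n) (h n))"
    if "recf {char_fun z} f" "recf {char_fun z} g" "recf {char_fun z} h" for f g h
    using recz_comp[OF rec(4), of "\<lambda>n. prod_encode (f n, prod_encode (g n, h n))"] that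
    by (simp add: recf_pair)
  have R3: "recp {char_fun z} (\<lambda>n. R (f n) (g n) (h n))"
    if "recf {char_fun z} f" "recf {char_fun z} g" "recf {char_fun z} h" for f g h
    using recp_comp[OF rec(5), of "\<lambda>n. prod_encode (f n, prod_encode (g n, h n))"] that
    by (simp add: recf_pair)
  have "recp {char_fun z} (\<lambda>p. C (pfst p) (psnd p))"
    unfolding C_def code_def
    by (intro recI num3 R3 recf_comp2[OF rec(1)] recf_comp2[OF rec(2)] recf_comp2[OF rec(3)])
  from ce_in_Ex[OF this] have ce: "ce_in z {e. \<exists>m. C e m}" .
  have "- T i = (\<Union>n\<in>{n. prod_encode (i, n) \<in> {e. \<exists>m. C e m}}. rat_interval n)" for i
  proof (intro equalityI subsetI)
    fix y assume "y \<in> - T i"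
    then obtain n where n: "\<And>t. t < b i n \<Longrightarrow> R i n t \<Longrightarrow>
        real (E i n) + 2 < \<bar>real (den i n) * y - of_int (num i n t)\<bar>"
      using complete[of i y] by (meson ComplD not_le)
    define g where "g = \<lfloor>real (den i n) * y\<rfloor>"
    have "int (E i n) + 1 < \<bar>num i n t - g\<bar>" if "t < b i n" "R i n t" for t
    proof -
      have "real (E i n) + 1 < \<bar>of_int (num i n t) - of_int g\<bar>"
        using n[OF that] unfolding g_def by linarith
      then show ?thesis by linarith
    qed
    then have "C (prod_encode (i, code i n g)) (prod_encode (n, int_encode g))"
      unfolding C_def by simp
    moreover have "y \<in> rat_interval (code i n g)"
    proof -
      have "of_int g - 1 < y * real (den i n)" "y * real (den i n) < of_int g + 1"
        unfolding g_def by (simp_all add: mult.commute) linarith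
      then show ?thesis unfolding code using den[of i n]
        by (simp add: pos_divide_less_eq pos_less_divide_eq)
    qed
    ultimately show "y \<in> (\<Union>n\<in>{n. prod_encode (i, n) \<in> {e. \<exists>m. C e m}}. rat_interval n)" by blast
  next
    fix y assume "y \<in> (\<Union>n\<in>{n. prod_encode (i, n) \<in> {e. \<exists>m. C e m}}. rat_interval n)"
    then obtain w m where "C (prod_encode (i, w)) m" "y \<in> rat_interval w" by blast
    then obtain n g where y: "y \<in> rat_interval (code i n g)" and
      far: "\<And>t. t < b i n \<Longrightarrow> R i n t \<Longrightarrow> int (E i n) + 1 < \<bar>num i n t - g\<bar>"
      unfolding C_def by auto
    have g: "of_int g - 1 < real (den i n) * y" "real (den i n) * y < of_int g + 1"
      using y den[of i n] unfolding code
      by (simp_all add: pos_divide_less_eq pos_less_divide_eq mult.commute)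
    show "y \<in> - T i"
    proof
      assume "y \<in> T i"
      then obtain t where t: "t < b i n" "R i n t" "\<bar>real (den i n) * y - of_int (num i n t)\<bar> \<le> real (E i n)"
        using sound by blast
      have "real (E i n) + 1 < \<bar>of_int (num i n t) - of_int g\<bar>" using far[OF t(1,2)] by linarith
      with g t(3) show False by linarith
    qed
  qed
  with ce show ?thesis unfolding uniformly_Pi01_def by blast
qed

definition cell :: "nat \<Rightarrow> int \<Rightarrow> real set" where
  "cell N g = {of_int g / 2 ^ N .. (of_int g + 1) / 2 ^ N}"

text \<open>
  Containment in a single enumerated interval is decidable, unlike containment in the complement;
  by a Lebesgue number argument every compact subset of the complement is nevertheless
  eventually discarded.
\<close>

definition removed :: "(nat \<Rightarrow> nat \<Rightarrow> bool) \<Rightarrow> nat \<Rightarrow> nat \<Rightarrow> int \<Rightarrow> bool" where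
  "removed D i N g \<longleftrightarrow> (\<exists>w<N. D (prod_encode (i, w)) N \<and> cell N g \<subseteq> rat_interval w)"

definition enumerates_complements :: "(nat \<Rightarrow> nat \<Rightarrow> bool) \<Rightarrow> (nat \<Rightarrow> real set) \<Rightarrow> bool" where
  "enumerates_complements D Q \<longleftrightarrow> (\<forall>e s t. D e s \<longrightarrow> s \<le> t \<longrightarrow> D e t) \<and>
     (\<forall>i. - Q i = (\<Union>w\<in>{w. \<exists>s. D (prod_encode (i, w)) s}. rat_interval w))"

text \<open>
  A code with denominator \<open>0\<close> denotes \<open>0\<close>, and negative denominators occur; multiplying by the square
  of the denominator treats both signs at once.
\<close>

lemma rat_code_less_iff:
  "(of_rat (nat_to_rat_surj c) < (of_int g / 2 ^ N :: real)) \<longleftrightarrow>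
    (if int_decode (psnd c) = 0 then 0 < g
     else int_decode (pfst c) * int_decode (psnd c) * int (2 ^ N) < g * (int_decode (psnd c) * int_decode (psnd c)))"
  "((of_int g / 2 ^ N :: real) < of_rat (nat_to_rat_surj c)) \<longleftrightarrow>
    (if int_decode (psnd c) = 0 then g < 0
     else g * (int_decode (psnd c) * int_decode (psnd c)) < int_decode (pfst c) * int_decode (psnd c) * int (2 ^ N))"
proof -
  define a b where "a = int_decode (pfst c)" and "b = int_decode (psnd c)"
  have r: "nat_to_rat_surj c = Fract a b" by (simp add: nat_to_rat_surj_def a_def b_def case_prod_unfold Let_def)
  have eq: "of_rat (Fract a b) = (of_int (a * b) / of_int (b * b) :: real)" if "b \<noteq> 0"
    using that by (simp add: of_rat_rat)
  have p: "0 < (of_int (b * b) :: real)" if "b \<noteq> 0" using that by (simp add: zero_less_mult_iff) linarith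
  have cross: "x / u < y / v \<longleftrightarrow> x * v < y * u" if "0 < u" "0 < v" for x y u v :: real
    using that by (simp add: field_simps)
  have z: "of_int (x * int (2 ^ N)) = (of_int x * 2 ^ N :: real)" for x by simp
  have "of_int (a * b) / of_int (b * b) < (of_int g / 2 ^ N :: real) \<longleftrightarrow> a * b * int (2 ^ N) < g * (b * b)"
    "(of_int g / 2 ^ N :: real) < of_int (a * b) / of_int (b * b) \<longleftrightarrow> g * (b * b) < a * b * int (2 ^ N)"
    if "b \<noteq> 0"
  proof -
    have "of_int (a * b) / of_int (b * b) < (of_int g / 2 ^ N :: real)
        \<longleftrightarrow> of_int (a * b) * 2 ^ N < (of_int g * of_int (b * b) :: real)"
      using p[OF that] by (intro cross) simp_all
    then show "of_int (a * b) / of_int (b * b) < (of_int g / 2 ^ N :: real) \<longleftrightarrow> a * b * int (2 ^ N) < g * (b * b)"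
      unfolding z[symmetric] of_int_mult[symmetric] of_int_less_iff .
    have "(of_int g / 2 ^ N :: real) < of_int (a * b) / of_int (b * b)
        \<longleftrightarrow> of_int g * of_int (b * b) < (of_int (a * b) * 2 ^ N :: real)"
      using p[OF that] by (intro cross) simp_all
    then show "(of_int g / 2 ^ N :: real) < of_int (a * b) / of_int (b * b) \<longleftrightarrow> g * (b * b) < a * b * int (2 ^ N)"
      unfolding z[symmetric] of_int_mult[symmetric] of_int_less_iff .
  qed
  moreover have "of_rat (Fract a 0) = (0::real)" by (simp add: rat_number_collapse)
  ultimately show "(of_rat (nat_to_rat_surj c) < (of_int g / 2 ^ N :: real)) \<longleftrightarrow>
    (if int_decode (psnd c) = 0 then 0 < g
     else int_decode (pfst c) * int_decode (psnd c) * int (2 ^ N) < g * (int_decode (psnd c) * int_decode (psnd c)))"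
    "((of_int g / 2 ^ N :: real) < of_rat (nat_to_rat_surj c)) \<longleftrightarrow>
    (if int_decode (psnd c) = 0 then g < 0
     else g * (int_decode (psnd c) * int_decode (psnd c)) < int_decode (pfst c) * int_decode (psnd c) * int (2 ^ N))"
    unfolding r a_def[symmetric] b_def[symmetric] using eq
    by (cases "b = 0"; simp add: zero_less_divide_iff divide_less_0_iff)+
qed

lemma cell_subset_interval_iff:
  "cell N g \<subseteq> rat_interval w \<longleftrightarrow>
     of_rat (nat_to_rat_surj (pfst w)) < (of_int g / 2 ^ N :: real) \<and>
     (of_int (g + 1) / 2 ^ N :: real) < of_rat (nat_to_rat_surj (psnd w))"
proof -
  have "(of_int g / 2 ^ N :: real) \<le> (of_int g + 1) / 2 ^ N" by (simp add: divide_right_mono)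
  then show ?thesis unfolding cell_def rat_interval_def by (auto simp: subset_iff)
qed

lemma recp_removed:
  assumes D: "recp G (\<lambda>p. D (pfst p) (psnd p))" and f: "recf G f" and h: "recf G h" and g: "recz G g"
  shows "recp G (\<lambda>n. removed D (f n) (h n) (g n))"
  unfolding removed_def cell_subset_interval_iff rat_code_less_iff
  if_bool_eq_conj
  by (intro recI recp_comp2[OF D] recf_comp[OF f] recf_comp[OF h] recz_comp[OF g] f h g)

lemma removed_disjoint:
  assumes "enumerates_complements D Q" "removed D i N g" shows "cell N g \<inter> Q i = {}"
proof -
  obtain w where w: "D (prod_encode (i, w)) N" "cell N g \<subseteq> rat_interval w"
    using assms(2) unfolding removed_def by blast
  have "- Q i = (\<Union>w\<in>{w. \<exists>s. D (prod_encode (i, w)) s}. rat_interval w)"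
    using assms(1) unfolding enumerates_complements_def by blast
  with w have "cell N g \<subseteq> - Q i" by blast
  then show ?thesis by blast
qed

lemma open_rat_interval: "open (rat_interval w)" by (simp add: rat_interval_def)

lemma cell_bounds: "x \<in> cell N g \<longleftrightarrow> of_int g \<le> x * 2 ^ N \<and> x * 2 ^ N \<le> of_int g + 1"
  by (simp add: cell_def pos_divide_le_eq pos_le_divide_eq)

lemma floor_cell: "x \<in> cell N \<lfloor>x * 2 ^ N\<rfloor>"
  unfolding cell_bounds by linarith

lemma small_cells_removed:
  assumes D: "enumerates_complements D Q" and C: "compact C" "C \<inter> Q i = {}"
  shows "\<exists>N0. \<forall>N\<ge>N0. \<forall>g. cell N g \<subseteq> C \<longrightarrow> removed D i N g"
proof (cases "C = {}")
  case True
  have "cell N g \<noteq> {}" for N g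
    using floor_cell[of "of_int g / 2 ^ N" N] by auto
  with True show ?thesis by auto
next
  case False
  let ?W = "{w. \<exists>s. D (prod_encode (i, w)) s}"
  have mono: "D e s \<Longrightarrow> s \<le> t \<Longrightarrow> D e t" for e s t
    using D unfolding enumerates_complements_def by blast
  have "- Q i = (\<Union>w\<in>?W. rat_interval w)"
    using D unfolding enumerates_complements_def by blast
  with C(2) have "C \<subseteq> (\<Union>w\<in>?W. rat_interval w)" by blast
  then obtain F where F: "F \<subseteq> ?W" "finite F" "C \<subseteq> (\<Union>w\<in>F. rat_interval w)"
    using compactE_image[OF C(1), of ?W rat_interval] open_rat_interval by metis
  have "F \<noteq> {}" using F(3) False by auto
  have "\<forall>w\<in>F. \<exists>s. D (prod_encode (i, w)) s" using F(1) by blast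
  then obtain s where s: "\<And>w. w \<in> F \<Longrightarrow> D (prod_encode (i, w)) (s w)" by (auto simp: bchoice_iff)
  have ne: "rat_interval ` F \<noteq> {}" using \<open>F \<noteq> {}\<close> by simp
  have op: "open B" if "B \<in> rat_interval ` F" for B using that open_rat_interval by auto
  have "\<exists>\<delta>>0. \<forall>T. T \<subseteq> C \<longrightarrow> diameter T < \<delta> \<longrightarrow> (\<exists>B\<in>rat_interval ` F. T \<subseteq> B)"
    by (rule Lebesgue_number_lemma[OF C(1) ne F(3) op]) blast+
  then obtain \<delta> where \<delta>: "0 < \<delta>"
    "\<And>T. T \<subseteq> C \<Longrightarrow> diameter T < \<delta> \<Longrightarrow> \<exists>B\<in>rat_interval ` F. T \<subseteq> B"
    by blast
  obtain M where M: "(1/2::real) ^ M < \<delta>" using real_arch_pow_inv[OF \<delta>(1), of "1/2"] by auto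
  define N0 where "N0 = Max (insert M (Suc ` F \<union> s ` F))"
  have fin: "finite (insert M (Suc ` F \<union> s ` F))" using F(2) by simp
  have N0: "M \<le> N0" "\<And>w. w \<in> F \<Longrightarrow> w < N0" "\<And>w. w \<in> F \<Longrightarrow> s w \<le> N0"
    using Max_ge[OF fin] unfolding N0_def by (auto simp: Suc_le_eq[symmetric])
  have "removed D i N g" if N: "N0 \<le> N" and g: "cell N g \<subseteq> C" for N g
  proof -
    have "(of_int g :: real) / 2 ^ N \<le> (of_int g + 1) / 2 ^ N" by (simp add: divide_right_mono)
    then have "diameter (cell N g) = 1 / 2 ^ N"
      unfolding cell_def by (simp add: add_divide_distrib)
    also have "\<dots> = (1/2) ^ N" by (simp add: power_one_over)
    also have "\<dots> \<le> (1/2) ^ M" using N N0(1) by (intro power_decreasing) auto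
    also note M
    finally obtain w where w: "w \<in> F" "cell N g \<subseteq> rat_interval w" using \<delta>(2)[OF g] by blast
    then show ?thesis unfolding removed_def
      using N0(2)[OF w(1)] mono[OF s[OF w(1)], of N] N0(3)[OF w(1)] N by (intro exI[of _ w]) simp
  qed
  then show ?thesis by blast
qed

lemma exists_base_expansion:
  fixes d :: "nat \<Rightarrow> nat"
  assumes "\<And>e. e < m \<Longrightarrow> d e < b"
  shows "\<exists>q<b ^ m. \<forall>e<m. q div b ^ e mod b = d e"
  using assms
proof (induction m)
  case (Suc m)
  then obtain q where q: "q < b ^ m" "\<forall>e<m. q div b ^ e mod b = d e" by auto
  have dm: "d m < b" using Suc.prems by simp
  let ?q = "q + d m * b ^ m"
  have "?q < b ^ m + d m * b ^ m" using q(1) by simp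
  also have "\<dots> = Suc (d m) * b ^ m" by simp
  also have "\<dots> \<le> b * b ^ m" using dm by (intro mult_le_mono1) simp
  also have "\<dots> = b ^ Suc m" by simp
  finally have "?q < b ^ Suc m" .
  moreover have "?q div b ^ e mod b = d e" if "e < Suc m" for e
  proof (cases "e = m")
    case True then show ?thesis using q(1) dm by simp
  next
    case False
    with that have e: "e < m" by simp
    then have "b ^ m = b ^ e * (b * b ^ (m - Suc e))"
      by (metis Suc_diff_Suc power_Suc le_add_diff_inverse less_imp_le_nat power_add)
    then have "?q = q + b ^ e * (d m * (b * b ^ (m - Suc e)))" by (simp only: mult.left_commute)
    moreover have "b ^ e \<noteq> 0" using dm by simp
    ultimately have "?q div b ^ e = q div b ^ e + d m * (b * b ^ (m - Suc e))" by (simp only: div_mult_self2) simp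
    then have "?q div b ^ e = q div b ^ e + b * (d m * b ^ (m - Suc e))" by (simp only: mult.left_commute)
    then show ?thesis using q(2) e by simp
  qed
  ultimately show ?case by blast
qed simp

lemma prod_encode_strict_mono:
  assumes "a < b" "c < d" shows "prod_encode (a, c) < prod_encode (b, d)"
proof -
  have "triangle (a + c) \<le> triangle (b + d)"
    unfolding triangle_def using assms by (intro div_le_mono mult_le_mono) auto
  with assms(1) show ?thesis by (simp add: prod_encode_def)
qed

context path_system
begin

definition apx_num :: "(nat \<Rightarrow> nat \<Rightarrow> int) \<Rightarrow> nat \<Rightarrow> nat \<Rightarrow> int" where
  "apx_num \<gamma> n p = (\<Sum>k<n. \<gamma> k (p div 2 ^ (S n - S k))
      * int (p div 2 ^ (S n - S (Suc k)) mod 2 ^ block k * 2 ^ k\<^sup>2 * 2 ^ (S n - S (Suc k))))"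

lemma apx_num: "of_int (apx_num \<gamma> n p) = path_apx \<gamma> n p * 2 ^ S n"
  unfolding apx_num_def path_apx_def sum_distrib_right of_int_sum
proof (rule sum.cong[OF refl])
  fix k assume "k \<in> {..<n}"
  then have "(2::real) ^ S n = 2 ^ S (Suc k) * 2 ^ (S n - S (Suc k))"
    using S_mono[of "Suc k" n] by (simp flip: power_add)
  then show "real_of_int (\<gamma> k (p div 2 ^ (S n - S k))
      * int (p div 2 ^ (S n - S (Suc k)) mod 2 ^ block k * 2 ^ k\<^sup>2 * 2 ^ (S n - S (Suc k))))
      = summand \<gamma> (\<lambda>i. p div 2 ^ (S n - S i)) k * 2 ^ S n"
    by (simp add: summand_def digit_weight_def)
qed

text \<open>
  A generator is coded by four times a prefix of a path, plus its kind.
\<close>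

definition gen_num :: "nat \<Rightarrow> nat \<Rightarrow> int" where
  "gen_num n q = (if q mod 4 = 0 then apx_num \<alpha> n (q div 4) else if q mod 4 = 1 then - apx_num \<alpha> n (q div 4)
     else if q mod 4 = 2 then apx_num \<beta> n (q div 4) else - apx_num \<beta> n (q div 4))"

lemma gen_num_cases:
  "gen_num n (4 * p) = apx_num \<alpha> n p" "gen_num n (4 * p + 1) = - apx_num \<alpha> n p"
  "gen_num n (4 * p + 2) = apx_num \<beta> n p" "gen_num n (4 * p + 3) = - apx_num \<beta> n p"
proof -
  have "(4 * p + 1) mod 4 = 1" "(4 * p + 2) mod 4 = 2" "(4 * p + 3) mod 4 = 3"
    "(4 * p + 1) div 4 = p" "(4 * p + 2) div 4 = p" "(4 * p + 3) div 4 = p"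
    by presburger+
  then show "gen_num n (4 * p) = apx_num \<alpha> n p" "gen_num n (4 * p + 1) = - apx_num \<alpha> n p"
    "gen_num n (4 * p + 2) = apx_num \<beta> n p" "gen_num n (4 * p + 3) = - apx_num \<beta> n p"
    by (simp_all add: gen_num_def)
qed

lemma apx_num_near:
  assumes "P \<in> paths"
  shows "\<bar>path_val \<alpha> P - of_int (apx_num \<alpha> n (P n)) / 2 ^ S n\<bar> \<le> path_err n"
    "\<bar>- path_val \<alpha> P - of_int (- apx_num \<alpha> n (P n)) / 2 ^ S n\<bar> \<le> path_err n"
    "\<bar>path_val \<beta> P - of_int (apx_num \<beta> n (P n)) / 2 ^ S n\<bar> \<le> path_err n"
    "\<bar>- path_val \<beta> P - of_int (- apx_num \<beta> n (P n)) / 2 ^ S n\<bar> \<le> path_err n"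
proof -
  have a: "of_int (apx_num \<gamma> n p) / 2 ^ S n = path_apx \<gamma> n p" for \<gamma> p by (simp add: apx_num)
  have m: "of_int (- apx_num \<gamma> n p) / 2 ^ S n = - path_apx \<gamma> n p" for \<gamma> p
    using a[of \<gamma> p] by simp
  have neg: "\<bar>- x - - y\<bar> \<le> e" if "\<bar>x - y\<bar> \<le> e" for x y e :: real using that by linarith
  have A: "\<bar>path_val \<alpha> P - path_apx \<alpha> n (P n)\<bar> \<le> path_err n"
    using path_val_apx[of \<alpha> P n] alpha_le assms by blast
  have B: "\<bar>path_val \<beta> P - path_apx \<beta> n (P n)\<bar> \<le> path_err n"
    using path_val_apx[of \<beta> P n] beta_le assms by blast
  show "\<bar>path_val \<alpha> P - of_int (apx_num \<alpha> n (P n)) / 2 ^ S n\<bar> \<le> path_err n"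
    "\<bar>path_val \<beta> P - of_int (apx_num \<beta> n (P n)) / 2 ^ S n\<bar> \<le> path_err n"
    unfolding a by (fact A, fact B)
  show "\<bar>- path_val \<alpha> P - of_int (- apx_num \<alpha> n (P n)) / 2 ^ S n\<bar> \<le> path_err n"
    "\<bar>- path_val \<beta> P - of_int (- apx_num \<beta> n (P n)) / 2 ^ S n\<bar> \<le> path_err n"
    unfolding m by (fact neg[OF A], fact neg[OF B])
qed

lemma path_gens_apx:
  assumes "y \<in> path_gens"
  shows "\<exists>q<4 * 2 ^ S n. \<bar>y - of_int (gen_num n q) / 2 ^ S n\<bar> \<le> path_err n"
proof -
  consider P where "P \<in> paths" "y = path_val \<alpha> P" | P where "P \<in> paths" "y = - path_val \<alpha> P"
    | P where "P \<in> paths" "y = path_val \<beta> P" | P where "P \<in> paths" "y = - path_val \<beta> P"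
    using assms unfolding path_gens_def by auto
  then show ?thesis
  proof cases
    case (1 P)
    then show ?thesis using apx_num_near(1)[OF 1(1), of n] path_less[OF 1(1), of n]
      by (intro exI[of _ "4 * P n"]) (simp add: gen_num_cases del: of_int_minus)
  next
    case (2 P)
    then show ?thesis using apx_num_near(2)[OF 2(1), of n] path_less[OF 2(1), of n]
      by (intro exI[of _ "4 * P n + 1"]) (simp only: gen_num_cases, simp)
  next
    case (3 P)
    then show ?thesis using apx_num_near(3)[OF 3(1), of n] path_less[OF 3(1), of n]
      by (intro exI[of _ "4 * P n + 2"]) (simp only: gen_num_cases, simp)
  next
    case (4 P)
    then show ?thesis using apx_num_near(4)[OF 4(1), of n] path_less[OF 4(1), of n]
      by (intro exI[of _ "4 * P n + 3"]) (simp only: gen_num_cases, simp)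
  qed
qed

lemma gen_num_path_gens:
  assumes "q < 4 * 2 ^ S n"
  shows "\<exists>y\<in>path_gens. \<bar>y - of_int (gen_num n q) / 2 ^ S n\<bar> \<le> path_err n"
proof -
  have "q div 4 < 2 ^ S n" using assms by (simp add: div_less_iff_less_mult mult.commute)
  then obtain P where P: "P \<in> paths" "P n = q div 4" using prefix_path by blast
  have gens: "path_val \<alpha> P \<in> path_gens" "- path_val \<alpha> P \<in> path_gens"
    "path_val \<beta> P \<in> path_gens" "- path_val \<beta> P \<in> path_gens"
    using P(1) unfolding path_gens_def by auto
  consider "q = 4 * P n" | "q = 4 * P n + 1" | "q = 4 * P n + 2" | "q = 4 * P n + 3"
    unfolding P(2) by linarith
  then show ?thesis
  proof cases
    case 1 show ?thesis unfolding 1 gen_num_cases using apx_num_near(1)[OF P(1)] gens(1) by blast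
  next
    case 2 show ?thesis unfolding 2 gen_num_cases using apx_num_near(2)[OF P(1)] gens(2) by blast
  next
    case 3 show ?thesis unfolding 3 gen_num_cases using apx_num_near(3)[OF P(1)] gens(3) by blast
  next
    case 4 show ?thesis unfolding 4 gen_num_cases using apx_num_near(4)[OF P(1)] gens(4) by blast
  qed
qed

definition piece :: "(nat \<Rightarrow> real set) \<Rightarrow> nat \<Rightarrow> nat \<Rightarrow> nat \<Rightarrow> nat \<Rightarrow> real set" where
  "piece Q k i l m = {y. \<exists>b v. b \<in> Q i \<and> \<bar>b\<bar> \<le> real l \<and> v \<in> path_sums m \<and> real (Suc k) * y = b + v}"

definition sum_num :: "nat \<Rightarrow> nat \<Rightarrow> nat \<Rightarrow> int" where
  "sum_num m n q = (\<Sum>e<m. gen_num n (q div (4 * 2 ^ S n) ^ e mod (4 * 2 ^ S n)))"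

lemma path_sums_apx:
  assumes "v \<in> path_sums m"
  shows "\<exists>q<(4 * 2 ^ S n) ^ m. \<bar>v - of_int (sum_num m n q) / 2 ^ S n\<bar> \<le> real m * path_err n"
proof -
  obtain g where g: "v = (\<Sum>e<m. g e)" "\<And>e. e < m \<Longrightarrow> g e \<in> path_gens"
    using assms unfolding path_sums_def by blast
  have "\<forall>e\<in>{..<m}. \<exists>q. q < 4 * 2 ^ S n \<and> \<bar>g e - of_int (gen_num n q) / 2 ^ S n\<bar> \<le> path_err n"
    using path_gens_apx g(2) by blast
  from bchoice[OF this] obtain d where
    "\<forall>e\<in>{..<m}. d e < 4 * 2 ^ S n \<and> \<bar>g e - of_int (gen_num n (d e)) / 2 ^ S n\<bar> \<le> path_err n" ..
  then have d: "\<And>e. e < m \<Longrightarrow> d e < 4 * 2 ^ S n"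
    "\<And>e. e < m \<Longrightarrow> \<bar>g e - of_int (gen_num n (d e)) / 2 ^ S n\<bar> \<le> path_err n"
    by simp_all
  obtain q where q: "q < (4 * 2 ^ S n) ^ m" "\<forall>e<m. q div (4 * 2 ^ S n) ^ e mod (4 * 2 ^ S n) = d e"
    using exists_base_expansion[of m d "4 * 2 ^ S n", OF d(1)] by auto
  have "sum_num m n q = (\<Sum>e<m. gen_num n (d e))"
    unfolding sum_num_def using q(2) by (intro sum.cong) simp_all
  then have "v - of_int (sum_num m n q) / 2 ^ S n = (\<Sum>e<m. g e - of_int (gen_num n (d e)) / 2 ^ S n)"
    by (simp add: g(1) sum_subtractf sum_divide_distrib)
  also have "\<bar>\<dots>\<bar> \<le> (\<Sum>e<m. path_err n)"
    using d(2) by (intro order_trans[OF sum_abs] sum_mono) simp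
  finally show ?thesis using q(1) by auto
qed

lemma sum_num_path_sums:
  "\<exists>v\<in>path_sums m. \<bar>v - of_int (sum_num m n q) / 2 ^ S n\<bar> \<le> real m * path_err n"
proof -
  let ?d = "\<lambda>e. q div (4 * 2 ^ S n) ^ e mod (4 * 2 ^ S n)"
  have "\<exists>y. y \<in> path_gens \<and> \<bar>y - of_int (gen_num n (?d e)) / 2 ^ S n\<bar> \<le> path_err n" for e
    using gen_num_path_gens[of "?d e" n] unfolding Bex_def by simp
  then have "\<forall>e. \<exists>y. y \<in> path_gens \<and> \<bar>y - of_int (gen_num n (?d e)) / 2 ^ S n\<bar> \<le> path_err n" by (rule allI)
  from choice[OF this] obtain g where
    "\<forall>e. g e \<in> path_gens \<and> \<bar>g e - of_int (gen_num n (?d e)) / 2 ^ S n\<bar> \<le> path_err n" ..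
  then have g: "\<And>e. g e \<in> path_gens"
    "\<And>e. \<bar>g e - of_int (gen_num n (?d e)) / 2 ^ S n\<bar> \<le> path_err n" by blast+
  have "(\<Sum>e<m. g e) - of_int (sum_num m n q) / 2 ^ S n = (\<Sum>e<m. g e - of_int (gen_num n (?d e)) / 2 ^ S n)"
    by (simp add: sum_num_def sum_subtractf sum_divide_distrib)
  also have "\<bar>\<dots>\<bar> \<le> (\<Sum>e<m. path_err n)"
    using g(2) by (intro order_trans[OF sum_abs] sum_mono) simp
  finally have "\<bar>(\<Sum>e<m. g e) - of_int (sum_num m n q) / 2 ^ S n\<bar> \<le> real m * path_err n" by simp
  moreover have "(\<Sum>e<m. g e) \<in> path_sums m" using g(1) unfolding path_sums_def by blast
  ultimately show ?thesis by blast
qed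

lemma path_err_scaled: "path_err n * 2 ^ S n = real (2 * 2 ^ (n\<^sup>2 + n))"
  by (simp add: path_err_def)

lemma S_ge: "n \<le> S n"
proof (induction n)
  case (Suc n)
  have "1 \<le> (n + 4)\<^sup>2" by (simp add: power2_eq_square)
  with Suc S_step[of n] show ?case by linarith
qed simp

lemma path_err_tendsto: "path_err \<longlonglongrightarrow> 0"
proof (rule tendsto_sandwich[OF _ _ tendsto_const])
  show "(\<lambda>n. 2 * (1/2::real) ^ n) \<longlonglongrightarrow> 0" by (auto intro!: tendsto_mult_right_zero LIMSEQ_power_zero)
  show "eventually (\<lambda>n. 0 \<le> path_err n) sequentially"
    using path_err_pos by (intro always_eventually allI less_imp_le)
  show "eventually (\<lambda>n. path_err n \<le> 2 * (1/2) ^ n) sequentially"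
    using path_err_le by (intro always_eventually allI)
qed

lemma piece_sound:
  assumes D: "enumerates_complements D Q" and y: "y \<in> piece Q k i l m"
  shows "\<exists>j<2 * l * 2 ^ S n + 1. \<exists>q<(4 * 2 ^ S n) ^ m. \<not> removed D i (S n) (int j - int (l * 2 ^ S n)) \<and>
     \<bar>real (Suc k * 2 ^ S n) * y - of_int (int j - int (l * 2 ^ S n) + sum_num m n q)\<bar>
       \<le> real (1 + m * (2 * 2 ^ (n\<^sup>2 + n)))"
proof -
  obtain b v where bv: "b \<in> Q i" "\<bar>b\<bar> \<le> real l" "v \<in> path_sums m" "real (Suc k) * y = b + v"
    using y unfolding piece_def by blast
  obtain q where q: "q < (4 * 2 ^ S n) ^ m" "\<bar>v - of_int (sum_num m n q) / 2 ^ S n\<bar> \<le> real m * path_err n"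
    using path_sums_apx[OF bv(3)] by blast
  define g where "g = \<lfloor>b * 2 ^ S n\<rfloor>"
  have b_le: "- real (l * 2 ^ S n) \<le> b * 2 ^ S n" "b * 2 ^ S n \<le> real (l * 2 ^ S n)"
    using bv(2) mult_right_mono[of "- real l" b "2 ^ S n"] mult_right_mono[of b "real l" "2 ^ S n"]
    by auto
  have g_le: "- int (l * 2 ^ S n) \<le> g" "g \<le> int (l * 2 ^ S n)"
    unfolding g_def using b_le by linarith+
  define j where "j = nat (g + int (l * 2 ^ S n))"
  have j: "int j - int (l * 2 ^ S n) = g" using g_le by (simp add: j_def)
  have "j < 2 * l * 2 ^ S n + 1" using g_le unfolding j_def by linarith
  moreover have "\<not> removed D i (S n) g"
    using removed_disjoint[OF D, of i "S n" g] floor_cell[of b "S n"] bv(1) unfolding g_def by blast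
  moreover have "\<bar>real (Suc k * 2 ^ S n) * y - of_int (g + sum_num m n q)\<bar> \<le> real (1 + m * (2 * 2 ^ (n\<^sup>2 + n)))"
  proof -
    have "\<bar>v - of_int (sum_num m n q) / 2 ^ S n\<bar> * 2 ^ S n \<le> real m * path_err n * 2 ^ S n"
      using q(2) by (rule mult_right_mono) simp
    also have "\<bar>v - of_int (sum_num m n q) / 2 ^ S n\<bar> * 2 ^ S n
        = \<bar>(v - of_int (sum_num m n q) / 2 ^ S n) * 2 ^ S n\<bar>"
      by (simp add: abs_mult)
    also have "(v - of_int (sum_num m n q) / 2 ^ S n) * 2 ^ S n = v * 2 ^ S n - of_int (sum_num m n q)"
      by (simp add: left_diff_distrib)
    also have "real m * path_err n * 2 ^ S n = real (m * (2 * 2 ^ (n\<^sup>2 + n)))"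
      using path_err_scaled[of n] by simp
    finally have 1: "\<bar>v * 2 ^ S n - of_int (sum_num m n q)\<bar> \<le> real (m * (2 * 2 ^ (n\<^sup>2 + n)))" .
    have "real (Suc k * 2 ^ S n) * y = (real (Suc k) * y) * 2 ^ S n" by (simp add: algebra_simps)
    also have "\<dots> = b * 2 ^ S n + v * 2 ^ S n" unfolding bv(4) by (rule distrib_right)
    finally have 2: "real (Suc k * 2 ^ S n) * y = b * 2 ^ S n + v * 2 ^ S n" .
    have 3: "\<bar>b * 2 ^ S n - of_int g\<bar> \<le> 1" unfolding g_def by linarith
    from 1 2 3 show ?thesis unfolding of_int_add of_nat_add by linarith
  qed
  ultimately show ?thesis using q(1) j by (intro exI[of _ j] exI[of _ q] conjI) auto
qed

text \<open>
  Approximations of all precisions by a cell that has not been discarded plus a sum of generators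
  converge along a subsequence: the sums of generators by compactness, hence also the cells.  The
  limit of the cells lies in the closed set, since otherwise a neighbourhood of it would have
  been discarded.
\<close>

lemma piece_complete:
  assumes D: "enumerates_complements D Q"
    and apx: "\<And>n. \<exists>j<2 * l * 2 ^ S n + 1. \<exists>q<(4 * 2 ^ S n) ^ m. \<not> removed D i (S n) (int j - int (l * 2 ^ S n)) \<and>
     \<bar>real (Suc k * 2 ^ S n) * y - of_int (int j - int (l * 2 ^ S n) + sum_num m n q)\<bar>
       \<le> real (1 + m * (2 * 2 ^ (n\<^sup>2 + n))) + 2"
  shows "y \<in> piece Q k i l m"
proof -
  define Y where "Y = real (Suc k) * y"
  define err where "err n = 3 * (1/2) ^ n + 2 * (real m * path_err n)" for n
  have "\<exists>g v. v \<in> path_sums m \<and> \<not> removed D i (S n) g \<and> \<bar>of_int g / 2 ^ S n\<bar> \<le> real l \<and>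
     \<bar>Y - v - of_int g / 2 ^ S n\<bar> \<le> err n" for n
  proof -
    obtain j q where j: "j < 2 * l * 2 ^ S n + 1" "\<not> removed D i (S n) (int j - int (l * 2 ^ S n))"
      "\<bar>real (Suc k * 2 ^ S n) * y - of_int (int j - int (l * 2 ^ S n) + sum_num m n q)\<bar>
       \<le> real (1 + m * (2 * 2 ^ (n\<^sup>2 + n))) + 2"
      using apx[of n] by blast
    define g where "g = int j - int (l * 2 ^ S n)"
    obtain v where v: "v \<in> path_sums m" "\<bar>v - of_int (sum_num m n q) / 2 ^ S n\<bar> \<le> real m * path_err n"
      using sum_num_path_sums by blast
    have "\<bar>real_of_int g\<bar> \<le> real l * 2 ^ S n"
    proof -
      have "\<bar>g\<bar> \<le> int (l * 2 ^ S n)" using j(1) unfolding g_def by linarith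
      then have "real_of_int \<bar>g\<bar> \<le> of_int (int (l * 2 ^ S n))" by (rule of_int_le_iff[THEN iffD2])
      then show ?thesis by simp
    qed
    then have gl: "\<bar>of_int g / 2 ^ S n\<bar> \<le> real l" by (simp add: abs_divide pos_divide_le_eq)
    have "\<bar>(Y - of_int g / 2 ^ S n - of_int (sum_num m n q) / 2 ^ S n) * 2 ^ S n\<bar>
        = \<bar>real (Suc k * 2 ^ S n) * y - of_int (g + sum_num m n q)\<bar>"
      by (simp add: Y_def algebra_simps)
    also have "\<dots> \<le> 3 + real (m * (2 * 2 ^ (n\<^sup>2 + n)))" using j(3) unfolding g_def by simp
    also have "\<dots> = (3 / 2 ^ S n + real m * path_err n) * 2 ^ S n"
      using path_err_scaled[of n] by (simp add: algebra_simps)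
    finally have "\<bar>Y - of_int g / 2 ^ S n - of_int (sum_num m n q) / 2 ^ S n\<bar> \<le> 3 / 2 ^ S n + real m * path_err n"
      unfolding abs_mult by simp
    moreover have "3 / 2 ^ S n \<le> 3 * (1/2::real) ^ n"
      using S_ge[of n] by (simp add: power_one_over field_simps power_increasing)
    ultimately have "\<bar>Y - v - of_int g / 2 ^ S n\<bar> \<le> err n" using v(2) unfolding err_def by linarith
    with v(1) gl j(2) show ?thesis unfolding g_def[symmetric] by blast
  qed
  then obtain g v where gv: "\<And>n. v n \<in> path_sums m" "\<And>n. \<not> removed D i (S n) (g n)"
    "\<And>n. \<bar>of_int (g n) / 2 ^ S n\<bar> \<le> real l" "\<And>n. \<bar>Y - v n - of_int (g n) / 2 ^ S n\<bar> \<le> err n"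
    by metis
  obtain v0 r where r: "v0 \<in> path_sums m" "strict_mono r" "(v \<circ> r) \<longlonglongrightarrow> v0"
    using compact_path_sums[of m] gv(1) unfolding compact_def by blast
  define x where "x n = of_int (g (r n)) / (2::real) ^ S (r n)" for n
  have "err \<longlonglongrightarrow> 3 * 0 + 2 * (real m * 0)"
    unfolding err_def by (intro tendsto_add tendsto_mult tendsto_const path_err_tendsto LIMSEQ_power_zero) simp
  then have "err \<longlonglongrightarrow> 0" by simp
  from LIMSEQ_subseq_LIMSEQ[OF this r(2)] have er: "(err \<circ> r) \<longlonglongrightarrow> 0" .
  have "(\<lambda>n. Y - v (r n) - x n) \<longlonglongrightarrow> 0"
  proof (rule Lim_null_comparison[OF _ er])
    show "\<forall>\<^sub>F n in sequentially. norm (Y - v (r n) - x n) \<le> (err \<circ> r) n"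
      using gv(4) by (intro always_eventually allI) (simp add: x_def)
  qed
  moreover have "(\<lambda>n. Y - v (r n)) \<longlonglongrightarrow> Y - v0"
    using tendsto_diff[OF tendsto_const r(3), of Y] by (simp add: o_def)
  ultimately have "(\<lambda>n. (Y - v (r n)) - (Y - v (r n) - x n)) \<longlonglongrightarrow> (Y - v0) - 0" by (rule tendsto_diff[rotated])
  then have x: "x \<longlonglongrightarrow> Y - v0" by simp
  have "\<bar>Y - v0\<bar> \<le> real l"
    using tendsto_rabs[OF x] by (rule LIMSEQ_le_const2) (use gv(3) in \<open>auto simp: x_def\<close>)
  moreover have "Y - v0 \<in> Q i"
  proof (rule ccontr)
    assume notin: "Y - v0 \<notin> Q i"
    have cQ: "- Q i = (\<Union>w\<in>{w. \<exists>s. D (prod_encode (i, w)) s}. rat_interval w)"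
      using D unfolding enumerates_complements_def by blast
    have "open (- Q i)" unfolding cQ by (intro open_UN ballI open_rat_interval)
    with notin obtain \<epsilon> where e: "0 < \<epsilon>" "cball (Y - v0) \<epsilon> \<subseteq> - Q i"
      unfolding open_contains_cball by blast
    have "cball (Y - v0) \<epsilon> \<inter> Q i = {}" using e(2) by blast
    from small_cells_removed[OF D compact_cball this] obtain N0 where
      N0: "\<And>N h. N0 \<le> N \<Longrightarrow> cell N h \<subseteq> cball (Y - v0) \<epsilon> \<Longrightarrow> removed D i N h"
      by blast
    have "eventually (\<lambda>n. dist (x n) (Y - v0) < \<epsilon> / 2) sequentially"
      using x e(1) by (intro tendstoD) simp_all
    moreover have "eventually (\<lambda>n. (1/2::real) ^ n < \<epsilon> / 2) sequentially"
      using e(1) by (intro order_tendstoD(2)[OF LIMSEQ_power_zero]) simp_all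
    ultimately have "eventually (\<lambda>n. dist (x n) (Y - v0) < \<epsilon> / 2 \<and> (1/2::real) ^ n < \<epsilon> / 2 \<and> N0 \<le> n) sequentially"
      using eventually_ge_at_top[of N0] by eventually_elim simp
    then obtain n where n: "dist (x n) (Y - v0) < \<epsilon> / 2" "(1/2::real) ^ n < \<epsilon> / 2" "N0 \<le> n"
      using eventually_happens by force
    have nS: "n \<le> S (r n)" using S_ge[of "r n"] seq_suble[OF r(2), of n] by simp
    have "cell (S (r n)) (g (r n)) \<subseteq> cball (Y - v0) \<epsilon>"
    proof
      fix u assume "u \<in> cell (S (r n)) (g (r n))"
      then have "\<bar>u - x n\<bar> \<le> 1 / 2 ^ S (r n)" by (auto simp: cell_def x_def add_divide_distrib)
      also have "\<dots> \<le> (1/2) ^ n" using nS by (simp add: power_one_over field_simps power_increasing)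
      finally show "u \<in> cball (Y - v0) \<epsilon>"
        using n(1,2) unfolding mem_cball dist_real_def by linarith
    qed
    then have "removed D i (S (r n)) (g (r n))" using N0 n(3) nS by simp
    with gv(2) show False by blast
  qed
  ultimately show ?thesis using r(1) unfolding piece_def Y_def[symmetric]
    by (intro CollectI exI[of _ "Y - v0"] exI[of _ v0]) (simp add: Y_def)
qed

lemma pieces_uniformly_Pi01:
  assumes D: "recp {char_fun z} (\<lambda>p. D (pfst p) (psnd p))" "enumerates_complements D Q"
    and S: "recf {char_fun z} S" and a: "recz {char_fun z} (\<lambda>p. \<alpha> (pfst p) (psnd p))"
    and b: "recz {char_fun z} (\<lambda>p. \<beta> (pfst p) (psnd p))"
  shows "uniformly_Pi01 z (\<lambda>c. piece Q (pfst c) (pfst (psnd c)) (pfst (psnd (psnd c))) (psnd (psnd (psnd c))))"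
proof (rule uniformly_Pi01I)
  let ?l = "\<lambda>c. pfst (psnd (psnd c))" and ?m = "\<lambda>c. psnd (psnd (psnd c))"
  let ?R = "\<lambda>c n t. \<not> removed D (pfst (psnd c)) (S n) (int (pfst t) - int (?l c * 2 ^ S n))
     \<and> pfst t < 2 * ?l c * 2 ^ S n + 1 \<and> psnd t < (4 * 2 ^ S n) ^ ?m c"
  let ?num = "\<lambda>c n t. int (pfst t) - int (?l c * 2 ^ S n) + sum_num (?m c) n (psnd t)"
  let ?b = "\<lambda>c n. prod_encode (2 * ?l c * 2 ^ S n + 1, (4 * 2 ^ S n) ^ ?m c)"
  have b_le: "t < ?b c n" if "pfst t < 2 * ?l c * 2 ^ S n + 1" "psnd t < (4 * 2 ^ S n) ^ ?m c" for t c n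
    using prod_encode_strict_mono[OF that] by simp
  have rec_apx: "recz {char_fun z} (\<lambda>n. apx_num \<gamma> (f n) (g n))"
    if "recf {char_fun z} f" "recf {char_fun z} g" "recz {char_fun z} (\<lambda>p. \<gamma> (pfst p) (psnd p))" for \<gamma> f g
    unfolding apx_num_def block_def
    by (intro recI recz_comp2[OF that(3)] recf_comp[OF S] recf_comp[OF that(1)] recf_comp[OF that(2)] that(1,2))
  have rec_gen: "recz {char_fun z} (\<lambda>n. gen_num (f n) (g n))"
    if "recf {char_fun z} f" "recf {char_fun z} g" for f g
    unfolding gen_num_def by (intro recI rec_apx a b that)
  have rec_sum: "recz {char_fun z} (\<lambda>n. sum_num (h n) (f n) (g n))"
    if "recf {char_fun z} f" "recf {char_fun z} g" "recf {char_fun z} h" for f g h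
    unfolding sum_num_def by (intro recI rec_gen recf_comp[OF S] recf_comp[OF that(1)] recf_comp[OF that(2)] that)
  show "recf {char_fun z} (\<lambda>p. Suc (pfst (pfst p)) * 2 ^ S (psnd p))"
    by (intro recI recf_comp[OF S])
  show "recf {char_fun z} (\<lambda>p. 1 + ?m (pfst p) * (2 * 2 ^ ((psnd p)\<^sup>2 + psnd p)))"
    by (intro recI)
  show "recf {char_fun z} (\<lambda>p. ?b (pfst p) (psnd p))" by (intro recI recf_comp[OF S])
  show "recz {char_fun z} (\<lambda>p. ?num (pfst p) (pfst (psnd p)) (psnd (psnd p)))"
    by (intro recI recf_comp[OF S] rec_sum)
  show "recp {char_fun z} (\<lambda>p. ?R (pfst p) (pfst (psnd p)) (psnd (psnd p)))"
    by (intro recI recp_removed[OF D(1)] recf_comp[OF S])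
  show "0 < Suc (pfst c) * 2 ^ S n" for c n by simp
  show "\<exists>t<?b c n. ?R c n t \<and> \<bar>real (Suc (pfst c) * 2 ^ S n) * y - of_int (?num c n t)\<bar>
      \<le> real (1 + ?m c * (2 * 2 ^ (n\<^sup>2 + n)))"
    if y: "y \<in> piece Q (pfst c) (pfst (psnd c)) (?l c) (?m c)" for c n y
  proof -
    obtain j q where jq: "j < 2 * ?l c * 2 ^ S n + 1" "q < (4 * 2 ^ S n) ^ ?m c"
      "\<not> removed D (pfst (psnd c)) (S n) (int j - int (?l c * 2 ^ S n))"
      "\<bar>real (Suc (pfst c) * 2 ^ S n) * y - of_int (int j - int (?l c * 2 ^ S n) + sum_num (?m c) n q)\<bar>
       \<le> real (1 + ?m c * (2 * 2 ^ (n\<^sup>2 + n)))"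
      using piece_sound[OF D(2) y] by blast
    then show ?thesis using b_le[of "prod_encode (j, q)"]
      by (intro exI[of _ "prod_encode (j, q)"]) simp
  qed
  show "y \<in> piece Q (pfst c) (pfst (psnd c)) (?l c) (?m c)"
    if h: "\<And>n. \<exists>t<?b c n. ?R c n t \<and> \<bar>real (Suc (pfst c) * 2 ^ S n) * y - of_int (?num c n t)\<bar>
      \<le> real (1 + ?m c * (2 * 2 ^ (n\<^sup>2 + n))) + 2" for c y
  proof (rule piece_complete[OF D(2)])
    fix n
    obtain t where "?R c n t \<and> \<bar>real (Suc (pfst c) * 2 ^ S n) * y - of_int (?num c n t)\<bar>
      \<le> real (1 + ?m c * (2 * 2 ^ (n\<^sup>2 + n))) + 2" using h[of n] by blast
    then show "\<exists>j<2 * ?l c * 2 ^ S n + 1. \<exists>q<(4 * 2 ^ S n) ^ ?m c.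
     \<not> removed D (pfst (psnd c)) (S n) (int j - int (?l c * 2 ^ S n)) \<and>
     \<bar>real (Suc (pfst c) * 2 ^ S n) * y - of_int (int j - int (?l c * 2 ^ S n) + sum_num (?m c) n q)\<bar>
       \<le> real (1 + ?m c * (2 * 2 ^ (n\<^sup>2 + n))) + 2" by blast
  qed
qed

end

section \<open>Searching for economical dyadic covers\<close>

text \<open>
  The test applied in the search for covers.  The number \<open>c\<close> codes a finest level and, through its
  binary digits, a finite set of dyadic cells for the parts in \<open>[-n, n]\<close> of the sets with index at most
  \<open>n\<close>.  The exponent of a cell of level \<open>\<kappa>\<close> is \<open>\<kappa> * \<tau> n / 2 ^ n\<close>; rounding it down keeps the condition
  decidable and changes the weight by a factor of at most \<open>2\<close>.  The factor \<open>2 ^ (n * s + n)\<close> pays for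
  translating the cover by all combinations of \<open>n\<close> prefixes of \<open>s\<close> digits, and for convergence to \<open>0\<close>.
\<close>

definition cheap_cover :: "(nat \<Rightarrow> nat \<Rightarrow> bool) \<Rightarrow> (nat \<Rightarrow> nat) \<Rightarrow> nat \<Rightarrow> nat \<Rightarrow> nat \<Rightarrow> bool" where
  "cheap_cover D \<tau> n s c \<longleftrightarrow> n \<le> pfst c \<and>
     (\<forall>j<2 * n * 2 ^ pfst c. (\<forall>i<Suc n. removed D i (pfst c) (int j - int (n * 2 ^ pfst c)))
        \<or> (\<exists>\<kappa><Suc (pfst c). n \<le> \<kappa> \<and> odd (psnd c div 2 ^ prod_encode (\<kappa>, j div 2 ^ (pfst c - \<kappa>))))) \<and>
     2 ^ (n * s + n) * (\<Sum>b<psnd c. of_bool (odd (psnd c div 2 ^ b) \<and> pfst b \<le> pfst c)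
        * 2 ^ (pfst c - pfst b * \<tau> n div 2 ^ n)) \<le> (2::nat) ^ pfst c"

lemma recp_cheap_cover:
  assumes D: "recp G (\<lambda>p. D (pfst p) (psnd p))" and t: "recf G \<tau>"
    and f: "recf G f" and g: "recf G g" and h: "recf G h"
  shows "recp G (\<lambda>p. cheap_cover D \<tau> (f p) (g p) (h p))"
  unfolding cheap_cover_def
  by (intro recI recp_removed[OF D] recf_comp[OF t] recf_comp[OF f] recf_comp[OF g] recf_comp[OF h] f g h)

lemma set_decode_less: "b \<in> set_decode c \<Longrightarrow> b < c"
proof -
  assume "b \<in> set_decode c"
  then have "odd (c div 2 ^ b)" by (simp add: set_decode_def)
  then have "c div 2 ^ b \<noteq> 0" by (intro notI) simp
  then have "2 ^ b \<le> c" by (simp add: div_eq_0_iff not_less)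
  moreover have "b < 2 ^ b" by (rule less_exp)
  ultimately show "b < c" by linarith
qed

lemma half_power_powr: "((1/2::real) ^ k) powr t = 2 powr (- (real k * t))"
proof -
  have "(2::real) powr (- real k) = inverse (2 ^ k)"
    unfolding powr_minus by (subst powr_realpow) simp_all
  also have "\<dots> = (1/2) ^ k" unfolding power_one_over by (rule inverse_eq_divide)
  finally have "(1/2::real) ^ k = 2 powr (- real k)" ..
  then have "((1/2::real) ^ k) powr t = 2 powr (- real k * t)" unfolding powr_powr[symmetric] by (rule arg_cong)
  then show ?thesis by (simp only: mult_minus_left)
qed

text \<open>
  A cover of small weight exists because the set is null.  Each member is enlarged to an open
  set inside three adjacent cells of comparable size, where the enlargement \<open>v i\<close> is chosen to add
  a controlled amount to the weight.  By compactness finitely many suffice, and at a level that is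
  fine enough every other cell has been discarded.
\<close>

lemma cheap_cover_exists:
  assumes D: "enumerates_complements D Q" and QB: "\<And>i. Q i \<subseteq> B"
    and \<tau>: "0 < \<tau> n" "\<tau> n \<le> 2 ^ n"
    and null: "hausdorff_measure (real (\<tau> n) / 2 ^ n) B = 0"
  shows "\<exists>c. cheap_cover D \<tau> n s c"
proof -
  define t where "t = real (\<tau> n) / 2 ^ n"
  have t: "0 < t" "t \<le> 1"
  proof -
    show "0 < t" using \<tau>(1) by (simp add: t_def)
    have "real (\<tau> n) \<le> real (2 ^ n)" using \<tau>(2) by (rule of_nat_mono)
    then show "t \<le> 1" by (simp add: t_def)
  qed
  \<comment> \<open>The factor 24 collects three cells per set, twice a factor 2 from rounding, and the enlargement.\<close>
  define \<eta> where "\<eta> = 1 / (24 * 2 ^ (n * s + n) :: real)"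
  have \<eta>: "0 < \<eta>" by (simp add: \<eta>_def)
  have \<eta>n: "2 * \<eta> \<le> (1/2) ^ n"
  proof -
    have "(2::real) ^ n \<le> 2 ^ (n * s + n)" by (rule power_increasing) auto
    then have "(2::real) ^ n \<le> 12 * 2 ^ (n * s + n)"
      using zero_le_power[of "2::real" "n * s + n"] by linarith
    then have "1 / (12 * 2 ^ (n * s + n)) \<le> 1 / (2::real) ^ n" by (intro divide_left_mono) auto
    then show ?thesis by (simp add: \<eta>_def power_one_over)
  qed
  from null[folded t_def, unfolded hausdorff_null_iff, rule_format, of 1 \<eta>] \<eta>
  obtain U :: "nat \<Rightarrow> real set" where U: "B \<subseteq> (\<Union>i. U i)" "\<And>i. bounded (U i)"
    "(\<Sum>i. diam_pow t (U i)) \<le> ennreal \<eta>"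
    by auto
  have dp: "diam_pow t (U i) = ennreal (diameter (U i) powr t)" for i
    using t(1) by (auto simp: diam_pow_def diameter_empty)
  have dsum: "(\<Sum>i\<in>I. diameter (U i) powr t) \<le> \<eta>" if "finite I" for I
  proof -
    have "ennreal (\<Sum>i\<in>I. diameter (U i) powr t) = (\<Sum>i\<in>I. diam_pow t (U i))"
      unfolding dp by (rule sum_ennreal[symmetric]) simp
    also have "\<dots> \<le> (\<Sum>i. diam_pow t (U i))" using that by (intro sum_le_suminf) auto
    also note U(3)
    finally show ?thesis using \<eta> by (simp add: ennreal_le_iff)
  qed
  \<comment> \<open>The enlarged diameters: their weights exceed the original ones by exactly \<open>\<eta> / 2 ^ Suc i\<close>.\<close>
  define v where "v i = (diameter (U i) powr t + \<eta> * (1/2) ^ Suc i) powr (1 / t)" for i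
  have pos: "0 < diameter (U i) powr t + \<eta> * (1/2) ^ Suc i" for i
    using \<eta> by (intro add_nonneg_pos) auto
  have vt: "v i powr t = diameter (U i) powr t + \<eta> * (1/2) ^ Suc i" for i
    using t(1) pos[of i] by (simp add: v_def powr_powr)
  have v0: "0 < v i" for i using pos[of i] unfolding v_def by (simp add: powr_gt_zero)
  have dv: "diameter (U i) < v i" for i
  proof -
    have "diameter (U i) powr t < v i powr t" unfolding vt using \<eta> by simp
    then show ?thesis using t(1) v0[of i]
      by (meson diameter_ge_0[OF U(2)] less_imp_le not_le powr_mono2)
  qed
  have vsum: "(\<Sum>i\<in>I. v i powr t) \<le> 2 * \<eta>" if "finite I" for I
  proof -
    have "(\<Sum>i\<in>I. (1/2::real) ^ Suc i) \<le> (\<Sum>i. (1/2) ^ Suc i)"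
      using that sums_summable[OF power_half_series] by (intro sum_le_suminf) auto
    also have "\<dots> = 1" using power_half_series by (rule sums_unique[symmetric])
    finally have "\<eta> * (\<Sum>i\<in>I. (1/2::real) ^ Suc i) \<le> \<eta> * 1" using \<eta> by (intro mult_left_mono) auto
    then show ?thesis using dsum[OF that] unfolding vt sum.distrib sum_distrib_left by linarith
  qed
  have vn: "v i \<le> (1/2) ^ n" for i
  proof -
    have "v i powr t \<le> (1/2) ^ n" using vsum[of "{i}"] \<eta>n by simp
    moreover have "v i \<le> v i powr t"
    proof -
      have "v i powr t \<le> 1" using calculation power_le_one[of "1/2::real" n] by simp
      then have "v i \<le> 1" using t(1) v0[of i] by (metis not_le powr_one_eq_one powr_less_mono2 zero_le_one)
      then show ?thesis using powr_mono'[of t 1 "v i"] t(2) v0[of i] by simp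
    qed
    ultimately show ?thesis by linarith
  qed
  have "\<exists>\<kappa>. n \<le> \<kappa> \<and> v i \<le> (1/2) ^ \<kappa> \<and> (1/2) ^ Suc \<kappa> < v i" for i
  proof -
    define m where "m = (LEAST m. (1/2) ^ m < v i)"
    have ex: "\<exists>m. (1/2) ^ m < v i" using real_arch_pow_inv[OF v0[of i], of "1/2"] by auto
    have m: "(1/2) ^ m < v i" unfolding m_def using ex by (rule LeastI_ex)
    have "\<not> m \<le> n"
    proof
      assume "m \<le> n"
      then have "(1/2::real) ^ n \<le> (1/2) ^ m" by (intro power_decreasing) auto
      with m vn[of i] show False by linarith
    qed
    then obtain \<kappa> where \<kappa>: "m = Suc \<kappa>" "n \<le> \<kappa>" by (metis Suc_leI Suc_le_D Suc_le_mono not_le)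
    have "\<not> (1/2) ^ \<kappa> < v i" using not_less_Least[of \<kappa> "\<lambda>m. (1/2) ^ m < v i"] \<kappa>(1) unfolding m_def[symmetric] by simp
    with \<kappa> m show ?thesis by auto
  qed
  then obtain \<kappa> where \<kappa>: "\<And>i. n \<le> \<kappa> i" "\<And>i. v i \<le> (1/2) ^ \<kappa> i" "\<And>i. (1/2) ^ Suc (\<kappa> i) < v i"
    by metis
  define a where "a i = \<lfloor>(SOME x. x \<in> U i) * 2 ^ \<kappa> i\<rfloor>" for i
  define V where "V i = {x::real. of_int (a i) - 1 < x * 2 ^ \<kappa> i \<and> x * 2 ^ \<kappa> i < of_int (a i) + 2}" for i
  have openV: "open (V i)" for i
    unfolding V_def by (intro open_Collect_conj open_Collect_less continuous_intros)
  have UV: "U i \<subseteq> V i" for i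
  proof
    fix y assume y: "y \<in> U i"
    define x where "x = (SOME x. x \<in> U i)"
    have x: "x \<in> U i" unfolding x_def using y by (rule someI)
    have "\<bar>y - x\<bar> < (1/2) ^ \<kappa> i"
      using diameter_bounded_bound[OF U(2) y x] dv[of i] \<kappa>(2)[of i] by (simp add: dist_real_def)
    then have "\<bar>y - x\<bar> * 2 ^ \<kappa> i < (1/2) ^ \<kappa> i * 2 ^ \<kappa> i" by (rule mult_strict_right_mono) simp
    then have "\<bar>y * 2 ^ \<kappa> i - x * 2 ^ \<kappa> i\<bar> < 1"
      by (simp add: abs_mult power_one_over flip: left_diff_distrib)
    moreover have "a i = \<lfloor>x * 2 ^ \<kappa> i\<rfloor>" by (simp add: a_def x_def)
    ultimately show "y \<in> V i" unfolding V_def by (simp; linarith)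
  qed
  have "\<exists>I. finite I \<and> (\<forall>i\<le>n. Q i \<inter> {- real n..real n} \<subseteq> (\<Union>i\<in>I. V i))"
  proof -
    define K where "K = (\<Union>i\<in>{..n}. Q i \<inter> {- real n..real n})"
    have "closed (Q i)" for i
    proof -
      have c: "- Q i = (\<Union>w\<in>{w. \<exists>s. D (prod_encode (i, w)) s}. rat_interval w)"
        using D unfolding enumerates_complements_def by blast
      have "open (- Q i)" unfolding c by (intro open_UN ballI open_rat_interval)
      then show ?thesis by (simp add: closed_open)
    qed
    then have "compact K" unfolding K_def by (intro compact_UN closed_Int_compact) auto
    moreover have "K \<subseteq> (\<Union>i\<in>UNIV. V i)"
    proof -
      have "K \<subseteq> B" unfolding K_def using QB by blast
      also have "B \<subseteq> (\<Union>i. V i)" using U(1) UV by blast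
      finally show ?thesis .
    qed
    ultimately obtain I where I: "finite I" "K \<subseteq> (\<Union>i\<in>I. V i)"
      using compactE_image[of K UNIV V] openV by metis
    then have "\<forall>i\<le>n. Q i \<inter> {- real n..real n} \<subseteq> (\<Union>i\<in>I. V i)" unfolding K_def by blast
    with I(1) show ?thesis by blast
  qed
  then obtain I where I: "finite I" "\<And>i. i \<le> n \<Longrightarrow> Q i \<inter> {- real n..real n} \<subseteq> (\<Union>i\<in>I. V i)" by blast
  \<comment> \<open>Cells of \<open>[-n, n]\<close> that avoid the cover lie in the compact set \<open>C\<close>, which is eventually discarded.\<close>
  define C where "C = {- real n..real n} - (\<Union>i\<in>I. V i)"
  have C: "compact C" unfolding C_def using openV by (intro compact_diff open_UN) auto
  have "\<exists>N0. \<forall>N\<ge>N0. \<forall>g. cell N g \<subseteq> C \<longrightarrow> removed D i N g" if "i \<le> n" for i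
    using small_cells_removed[OF D C, of i] I(2)[OF that] unfolding C_def by blast
  then have "\<forall>i. \<exists>N0. i \<le> n \<longrightarrow> (\<forall>N\<ge>N0. \<forall>g. cell N g \<subseteq> C \<longrightarrow> removed D i N g)" by blast
  from choice[OF this] obtain N0 where
    N0: "\<forall>i. i \<le> n \<longrightarrow> (\<forall>N\<ge>N0 i. \<forall>g. cell N g \<subseteq> C \<longrightarrow> removed D i N g)" ..
  define N where "N = Max (insert n (N0 ` {..n} \<union> \<kappa> ` I))"
  have fin: "finite (insert n (N0 ` {..n} \<union> \<kappa> ` I))" using I(1) by simp
  have N: "n \<le> N" "\<And>i. i \<le> n \<Longrightarrow> N0 i \<le> N" "\<And>i. i \<in> I \<Longrightarrow> \<kappa> i \<le> N"
    using Max_ge[OF fin] unfolding N_def by auto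
  define f where "f = (\<lambda>(i, h :: nat). prod_encode (\<kappa> i, nat (a i + int h - 1 + int (n * 2 ^ \<kappa> i))))"
  define T where "T = f ` (I \<times> {..<3})"
  have finT: "finite T" using I(1) by (simp add: T_def)
  have dec: "set_decode (set_encode T) = T" using finT by simp
  have mem: "odd (set_encode T div 2 ^ b) \<longleftrightarrow> b \<in> T" for b
    using dec by (auto simp: set_decode_def)
  have cover: "(\<forall>i<Suc n. removed D i N (int j - int (n * 2 ^ N)))
        \<or> (\<exists>\<kappa><Suc N. n \<le> \<kappa> \<and> odd (set_encode T div 2 ^ prod_encode (\<kappa>, j div 2 ^ (N - \<kappa>))))"
    if j: "j < 2 * n * 2 ^ N" for j
  proof -
    define g where "g = int j - int (n * 2 ^ N)"
    have sub: "cell N g \<subseteq> {- real n..real n}"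
    proof
      fix u assume "u \<in> cell N g"
      then have u: "of_int g \<le> u * 2 ^ N" "u * 2 ^ N \<le> of_int g + 1" by (simp_all add: cell_bounds)
      have "- int (n * 2 ^ N) \<le> g" "g + 1 \<le> int (n * 2 ^ N)" using j unfolding g_def by linarith+
      then have "- real (n * 2 ^ N) \<le> of_int g" "of_int g + 1 \<le> real (n * 2 ^ N)" by linarith+
      moreover have "real (n * 2 ^ N) = real n * 2 ^ N" by simp
      ultimately have "- real n * 2 ^ N \<le> u * 2 ^ N" "u * 2 ^ N \<le> real n * 2 ^ N" using u by linarith+
      note un = this
      have "- real n \<le> u" using un(1) by (rule mult_right_le_imp_le) simp
      moreover have "u \<le> real n" using un(2) by (rule mult_right_le_imp_le) simp
      ultimately show "u \<in> {- real n..real n}" by simp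
    qed
    show ?thesis
    proof (cases "cell N g \<subseteq> C")
      case True
      then have "removed D i N g" if "i \<le> n" for i using N0 N(2)[OF that] that by blast
      then show ?thesis unfolding g_def by simp
    next
      case False
      then obtain u i where u: "u \<in> cell N g" "i \<in> I" "u \<in> V i" using sub unfolding C_def by blast
      have \<kappa>N: "\<kappa> i \<le> N" using N(3) u(2) .
      define M where "M = N - \<kappa> i"
      have pw: "(2::real) ^ N = 2 ^ \<kappa> i * 2 ^ M" using \<kappa>N by (simp add: M_def flip: power_add)
      have pwn: "(2::nat) ^ N = 2 ^ \<kappa> i * 2 ^ M" using \<kappa>N by (simp add: M_def flip: power_add)
      have O1: "of_int (a i) - 1 < u * 2 ^ \<kappa> i" and O2: "u * 2 ^ \<kappa> i < of_int (a i) + 2"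
        using u(3) unfolding V_def by simp_all
      have "(of_int (a i) - 1) * 2 ^ M < (u * 2 ^ \<kappa> i) * 2 ^ M" using O1 by (rule mult_strict_right_mono) simp
      moreover have "(u * 2 ^ \<kappa> i) * 2 ^ M < (of_int (a i) + 2) * 2 ^ M" using O2 by (rule mult_strict_right_mono) simp
      moreover have "u * 2 ^ N = (u * 2 ^ \<kappa> i) * 2 ^ M" unfolding pw by (rule mult.assoc[symmetric])
      moreover have "of_int g \<le> u * 2 ^ N" "u * 2 ^ N \<le> of_int g + 1" using u(1) by (simp_all add: cell_bounds)
      ultimately have "(of_int (a i) - 1) * 2 ^ M < of_int g + (1::real)" "of_int g < (of_int (a i) + 2) * (2::real) ^ M"
        by linarith+
      then have "of_int ((a i - 1) * 2 ^ M) < (of_int (g + 1) :: real)" "of_int g < (of_int ((a i + 2) * 2 ^ M) :: real)"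
        by simp_all
      then have g: "(a i - 1) * 2 ^ M \<le> g" "g < (a i + 2) * 2 ^ M"
        unfolding of_int_less_iff by simp_all
      define h where "h = nat (g div 2 ^ M - (a i - 1))"
      have d: "a i - 1 \<le> g div 2 ^ M" "g div 2 ^ M < a i + 2"
      proof -
        show "a i - 1 \<le> g div 2 ^ M" using zdiv_mono1[OF g(1), of "2 ^ M"] by simp
        have "(g div 2 ^ M) * 2 ^ M \<le> g"
        proof -
          have "0 \<le> g mod 2 ^ M" by simp
          then show ?thesis using div_mult_mod_eq[of g "2 ^ M"] by linarith
        qed
        then have "(g div 2 ^ M) * 2 ^ M < (a i + 2) * 2 ^ M" using g(2) by (rule le_less_trans)
        then show "g div 2 ^ M < a i + 2" by (rule mult_right_less_imp_less) simp
      qed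
      then have h: "h < 3" "int h = g div 2 ^ M - (a i - 1)" unfolding h_def by linarith+
      have "int j = g + int (n * 2 ^ \<kappa> i) * 2 ^ M" unfolding g_def pwn by simp
      then have "int (j div 2 ^ M) = (g + int (n * 2 ^ \<kappa> i) * 2 ^ M) div 2 ^ M" by (simp add: zdiv_int)
      also have "\<dots> = g div 2 ^ M + int (n * 2 ^ \<kappa> i)" by simp
      finally have "nat (a i + int h - 1 + int (n * 2 ^ \<kappa> i)) = j div 2 ^ M" using h(2) by simp
      then have "prod_encode (\<kappa> i, j div 2 ^ M) = f (i, h)" by (simp add: f_def)
      then have "prod_encode (\<kappa> i, j div 2 ^ M) \<in> T" unfolding T_def using u(2) h(1) by blast
      then show ?thesis using \<kappa>(1)[of i] \<kappa>N unfolding mem M_def by (intro disjI2 exI[of _ "\<kappa> i"]) simp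
    qed
  qed
  have cost: "2 ^ (n * s + n) * (\<Sum>b<set_encode T. of_bool (odd (set_encode T div 2 ^ b) \<and> pfst b \<le> N)
        * 2 ^ (N - pfst b * \<tau> n div 2 ^ n)) \<le> (2::nat) ^ N" (is "_ * ?sum \<le> _")
  proof -
    let ?w = "\<lambda>b. (2::nat) ^ (N - pfst b * \<tau> n div 2 ^ n)"
    have "?sum \<le> (\<Sum>b<set_encode T. of_bool (b \<in> T) * ?w b)"
      unfolding mem by (intro sum_mono mult_le_mono1) auto
    also have "\<dots> = (\<Sum>b\<in>{..<set_encode T} \<inter> T. ?w b)"
      by (simp add: sum.inter_restrict of_bool_def if_distrib[of "\<lambda>x. x * _"] cong: if_cong)
    also have "\<dots> \<le> (\<Sum>b\<in>T. ?w b)" using finT by (intro sum_mono2) auto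
    also have "\<dots> \<le> (\<Sum>x\<in>I \<times> {..<3}. ?w (f x))"
      unfolding T_def using I(1) sum_image_le[of "I \<times> {..<3}" ?w f] by (simp add: o_def)
    also have "\<dots> = (\<Sum>i\<in>I. \<Sum>h<3. ?w (f (i, h)))"
      unfolding sum.cartesian_product by (rule sum.cong) auto
    also have "\<dots> = (\<Sum>i\<in>I. 3 * 2 ^ (N - \<kappa> i * \<tau> n div 2 ^ n))" by (simp add: f_def)
    finally have 1: "?sum \<le> (\<Sum>i\<in>I. 3 * 2 ^ (N - \<kappa> i * \<tau> n div 2 ^ n))" .
    have 2: "real (3 * 2 ^ (N - \<kappa> i * \<tau> n div 2 ^ n)) \<le> 12 * 2 ^ N * v i powr t" if i: "i \<in> I" for i
    proof -
      let ?q = "\<kappa> i * \<tau> n div 2 ^ n"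
      have "?q \<le> \<kappa> i * 2 ^ n div 2 ^ n" using \<tau>(2) by (intro div_le_mono mult_le_mono2)
      then have q: "?q \<le> N" using N(3)[OF i] by simp
      have "real (\<kappa> i) * t < real ?q + 1"
      proof -
        have "\<kappa> i * \<tau> n < (?q + 1) * 2 ^ n"
          using dividend_less_div_times[of "2 ^ n" "\<kappa> i * \<tau> n"] by (simp add: algebra_simps)
        then have "real (\<kappa> i * \<tau> n) < real ((?q + 1) * 2 ^ n)" by (rule of_nat_less_iff[THEN iffD2])
        then show ?thesis by (simp add: t_def pos_divide_less_eq algebra_simps)
      qed
      then have "2 powr (real (\<kappa> i) * t) \<le> 2 powr (real ?q + 1)" by (intro powr_mono) auto
      also have "\<dots> = 2 * 2 ^ ?q" by (simp add: powr_add powr_realpow)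
      finally have A: "2 powr (real (\<kappa> i) * t) \<le> 2 * 2 ^ ?q" .
      have a1: "((1/2) ^ Suc (\<kappa> i)) powr t \<le> v i powr t"
        using \<kappa>(3)[of i] t(1) by (intro powr_mono2) auto
      have a2: "((1/2::real) ^ Suc (\<kappa> i)) powr t = 2 powr (- (real (Suc (\<kappa> i)) * t))"
        by (rule half_power_powr)
      have a3: "2 powr (- (real (Suc (\<kappa> i)) * t)) = 2 powr (- t) * 2 powr (- (real (\<kappa> i) * t))"
        by (simp add: powr_add[symmetric] algebra_simps)
      have a4: "1 / 2 \<le> 2 powr (- t)"
        using powr_mono[of "-1" "-t" "2::real"] t(2) by (simp add: powr_minus)
      have "1/2 * 2 powr (- (real (\<kappa> i) * t)) \<le> 2 powr (- t) * 2 powr (- (real (\<kappa> i) * t))"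
        using a4 by (rule mult_right_mono) simp
      also have "\<dots> \<le> v i powr t" using a1 unfolding a2 a3 .
      finally have "1/2 * 2 powr (- (real (\<kappa> i) * t)) \<le> v i powr t" .
      then have B: "1 \<le> 2 * v i powr t * 2 powr (real (\<kappa> i) * t)"
        by (simp add: powr_minus field_simps)
      have "1 \<le> 2 * v i powr t * (2 * 2 ^ ?q)"
        using B mult_left_mono[OF A, of "2 * v i powr t"] by simp
      then have "(2::real) ^ (N - ?q) * 1 \<le> 2 ^ (N - ?q) * (2 * v i powr t * (2 * 2 ^ ?q))"
        by (intro mult_left_mono) simp_all
      also have "\<dots> = 4 * (2 ^ (N - ?q) * 2 ^ ?q) * v i powr t" by (simp add: ac_simps)
      also have "(2::real) ^ (N - ?q) * 2 ^ ?q = 2 ^ N" using q by (simp flip: power_add)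
      finally show ?thesis by (simp add: ac_simps)
    qed
    have "real ?sum \<le> (\<Sum>i\<in>I. real (3 * 2 ^ (N - \<kappa> i * \<tau> n div 2 ^ n)))"
      using of_nat_mono[OF 1, where ?'a = real] unfolding of_nat_sum .
    also have "\<dots> \<le> (\<Sum>i\<in>I. 12 * 2 ^ N * v i powr t)" using 2 by (rule sum_mono)
    also have "\<dots> = 12 * 2 ^ N * (\<Sum>i\<in>I. v i powr t)" by (rule sum_distrib_left[symmetric])
    also have "\<dots> \<le> 12 * 2 ^ N * (2 * \<eta>)" using vsum[OF I(1)] by (intro mult_left_mono) auto
    also have "\<dots> = 2 ^ N / 2 ^ (n * s + n)" by (simp add: \<eta>_def)
    finally have "2 ^ (n * s + n) * real ?sum \<le> 2 ^ N" by (simp add: pos_le_divide_eq mult.commute)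
    then have "real (2 ^ (n * s + n) * ?sum) \<le> real (2 ^ N)" by simp
    then show ?thesis unfolding of_nat_le_iff .
  qed
  have "cheap_cover D \<tau> n s (prod_encode (N, set_encode T))"
    unfolding cheap_cover_def prod_encode_inverse fst_conv snd_conv using N(1) cover cost by blast
  then show ?thesis by blast
qed

lemma cheap_cover_cells:
  assumes D: "enumerates_complements D Q" and c: "cheap_cover D \<tau> n s c"
    and i: "i \<le> n" and x: "x \<in> Q i" "\<bar>x\<bar> < real n"
  shows "\<exists>b\<in>set_decode (psnd c). n \<le> pfst b \<and> pfst b \<le> pfst c \<and> x \<in> cell (pfst b) (int (psnd b) - int (n * 2 ^ pfst b))"
proof -
  define N where "N = pfst c"
  define g where "g = \<lfloor>x * 2 ^ N\<rfloor>"
  have g_le: "- int (n * 2 ^ N) \<le> g" "g < int (n * 2 ^ N)"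
  proof -
    have "- real n * 2 ^ N \<le> x * 2 ^ N" "x * 2 ^ N < real n * 2 ^ N"
      using x(2) by (intro mult_right_mono mult_strict_right_mono; simp)+
    then have "- real (n * 2 ^ N) \<le> x * 2 ^ N" "x * 2 ^ N < real (n * 2 ^ N)" by simp_all
    then show "- int (n * 2 ^ N) \<le> g" "g < int (n * 2 ^ N)" unfolding g_def by linarith+
  qed
  define j where "j = nat (g + int (n * 2 ^ N))"
  have j: "int j = g + int (n * 2 ^ N)" using g_le by (simp add: j_def)
  then have "int j < 2 * int (n * 2 ^ N)" using g_le by simp
  then have jl: "j < 2 * n * 2 ^ N" by (simp add: algebra_simps flip: of_nat_mult)
  have "\<not> removed D i N (int j - int (n * 2 ^ N))"
    using removed_disjoint[OF D, of i N g] floor_cell[of x N] x(1) j unfolding g_def by auto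
  moreover have "(\<forall>i<Suc n. removed D i N (int j - int (n * 2 ^ N)))
        \<or> (\<exists>\<kappa><Suc N. n \<le> \<kappa> \<and> odd (psnd c div 2 ^ prod_encode (\<kappa>, j div 2 ^ (N - \<kappa>))))"
    using c jl unfolding cheap_cover_def N_def by blast
  ultimately obtain \<kappa> where \<kappa>: "\<kappa> \<le> N" "n \<le> \<kappa>" "prod_encode (\<kappa>, j div 2 ^ (N - \<kappa>)) \<in> set_decode (psnd c)"
    using i by (auto simp: set_decode_def less_Suc_eq_le)
  define M where "M = N - \<kappa>"
  have pw: "(2::real) ^ N = 2 ^ \<kappa> * 2 ^ M" using \<kappa>(1) by (simp add: M_def flip: power_add)
  have pwn: "(2::nat) ^ N = 2 ^ \<kappa> * 2 ^ M" using \<kappa>(1) by (simp add: M_def flip: power_add)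
  define q where "q = j div 2 ^ M"
  have q: "q * 2 ^ M \<le> j" "j < (q + 1) * 2 ^ M"
    using dividend_less_div_times[of "2 ^ M" j] unfolding q_def by (simp_all add: algebra_simps)
  have "real q * 2 ^ M \<le> real j" "real j + 1 \<le> (real q + 1) * 2 ^ M"
  proof -
    have "real (q * 2 ^ M) \<le> real j" using q(1) by (rule of_nat_mono)
    then show "real q * 2 ^ M \<le> real j" by simp
    have "real (j + 1) \<le> real ((q + 1) * 2 ^ M)" using q(2) by (intro of_nat_mono) simp
    then show "real j + 1 \<le> (real q + 1) * 2 ^ M" by (simp add: algebra_simps)
  qed
  moreover have "real j - real n * 2 ^ N \<le> x * 2 ^ N" "x * 2 ^ N \<le> real j - real n * 2 ^ N + 1"
  proof -
    have "of_int g = real j - real n * 2 ^ N" using arg_cong[OF j, of real_of_int] by simp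
    then show "real j - real n * 2 ^ N \<le> x * 2 ^ N" "x * 2 ^ N \<le> real j - real n * 2 ^ N + 1"
      unfolding g_def by linarith+
  qed
  ultimately have "(real q - real n * 2 ^ \<kappa>) * 2 ^ M \<le> (x * 2 ^ \<kappa>) * 2 ^ M"
    "(x * 2 ^ \<kappa>) * 2 ^ M \<le> (real q - real n * 2 ^ \<kappa> + 1) * 2 ^ M"
    unfolding pw by (simp_all add: algebra_simps)
  then have "real q - real n * 2 ^ \<kappa> \<le> x * 2 ^ \<kappa>" "x * 2 ^ \<kappa> \<le> real q - real n * 2 ^ \<kappa> + 1"
    by simp_all
  then have "x \<in> cell \<kappa> (int q - int (n * 2 ^ \<kappa>))" unfolding cell_bounds by simp
  with \<kappa> show ?thesis unfolding N_def q_def M_def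
    by (intro bexI[of _ "prod_encode (\<kappa>, j div 2 ^ (pfst c - \<kappa>))"]) simp_all
qed

lemma cheap_cover_cost:
  assumes c: "cheap_cover D \<tau> n s c" and \<tau>: "\<tau> n \<le> 2 ^ n" and t: "real (\<tau> n) / 2 ^ n \<le> t"
  shows "(\<Sum>b\<in>{b \<in> set_decode (psnd c). pfst b \<le> pfst c}. ((1/2) ^ pfst b) powr t) \<le> 1 / 2 ^ (n * s + n)"
proof -
  define N where "N = pfst c"
  define T where "T = {b \<in> set_decode (psnd c). pfst b \<le> N}"
  let ?w = "\<lambda>b. (2::nat) ^ (N - pfst b * \<tau> n div 2 ^ n)"
  have sub: "T \<subseteq> {..<psnd c}" using set_decode_less by (auto simp: T_def)
  have "(\<Sum>b<psnd c. of_bool (odd (psnd c div 2 ^ b) \<and> pfst b \<le> N) * ?w b) = (\<Sum>b\<in>T. of_bool (b \<in> T) * ?w b)"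
    using sub by (intro sum.mono_neutral_cong_right) (auto simp: T_def set_decode_def)
  also have "\<dots> = (\<Sum>b\<in>T. ?w b)" by (rule sum.cong) auto
  finally have "2 ^ (n * s + n) * (\<Sum>b\<in>T. ?w b) \<le> 2 ^ N" using c unfolding cheap_cover_def N_def[symmetric] by simp
  then have "real (2 ^ (n * s + n) * (\<Sum>b\<in>T. ?w b)) \<le> real (2 ^ N)" by (rule of_nat_mono)
  then have sum: "2 ^ (n * s + n) * (\<Sum>b\<in>T. real (?w b)) \<le> 2 ^ N" by simp
  have each: "((1/2) ^ pfst b) powr t \<le> real (?w b) / 2 ^ N" if b: "b \<in> T" for b
  proof -
    let ?q = "pfst b * \<tau> n div 2 ^ n"
    have "?q \<le> pfst b * 2 ^ n div 2 ^ n" using \<tau> by (intro div_le_mono mult_le_mono2)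
    then have q: "?q \<le> N" using b by (simp add: T_def)
    have "((1/2::real) ^ pfst b) powr t = 2 powr (- (real (pfst b) * t))"
      by (rule half_power_powr)
    also have "\<dots> \<le> 2 powr (- real ?q)"
    proof (rule powr_mono)
      have "?q * 2 ^ n \<le> pfst b * \<tau> n" by simp
      then have "real (?q * 2 ^ n) \<le> real (pfst b * \<tau> n)" by (rule of_nat_mono)
      then have "real ?q \<le> real (pfst b) * (real (\<tau> n) / 2 ^ n)" by (simp add: pos_le_divide_eq)
      also have "\<dots> \<le> real (pfst b) * t" using t by (rule mult_left_mono) simp
      finally show "- (real (pfst b) * t) \<le> - real ?q" by simp
    qed simp
    also have "\<dots> = 1 / 2 ^ ?q"
      using half_power_powr[of ?q 1] by (simp only: mult_1_right power_one_over powr_one_gt_zero_iff) simp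
    also have "\<dots> = 2 ^ (N - ?q) / 2 ^ N" using q by (simp add: power_diff)
    finally show ?thesis by simp
  qed
  have "(\<Sum>b\<in>T. ((1/2) ^ pfst b) powr t) \<le> (\<Sum>b\<in>T. real (?w b) / 2 ^ N)" using each by (rule sum_mono)
  also have "\<dots> = (\<Sum>b\<in>T. real (?w b)) / 2 ^ N" by (rule sum_divide_distrib[symmetric])
  also have "\<dots> \<le> 1 / 2 ^ (n * s + n)"
    using sum by (simp add: pos_divide_le_eq pos_le_divide_eq mult.commute)
  finally show ?thesis unfolding T_def N_def .
qed

section \<open>Prescribing directions\<close>

text \<open>
  The block number \<open>n\<close> is read as a code of \<open>(rep, j, b, c)\<close>: the prefix \<open>q\<close> of length \<open>j\<close> of the
  current path asks for the direction coded by the digit of \<open>c\<close> in base \<open>b\<close> at position \<open>q\<close>.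
  Thus every assignment of directions to finitely many prefixes is requested by
  some block, and by infinitely many because of the repetition counter \<open>rep\<close>.
\<close>

definition request :: "(nat \<Rightarrow> nat) \<Rightarrow> nat \<Rightarrow> nat \<Rightarrow> nat" where
  "request S n p = psnd (psnd (psnd n)) div pfst (psnd (psnd n)) ^ (p div 2 ^ (S n - S (pfst (psnd n))))
     mod pfst (psnd (psnd n))"

text \<open>
  A decidable condition that forces the bounds on a direction and is eventually satisfied by
  every direction on which \<open>a + \<xi> b\<close> is positive.  The number \<open>X (3 * n)\<close> stands for \<open>2 ^ (3 * n) * \<xi>\<close>
  rounded down.
\<close>

definition admissible :: "(nat \<Rightarrow> nat) \<Rightarrow> nat \<Rightarrow> int \<Rightarrow> int \<Rightarrow> bool" where
  "admissible X n a b \<longleftrightarrow> 2 * \<bar>a\<bar> \<le> int (2 ^ n) \<and> 2 * \<bar>b\<bar> \<le> int (2 ^ n) \<and>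
     int (2 ^ (2 * n + 1)) \<le> a * int (2 ^ (3 * n)) + b * int (X (3 * n))"

definition dir_a :: "(nat \<Rightarrow> nat) \<Rightarrow> (nat \<Rightarrow> nat) \<Rightarrow> nat \<Rightarrow> nat \<Rightarrow> int" where
  "dir_a X S n p = (if admissible X n (int_decode (pfst (request S n p))) (int_decode (psnd (request S n p)))
     then int_decode (pfst (request S n p)) else 1)"

definition dir_b :: "(nat \<Rightarrow> nat) \<Rightarrow> (nat \<Rightarrow> nat) \<Rightarrow> nat \<Rightarrow> nat \<Rightarrow> int" where
  "dir_b X S n p = (if admissible X n (int_decode (pfst (request S n p))) (int_decode (psnd (request S n p)))
     then int_decode (psnd (request S n p)) else 0)"

lemma recf_request:
  assumes "recf G S" "recf G f" "recf G g" shows "recf G (\<lambda>p. request S (f p) (g p))"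
  unfolding request_def by (intro recI recf_comp[OF assms(1)] assms(2,3))

lemma recz_dir:
  assumes X: "recf G X" and S: "recf G S"
  shows "recz G (\<lambda>p. dir_a X S (pfst p) (psnd p))" "recz G (\<lambda>p. dir_b X S (pfst p) (psnd p))"
  unfolding dir_a_def dir_b_def admissible_def
  by (intro recI recf_request[OF S] recf_comp[OF X])+

lemma scaled_floor:
  fixes \<xi> :: real
  assumes "0 \<le> \<xi>" shows "real (nat \<lfloor>2 ^ k * \<xi>\<rfloor>) \<le> 2 ^ k * \<xi>" "2 ^ k * \<xi> < real (nat \<lfloor>2 ^ k * \<xi>\<rfloor>) + 1"
proof -
  have "0 \<le> 2 ^ k * \<xi>" using assms by simp
  then have "real (nat \<lfloor>2 ^ k * \<xi>\<rfloor>) = of_int \<lfloor>2 ^ k * \<xi>\<rfloor>" by (simp add: of_nat_nat)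
  then show "real (nat \<lfloor>2 ^ k * \<xi>\<rfloor>) \<le> 2 ^ k * \<xi>" "2 ^ k * \<xi> < real (nat \<lfloor>2 ^ k * \<xi>\<rfloor>) + 1" by linarith+
qed

lemma admissible_real:
  fixes \<xi> :: real
  assumes \<xi>: "0 \<le> \<xi>" "\<xi> < 1" and X: "\<And>k. X k = nat \<lfloor>2 ^ k * \<xi>\<rfloor>"
  shows "admissible X n a b \<Longrightarrow> 2 * \<bar>real_of_int a\<bar> \<le> 2 ^ n" "admissible X n a b \<Longrightarrow> 2 * \<bar>real_of_int b\<bar> \<le> 2 ^ n"
    "admissible X n a b \<Longrightarrow> 2 * 2 ^ (2 * n) \<le> real_of_int a * 2 ^ (3 * n) + of_int b * real (X (3 * n))"
    "\<bar>of_int b * real (X (3 * n)) - of_int b * (2 ^ (3 * n) * \<xi>)\<bar> \<le> \<bar>real_of_int b\<bar>"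
proof -
  assume ad: "admissible X n a b"
  have "real_of_int (2 * \<bar>a\<bar>) \<le> of_int (int (2 ^ n))" using ad unfolding admissible_def of_int_le_iff by blast
  then show "2 * \<bar>real_of_int a\<bar> \<le> 2 ^ n" by simp
  have "real_of_int (2 * \<bar>b\<bar>) \<le> of_int (int (2 ^ n))" using ad unfolding admissible_def of_int_le_iff by blast
  then show "2 * \<bar>real_of_int b\<bar> \<le> 2 ^ n" by simp
  have "real_of_int (int (2 ^ (2 * n + 1))) \<le> of_int (a * int (2 ^ (3 * n)) + b * int (X (3 * n)))"
    using ad unfolding admissible_def of_int_le_iff by blast
  then show "2 * 2 ^ (2 * n) \<le> real_of_int a * 2 ^ (3 * n) + of_int b * real (X (3 * n))" by simp
next
  have "\<bar>real (X (3 * n)) - 2 ^ (3 * n) * \<xi>\<bar> \<le> 1"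
    using scaled_floor[OF \<xi>(1), of "3 * n"] unfolding X by linarith
  then have "\<bar>real_of_int b\<bar> * \<bar>real (X (3 * n)) - 2 ^ (3 * n) * \<xi>\<bar> \<le> \<bar>real_of_int b\<bar> * 1"
    by (rule mult_left_mono) simp
  then show "\<bar>of_int b * real (X (3 * n)) - of_int b * (2 ^ (3 * n) * \<xi>)\<bar> \<le> \<bar>real_of_int b\<bar>"
    by (simp only: abs_mult[symmetric] right_diff_distrib mult_1_right)
qed

lemma power_3n: "(2::real) ^ (3 * n) = 2 ^ (2 * n) * 2 ^ n" "(2::real) ^ (2 * n) = 2 ^ n * 2 ^ n"
  by (simp_all flip: power_add)

lemma admissible_bounds:
  fixes \<xi> :: real
  assumes \<xi>: "0 \<le> \<xi>" "\<xi> < 1" and X: "\<And>k. X k = nat \<lfloor>2 ^ k * \<xi>\<rfloor>" and ad: "admissible X n a b"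
  shows "1 \<le> 2 ^ n * (of_int a + \<xi> * of_int b)" "of_int a + \<xi> * of_int b \<le> 2 ^ n"
    "\<bar>a\<bar> \<le> 2 ^ n" "\<bar>b\<bar> \<le> 2 ^ n"
proof -
  note r1 = admissible_real(1)[OF \<xi> X ad] and r2 = admissible_real(2)[OF \<xi> X ad]
    and r3 = admissible_real(3)[OF \<xi> X ad] and r4 = admissible_real(4)[OF \<xi> X, of b n]
  have p: "(1::real) \<le> 2 ^ n" by simp
  have "(2::real) ^ n * 1 \<le> 2 ^ n * 2 ^ n" using p by (rule mult_left_mono) simp
  then have "\<bar>real_of_int b\<bar> \<le> 2 ^ (2 * n)" using r2 p unfolding power_3n(2) by linarith
  then have "2 ^ (2 * n) \<le> real_of_int a * 2 ^ (3 * n) + of_int b * (2 ^ (3 * n) * \<xi>)"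
    using r3 r4 by linarith
  then have "2 ^ (2 * n) * 1 \<le> 2 ^ (2 * n) * (2 ^ n * (of_int a + \<xi> * of_int b))"
    unfolding power_3n(1) by (simp add: algebra_simps)
  then show "1 \<le> 2 ^ n * (of_int a + \<xi> * of_int b)" by (rule mult_left_le_imp_le) simp
  have "\<xi> * of_int b \<le> \<xi> * \<bar>of_int b\<bar>" using \<xi>(1) by (intro mult_left_mono) auto
  also have "\<dots> \<le> 1 * \<bar>of_int b\<bar>" using \<xi>(2) by (intro mult_right_mono) auto
  finally show "of_int a + \<xi> * of_int b \<le> 2 ^ n" using r1 r2 by linarith
  show "\<bar>a\<bar> \<le> 2 ^ n" "\<bar>b\<bar> \<le> 2 ^ n" using ad unfolding admissible_def by auto
qed

lemma admissible_eventually: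
  fixes \<xi> :: real
  assumes \<xi>: "0 \<le> \<xi>" "\<xi> < 1" and X: "\<And>k. X k = nat \<lfloor>2 ^ k * \<xi>\<rfloor>"
    and pos: "0 < of_int a + \<xi> * of_int b"
  shows "\<exists>K. \<forall>n\<ge>K. admissible X n a b"
proof -
  define c where "c = of_int a + \<xi> * of_int b"
  have c: "0 < c" using pos by (simp add: c_def)
  obtain K where K: "3 / c + 2 * \<bar>real_of_int a\<bar> + 2 * \<bar>real_of_int b\<bar> < 2 ^ K"
    using real_arch_pow[of 2 "3 / c + 2 * \<bar>real_of_int a\<bar> + 2 * \<bar>real_of_int b\<bar>"] by auto
  have "admissible X n a b" if n: "K \<le> n" for n
  proof -
    have "(2::real) ^ K \<le> 2 ^ n" using n by (rule power_increasing) simp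
    moreover have "0 < 3 / c" using c by simp
    ultimately have b: "2 * \<bar>real_of_int a\<bar> \<le> 2 ^ n" "2 * \<bar>real_of_int b\<bar> \<le> 2 ^ n" "3 / c \<le> 2 ^ n"
      using K by linarith+
    have "3 \<le> 2 ^ n * c" using b(3) c by (simp add: pos_divide_le_eq)
    then have "2 ^ (2 * n) * 3 \<le> 2 ^ (2 * n) * (2 ^ n * c)" by (rule mult_left_mono) simp
    then have 1: "3 * 2 ^ (2 * n) \<le> real_of_int a * 2 ^ (3 * n) + of_int b * (2 ^ (3 * n) * \<xi>)"
      unfolding c_def power_3n(1) by (simp add: algebra_simps)
    have p: "(1::real) \<le> 2 ^ n" by simp
    have "(2::real) ^ n * 1 \<le> 2 ^ n * 2 ^ n" using p by (rule mult_left_mono) simp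
    then have 2: "\<bar>real_of_int b\<bar> \<le> 2 ^ (2 * n)" using b(2) p unfolding power_3n(2) by linarith
    have "2 * 2 ^ (2 * n) \<le> real_of_int a * 2 ^ (3 * n) + of_int b * real (X (3 * n))"
      using 1 2 admissible_real(4)[OF \<xi> X, of b n] by linarith
    then have "real_of_int (int (2 ^ (2 * n + 1))) \<le> of_int (a * int (2 ^ (3 * n)) + b * int (X (3 * n)))" by simp
    moreover have "real_of_int (2 * \<bar>a\<bar>) \<le> of_int (int (2 ^ n))" "real_of_int (2 * \<bar>b\<bar>) \<le> of_int (int (2 ^ n))"
      using b by simp_all
    ultimately show ?thesis unfolding admissible_def of_int_le_iff by blast
  qed
  then show ?thesis by blast
qed

lemma path_system_directions:
  fixes \<xi> :: real
  assumes S: "S 0 = 0" "\<And>n. S n + (n + 4)\<^sup>2 \<le> S (Suc n)"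
    and \<xi>: "0 \<le> \<xi>" "\<xi> < 1" and X: "\<And>k. X k = nat \<lfloor>2 ^ k * \<xi>\<rfloor>"
  shows "path_system S (dir_a X S) (dir_b X S) \<xi>"
proof
  show "S 0 = 0" "\<And>n. S n + (n + 4)\<^sup>2 \<le> S (Suc n)" by (fact S)+
  fix n p
  note b = admissible_bounds[OF \<xi> X, of n "int_decode (pfst (request S n p))" "int_decode (psnd (request S n p))"]
  show "\<bar>dir_a X S n p\<bar> \<le> 2 ^ n" using b(3) by (simp add: dir_a_def)
  show "\<bar>dir_b X S n p\<bar> \<le> 2 ^ n" using b(4) by (simp add: dir_b_def)
  show "1 \<le> 2 ^ n * (of_int (dir_a X S n p) + \<xi> * of_int (dir_b X S n p))"
    using b(1) by (simp add: dir_a_def dir_b_def)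
  show "of_int (dir_a X S n p) + \<xi> * of_int (dir_b X S n p) \<le> 2 ^ n"
    using b(2) by (simp add: dir_a_def dir_b_def)
qed

lemma directions_recur:
  fixes \<xi> :: real
  assumes \<xi>: "0 \<le> \<xi>" "\<xi> < 1" and X: "\<And>k. X k = nat \<lfloor>2 ^ k * \<xi>\<rfloor>"
    and L: "distinct (map fst L)"
    and pos: "\<And>e. e < length L \<Longrightarrow> 0 < of_int (fst (snd (L ! e))) + \<xi> * of_int (snd (snd (L ! e)))"
  shows "\<exists>n\<ge>M. \<forall>e<length (L :: (nat \<times> int \<times> int) list). \<forall>p. p div 2 ^ (S n - S j) = fst (L ! e) \<longrightarrow>
     dir_a X S n p = fst (snd (L ! e)) \<and> dir_b X S n p = snd (snd (L ! e))"
proof -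
  define A B where "A e = fst (snd (L ! e))" and "B e = snd (snd (L ! e))" for e
  define code where "code e = prod_encode (int_encode (A e), int_encode (B e))" for e
  have "\<forall>e. \<exists>K. e < length L \<longrightarrow> (\<forall>n\<ge>K. admissible X n (A e) (B e))"
    using admissible_eventually[OF \<xi> X] pos unfolding A_def B_def by blast
  from choice[OF this] obtain K where K: "\<forall>e. e < length L \<longrightarrow> (\<forall>n\<ge>K e. admissible X n (A e) (B e))" ..
  define d where "d = Suc (\<Sum>e<length L. code e)"
  have code_less: "code e < d" if "e < length L" for e
    using member_le_sum[of e "{..<length L}" code] that by (simp add: d_def le_imp_less_Suc)
  \<comment> \<open>The prefixes are distinct, so that each of them determines its requested direction.\<close>
  define digit where "digit q = (if \<exists>e<length L. fst (L ! e) = q then code (SOME e. e < length L \<and> fst (L ! e) = q) else 0)" for q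
  have digit: "digit (fst (L ! e)) = code e" if e: "e < length L" for e
  proof -
    have u: "e' = e" if "e' < length L \<and> fst (L ! e') = fst (L ! e)" for e'
      using that e L nth_eq_iff_index_eq[of "map fst L" e' e] by simp
    have "(SOME e'. e' < length L \<and> fst (L ! e') = fst (L ! e)) = e"
      using someI[of "\<lambda>e'. e' < length L \<and> fst (L ! e') = fst (L ! e)" e] e u by blast
    then show ?thesis using e by (auto simp: digit_def)
  qed
  have digit_less: "digit q < d" for q
  proof (cases "\<exists>e<length L. fst (L ! e) = q")
    case True
    then show ?thesis using digit code_less by auto
  next
    case False
    then have "digit q = 0" unfolding digit_def by (rule if_not_P)
    then show ?thesis by (simp add: d_def)
  qed
  \<comment> \<open>Sums serve as upper bounds for all prefixes and codes.\<close>
  define m where "m = Suc (\<Sum>e<length L. fst (L ! e))"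
  have m: "fst (L ! e) < m" if "e < length L" for e
    using member_le_sum[of e "{..<length L}" "\<lambda>e. fst (L ! e)"] that by (simp add: m_def le_imp_less_Suc)
  obtain c where c: "\<forall>q<m. c div d ^ q mod d = digit q"
    using exists_base_expansion[of m digit d] digit_less by blast
  define rep where "rep = M + (\<Sum>e<length L. K e)"
  define n where "n = prod_encode (rep, prod_encode (j, prod_encode (d, c)))"
  have n: "rep \<le> n" unfolding n_def by (rule le_prod_encode_1)
  have "dir_a X S n p = A e \<and> dir_b X S n p = B e" if e: "e < length L" and p: "p div 2 ^ (S n - S j) = fst (L ! e)" for e p
  proof -
    have "request S n p = c div d ^ (p div 2 ^ (S n - S j)) mod d"
      by (simp add: request_def n_def)
    also have "\<dots> = code e" using c m[OF e] digit[OF e] p by simp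
    finally have r: "request S n p = code e" .
    have "K e \<le> (\<Sum>e<length L. K e)" using member_le_sum[of e "{..<length L}" K] e by simp
    then have "admissible X n (A e) (B e)" using K e n by (simp add: rep_def)
    then show ?thesis unfolding dir_a_def dir_b_def r by (simp add: code_def)
  qed
  moreover have "M \<le> n" using n by (simp add: rep_def)
  ultimately show ?thesis unfolding A_def B_def by blast
qed

section \<open>The dimension of the pieces\<close>

context path_system
begin

definition dim_piece :: "(nat \<Rightarrow> real set) \<Rightarrow> nat \<Rightarrow> nat \<Rightarrow> nat \<Rightarrow> nat \<Rightarrow> (nat \<times> int \<times> int) list \<Rightarrow> real set" where
  "dim_piece Q k i l j L = {y. \<exists>b P. b \<in> Q i \<and> \<bar>b\<bar> \<le> real l \<and>
     (\<forall>e<length L. P e \<in> paths \<and> P e j = fst (L ! e)) \<and>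
     real (Suc k) * y = b + (\<Sum>e<length L. of_int (fst (snd (L ! e))) * path_val \<alpha> (P e)
        + of_int (snd (snd (L ! e))) * path_val \<beta> (P e))}"

lemma path_err_Suc_le:
  assumes "S n + N + (n + 4)\<^sup>2 \<le> S (Suc n)" shows "path_err (Suc n) \<le> (1/2) ^ N"
proof -
  have "N + ((Suc n)\<^sup>2 + Suc n + 1) \<le> S (Suc n)" using assms by (simp add: power2_eq_square algebra_simps)
  then have "(2::real) ^ (N + ((Suc n)\<^sup>2 + Suc n + 1)) \<le> 2 ^ S (Suc n)" by (rule power_increasing) simp
  then have "(2::real) ^ N * (2 * 2 ^ ((Suc n)\<^sup>2 + Suc n)) \<le> 2 ^ S (Suc n)"
    by (simp only: power_add power_one_right mult.commute[of _ 2])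
  note le = this
  have div: "x * (2 * q) \<le> z \<Longrightarrow> 0 < x \<Longrightarrow> 0 < z \<Longrightarrow> 2 * (q / z) \<le> 1 / x" for x q z :: real
    by (simp add: field_simps)
  show ?thesis unfolding path_err_def power_one_over by (rule div[OF le]) simp_all
qed

text \<open>
  In a block \<open>n\<close> whose directions annihilate the linear forms of all paths involved, the path
  part is known up to a negligible error from the \<open>m * S n\<close> digits before the block.  The
  remaining part lies in one of the cells of the economical cover.  Translating this cover by
  \<open>2 ^ (m * S n)\<close> vectors multiplies its weight by the same number, which is
  compensated by the bound \<open>2 ^ -(n * S n + n)\<close> as soon as \<open>m \<le> n\<close>.
\<close>

lemma dim_piece_null:
  assumes D: "enumerates_complements D Q"
    and c: "\<And>n. cheap_cover D \<tau> n (S n) (c n)" and step: "\<And>n. S n + pfst (c n) + (n + 4)\<^sup>2 \<le> S (Suc n)"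
    and \<tau>: "\<And>n. \<tau> n \<le> 2 ^ n" and t: "0 < t" "\<forall>\<^sub>F n in sequentially. real (\<tau> n) / 2 ^ n \<le> t"
    and kill: "\<And>M. \<exists>n\<ge>M. \<forall>e<length L. \<forall>P\<in>paths. P j = fst (L ! e) \<longrightarrow>
       fst (snd (L ! e)) * \<alpha> n (P n) + snd (snd (L ! e)) * \<beta> n (P n) = 0"
  shows "hausdorff_measure t (dim_piece Q k i l j L) = 0"
proof (rule hausdorff_null_finite_cball_covers[OF t(1)])
  fix \<delta> \<epsilon> :: real assume pos: "0 < \<delta>" "0 < \<epsilon>"
  define r s where "r e = fst (snd (L ! e))" and "s e = snd (snd (L ! e))" for e
  define m where "m = length L"
  \<comment> \<open>One unit for the cell itself, the rest for the coefficients times the error of the block.\<close>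
  define W where "W = 1 + (\<Sum>e<m. \<bar>real_of_int (r e)\<bar> + \<bar>real_of_int (s e)\<bar>)"
  have W: "1 \<le> W" unfolding W_def by (simp add: sum_nonneg)
  have "(\<lambda>n. W * (1/2) ^ n) \<longlonglongrightarrow> 0" by (intro tendsto_mult_right_zero LIMSEQ_power_zero) simp
  then have "\<forall>\<^sub>F n in sequentially. W * (1/2) ^ n < \<delta>" using pos(1) by (rule order_tendstoD)
  moreover have "(\<lambda>n. (2 * W) powr t * (1/2) ^ n) \<longlonglongrightarrow> 0" by (intro tendsto_mult_right_zero LIMSEQ_power_zero) simp
  then have "\<forall>\<^sub>F n in sequentially. (2 * W) powr t * (1/2) ^ n < \<epsilon>" using pos(2) by (rule order_tendstoD)
  ultimately have "\<forall>\<^sub>F n in sequentially. W * (1/2) ^ n < \<delta> \<and> (2 * W) powr t * (1/2) ^ n < \<epsilon> \<and>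
      real (\<tau> n) / 2 ^ n \<le> t \<and> i + l + m + 1 \<le> n"
    using t(2) eventually_ge_at_top[of "i + l + m + 1"] by eventually_elim simp
  then obtain M where M: "\<forall>n\<ge>M. W * (1/2) ^ n < \<delta> \<and> (2 * W) powr t * (1/2) ^ n < \<epsilon> \<and>
      real (\<tau> n) / 2 ^ n \<le> t \<and> i + l + m + 1 \<le> n"
    unfolding eventually_sequentially by blast
  obtain n where "n \<ge> M" and kn: "\<And>e P. e < m \<Longrightarrow> P \<in> paths \<Longrightarrow> P j = fst (L ! e) \<Longrightarrow>
       r e * \<alpha> n (P n) + s e * \<beta> n (P n) = 0"
    using kill[of M] unfolding r_def s_def m_def by blast
  from M[rule_format, OF \<open>n \<ge> M\<close>] have n: "W * (1/2) ^ n < \<delta>" "(2 * W) powr t * (1/2) ^ n < \<epsilon>" "real (\<tau> n) / 2 ^ n \<le> t"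
    "i + l + m + 1 \<le> n" by simp_all
  define T where "T = {b \<in> set_decode (psnd (c n)). n \<le> pfst b \<and> pfst b \<le> pfst (c n)}"
  have finT: "finite T" unfolding T_def by simp
  define V where "V = PiE {..<m} (\<lambda>_. {..<(2::nat) ^ S n})"
  have finV: "finite V" unfolding V_def by (intro finite_PiE) simp_all
  have cardV: "card V = (2 ^ S n) ^ m" unfolding V_def by (simp add: card_PiE)
  define sp where "sp pv = (\<Sum>e<m. of_int (r e) * path_apx \<alpha> n (pv e) + of_int (s e) * path_apx \<beta> n (pv e))" for pv
  define cc where "cc b = of_int (int (psnd b) - int (n * 2 ^ pfst b)) / (2::real) ^ pfst b" for b
  define ctr where "ctr x = (cc (snd x) + sp (fst x)) / real (Suc k)" for x :: "(nat \<Rightarrow> nat) \<times> nat"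
  define rad where "rad x = W * (1/2) ^ pfst (snd x)" for x :: "(nat \<Rightarrow> nat) \<times> nat"
  have "dim_piece Q k i l j L \<subseteq> (\<Union>x\<in>V \<times> T. cball (ctr x) (rad x))"
  proof
    fix y assume "y \<in> dim_piece Q k i l j L"
    then obtain b P where bP: "b \<in> Q i" "\<bar>b\<bar> \<le> real l" "\<And>e. e < m \<Longrightarrow> P e \<in> paths" "\<And>e. e < m \<Longrightarrow> P e j = fst (L ! e)"
      "real (Suc k) * y = b + (\<Sum>e<m. of_int (r e) * path_val \<alpha> (P e) + of_int (s e) * path_val \<beta> (P e))"
      unfolding dim_piece_def m_def r_def s_def by blast
    have "i \<le> n" "\<bar>b\<bar> < real n" using n(4) bP(2) by simp_all
    from cheap_cover_cells[OF D c this(1) bP(1) this(2)] obtain u where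
      u: "u \<in> T" "b \<in> cell (pfst u) (int (psnd u) - int (n * 2 ^ pfst u))" unfolding T_def by blast
    define h where "h = (1/2::real) ^ pfst u"
    have h0: "0 \<le> h" by (simp add: h_def)
    have bc: "\<bar>b - cc u\<bar> \<le> h"
      using u(2) unfolding cell_def cc_def h_def power_one_over by (simp add: add_divide_distrib)
    define pv where "pv = restrict (\<lambda>e. P e n) {..<m}"
    have pv: "pv \<in> V" unfolding V_def pv_def using path_less bP(3) by auto
    have errh: "path_err (Suc n) \<le> h"
    proof -
      have "path_err (Suc n) \<le> (1/2) ^ pfst (c n)" by (rule path_err_Suc_le[OF step])
      also have "\<dots> \<le> h" unfolding h_def using u(1) by (intro power_decreasing) (auto simp: T_def)
      finally show ?thesis .
    qed
    have "\<bar>(\<Sum>e<m. of_int (r e) * path_val \<alpha> (P e) + of_int (s e) * path_val \<beta> (P e)) - sp pv\<bar>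
        \<le> (\<Sum>e<m. (\<bar>real_of_int (r e)\<bar> + \<bar>real_of_int (s e)\<bar>) * h)"
      unfolding sp_def sum_subtractf[symmetric]
    proof (rule order_trans[OF sum_abs sum_mono])
      fix e assume "e \<in> {..<m}"
      then have e: "e < m" by simp
      have "\<bar>of_int (r e) * path_val \<alpha> (P e) + of_int (s e) * path_val \<beta> (P e)
          - (of_int (r e) * path_apx \<alpha> n (P e n) + of_int (s e) * path_apx \<beta> n (P e n))\<bar>
          \<le> (\<bar>of_int (r e)\<bar> + \<bar>of_int (s e)\<bar>) * path_err (Suc n)"
        by (rule killed_block[OF bP(3)[OF e] kn[OF e bP(3)[OF e] bP(4)[OF e]]])
      also have "\<dots> \<le> (\<bar>of_int (r e)\<bar> + \<bar>of_int (s e)\<bar>) * h" using errh by (intro mult_left_mono) auto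
      finally show "\<bar>of_int (r e) * path_val \<alpha> (P e) + of_int (s e) * path_val \<beta> (P e)
          - (of_int (r e) * path_apx \<alpha> n (pv e) + of_int (s e) * path_apx \<beta> n (pv e))\<bar>
          \<le> (\<bar>of_int (r e)\<bar> + \<bar>of_int (s e)\<bar>) * h" using e by (simp add: pv_def)
    qed
    also have "\<dots> = (W - 1) * h" by (simp add: W_def sum_distrib_right)
    finally have sc: "\<bar>(\<Sum>e<m. of_int (r e) * path_val \<alpha> (P e) + of_int (s e) * path_val \<beta> (P e)) - sp pv\<bar> \<le> (W - 1) * h" .
    have "\<bar>real (Suc k) * y - (cc u + sp pv)\<bar> \<le> W * h"
      using bc sc unfolding bP(5) left_diff_distrib mult_1_left by linarith
    moreover have "ctr (pv, u) - y = - ((real (Suc k) * y - (cc u + sp pv)) / real (Suc k))"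
      by (simp add: ctr_def field_simps)
    ultimately have "\<bar>ctr (pv, u) - y\<bar> \<le> W * h / real (Suc k)"
      by (simp only: abs_minus_cancel abs_divide abs_of_nat divide_right_mono of_nat_0_le_iff)
    also have "\<dots> \<le> W * h / 1" using W h0 by (intro divide_left_mono) auto
    finally have "y \<in> cball (ctr (pv, u)) (rad (pv, u))" by (simp add: dist_real_def rad_def h_def)
    moreover have "(pv, u) \<in> V \<times> T" using pv u(1) by simp
    ultimately show "y \<in> (\<Union>x\<in>V \<times> T. cball (ctr x) (rad x))" by blast
  qed
  moreover have "\<forall>x\<in>V \<times> T. 0 \<le> rad x \<and> rad x \<le> \<delta>"
  proof
    fix x assume "x \<in> V \<times> T"
    then have "n \<le> pfst (snd x)" by (auto simp: T_def)
    then have "(1/2::real) ^ pfst (snd x) \<le> (1/2) ^ n" by (intro power_decreasing) auto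
    then have "rad x \<le> W * (1/2) ^ n" unfolding rad_def using W by (intro mult_left_mono) auto
    then have "rad x \<le> \<delta>" using n(1) by linarith
    moreover have "0 \<le> rad x" using W by (simp add: rad_def)
    ultimately show "0 \<le> rad x \<and> rad x \<le> \<delta>" by simp
  qed
  moreover have "(\<Sum>x\<in>V \<times> T. (2 * rad x) powr t) \<le> \<epsilon>"
  proof -
    have "(\<Sum>x\<in>V \<times> T. (2 * rad x) powr t) = (\<Sum>v\<in>V. \<Sum>b\<in>T. (2 * W * (1/2) ^ pfst b) powr t)"
      unfolding sum.cartesian_product by (rule sum.cong) (auto simp: rad_def mult.assoc)
    also have "\<dots> = real (card V) * (\<Sum>b\<in>T. (2 * W) powr t * ((1/2) ^ pfst b) powr t)"
      using W by (simp add: powr_mult)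
    also have "\<dots> = (2 ^ S n) ^ m * (2 * W) powr t * (\<Sum>b\<in>T. ((1/2) ^ pfst b) powr t)"
      by (simp add: cardV sum_distrib_left mult.assoc)
    also have "\<dots> \<le> (2 ^ S n) ^ m * (2 * W) powr t * (1 / 2 ^ (n * S n + n))"
    proof (rule mult_left_mono)
      have "(\<Sum>b\<in>T. ((1/2::real) ^ pfst b) powr t) \<le> (\<Sum>b\<in>{b \<in> set_decode (psnd (c n)). pfst b \<le> pfst (c n)}. ((1/2) ^ pfst b) powr t)"
        unfolding T_def by (intro sum_mono2) auto
      also have "\<dots> \<le> 1 / 2 ^ (n * S n + n)" by (rule cheap_cover_cost[OF c \<tau> n(3)])
      finally show "(\<Sum>b\<in>T. ((1/2::real) ^ pfst b) powr t) \<le> 1 / 2 ^ (n * S n + n)" .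
    qed simp
    also have "\<dots> \<le> (2 * W) powr t * (1/2) ^ n"
    proof -
      have "(2::real) ^ (S n * m) \<le> 2 ^ (n * S n)" using n(4) by (intro power_increasing) auto
      then have "(2::real) ^ (S n * m) * (1 / 2 ^ (n * S n)) \<le> 1" by (simp add: pos_divide_le_eq)
      then have "((2::real) ^ (S n * m) * (1 / 2 ^ (n * S n))) * ((2 * W) powr t * (1/2) ^ n) \<le> 1 * ((2 * W) powr t * (1/2) ^ n)"
        by (rule mult_right_mono) simp
      then show ?thesis by (simp add: power_mult[symmetric] power_add power_one_over field_simps)
    qed
    also note n(2)
    finally show ?thesis by simp
  qed
  ultimately show "\<exists>(I :: ((nat \<Rightarrow> nat) \<times> nat) set) c r. finite I \<and> dim_piece Q k i l j L \<subseteq> (\<Union>x\<in>I. cball (c x) (r x)) \<and>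
        (\<forall>x\<in>I. 0 \<le> r x \<and> r x \<le> \<delta>) \<and> (\<Sum>x\<in>I. (2 * r x) powr t) \<le> \<epsilon>"
    using finV finT by (intro exI[of _ "V \<times> T"] exI[of _ ctr] exI[of _ rad]) simp
qed

end

section \<open>The construction\<close>

text \<open>
  A block is made so long that its end is finer than all cells of the cover found for its beginning.
\<close>

primrec scale :: "(nat \<Rightarrow> nat \<Rightarrow> bool) \<Rightarrow> (nat \<Rightarrow> nat) \<Rightarrow> nat \<Rightarrow> nat" where
  "scale D \<tau> 0 = 0"
| "scale D \<tau> (Suc n) = scale D \<tau> n + pfst (LEAST c. cheap_cover D \<tau> n (scale D \<tau> n) c) + (n + 4)\<^sup>2"

lemma recf_scale:
  assumes D: "recp G (\<lambda>p. D (pfst p) (psnd p))" and \<tau>: "recf G \<tau>"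
    and ex: "\<And>n s. \<exists>c. cheap_cover D \<tau> n s c"
  shows "recf G (scale D \<tau>)"
proof -
  have "recp G (\<lambda>q. cheap_cover D \<tau> (pfst (pfst q)) (psnd (pfst q)) (psnd q))"
    by (intro recI recp_cheap_cover[OF D \<tau>])
  from recf_Least[of G "\<lambda>p c. cheap_cover D \<tau> (pfst p) (psnd p) c", OF this ex]
  have "recf G (\<lambda>p. (\<lambda>m s. LEAST c. cheap_cover D \<tau> m s c) (pfst p) (psnd p))" by simp
  note L = recf_comp2[OF this]
  have "recf G (\<lambda>n. rec_nat 0 (\<lambda>m s. s + pfst (LEAST c. cheap_cover D \<tau> m s c) + (m + 4)\<^sup>2) n)"
    by (intro recI L)
  moreover have "rec_nat 0 (\<lambda>m s. s + pfst (LEAST c. cheap_cover D \<tau> m s c) + (m + 4)\<^sup>2) n = scale D \<tau> n" for n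
    by (induction n) simp_all
  ultimately show ?thesis by simp
qed

lemma recf_binary_digits:
  assumes "recp G (real_code r)" shows "recf G (\<lambda>k. nat \<lfloor>2 ^ k * frac r\<rfloor>)"
proof -
  have digit: "real_code r (2 * m + 1) \<longleftrightarrow> odd \<lfloor>2 ^ Suc m * frac r\<rfloor>" for m
    by (simp add: real_code_def oracle_join_def)
  have step: "nat \<lfloor>2 ^ Suc m * frac r\<rfloor> = 2 * nat \<lfloor>2 ^ m * frac r\<rfloor> + of_bool (real_code r (2 * m + 1))" for m
  proof -
    define y where "y = 2 ^ m * frac r"
    have y: "0 \<le> y" by (simp add: y_def frac_ge_0)
    have e: "2 ^ Suc m * frac r = 2 * y" by (simp add: y_def)
    have d: "\<lfloor>2 * y\<rfloor> div 2 = \<lfloor>y\<rfloor>" using floor_divide_real_eq_div[of 2 "2 * y"] by simp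
    have "\<lfloor>2 * y\<rfloor> = 2 * \<lfloor>y\<rfloor> + of_bool (odd \<lfloor>2 * y\<rfloor>)"
    proof (cases "odd \<lfloor>2 * y\<rfloor>")
      case True then show ?thesis using odd_two_times_div_two_succ[OF True] d by simp
    next
      case False then show ?thesis using d by (metis add.right_neutral even_two_times_div_two of_bool_eq(1))
    qed
    moreover have "0 \<le> \<lfloor>y\<rfloor>" using y by simp
    ultimately have "nat \<lfloor>2 * y\<rfloor> = 2 * nat \<lfloor>y\<rfloor> + of_bool (odd \<lfloor>2 * y\<rfloor>)"
      by (cases "odd \<lfloor>2 * y\<rfloor>") (simp_all add: nat_add_distrib nat_mult_distrib)
    then show ?thesis unfolding digit e y_def[symmetric] .
  qed
  have "recf G (\<lambda>k. rec_nat 0 (\<lambda>m r'. 2 * r' + of_bool (real_code r (2 * m + 1))) k)"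
    by (intro recI recp_comp[OF assms])
  moreover have "rec_nat 0 (\<lambda>m r'. 2 * r' + of_bool (real_code r (2 * m + 1))) k = nat \<lfloor>2 ^ k * frac r\<rfloor>" for k
  proof (induction k)
    case 0
    have "\<lfloor>frac r\<rfloor> = 0" using frac_ge_0[of r] frac_lt_1[of r] by linarith
    then show ?case by simp
  next
    case (Suc k) then show ?case unfolding step by simp
  qed
  ultimately show ?thesis by simp
qed

text \<open>
  Up to sign, the direction annihilated by the form \<open>r a + s b\<close> is \<open>(s, -r)\<close>.
\<close>

lemma irrational_direction:
  fixes \<xi> :: real
  assumes "\<xi> \<notin> \<rat>"
  shows "\<exists>a b :: int. r * a + s * b = 0 \<and> 0 < of_int a + \<xi> * of_int b"
proof (cases "r = 0 \<and> s = 0")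
  case True then show ?thesis by (intro exI[of _ 1] exI[of _ 0]) simp
next
  case False
  have "of_int s - \<xi> * of_int r \<noteq> 0"
  proof
    assume z: "of_int s - \<xi> * of_int r = 0"
    have "r \<noteq> 0" using z False by auto
    with z have "\<xi> = of_int s / of_int r" by (simp add: field_simps)
    with assms show False by simp
  qed
  then consider "0 < of_int s - \<xi> * of_int r" | "of_int s - \<xi> * of_int r < 0" by linarith
  then show ?thesis
  proof cases
    case 1 then show ?thesis by (intro exI[of _ s] exI[of _ "- r"]) simp
  next
    case 2 then show ?thesis by (intro exI[of _ "- s"] exI[of _ r]) simp
  qed
qed

text \<open>
  The case of dimension \<open>d < 1\<close>.  The oracle computes the rational numbers \<open>\<tau> n / 2 ^ n\<close> that
  decrease to \<open>d\<close> from above, hence by searching for covers also the block lengths and the directions.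
\<close>

lemma effective_extension:
  fixes B :: "real set" and \<xi> :: real
  assumes B: "additive_subgroup_real B" "B = (\<Union>i. Q i)"
    and D: "recp {char_fun z} (\<lambda>p. D (pfst p) (psnd p))" "enumerates_complements D Q"
    and codes: "recp {char_fun z} (real_code (hausdorff_dim B))" "recp {char_fun z} (real_code \<xi>)"
    and d1: "hausdorff_dim B < 1" and irr: "\<xi> \<notin> \<rat>"
  shows "\<exists>A. rat_subspace A \<and> Sigma02 z A \<and> B \<subseteq> A \<and> hausdorff_dim A = hausdorff_dim B
    \<and> {a + \<xi> * b | a b. a \<in> A \<and> b \<in> A} = UNIV"
proof -
  define d where "d = hausdorff_dim B"
  have d: "0 \<le> d" "d < 1" using d1 hausdorff_dim_nonneg by (simp_all add: d_def)
  have "\<lfloor>d\<rfloor> = 0" using d by linarith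
  then have fd: "frac d = d" by (simp add: frac_def)
  define \<tau> where "\<tau> n = nat \<lfloor>2 ^ n * frac d\<rfloor> + 1" for n
  have \<tau>_bounds: "2 ^ n * d < real (\<tau> n)" "real (\<tau> n) \<le> 2 ^ n * d + 1" for n
    using scaled_floor[OF d(1), of n] unfolding \<tau>_def fd of_nat_add of_nat_1 by linarith+
  have \<tau>_le: "\<tau> n \<le> 2 ^ n" for n
  proof -
    have "2 ^ n * d < 2 ^ n * 1" using d(2) by (intro mult_strict_left_mono) auto
    then have "\<lfloor>2 ^ n * d\<rfloor> < 2 ^ n" by (simp add: floor_less_iff)
    moreover have "0 \<le> \<lfloor>2 ^ n * d\<rfloor>" using d(1) by simp
    ultimately have "int (\<tau> n) \<le> int (2 ^ n)" unfolding \<tau>_def fd by simp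
    then show ?thesis by simp
  qed
  have \<tau>_pos: "0 < \<tau> n" for n by (simp add: \<tau>_def)
  have \<tau>_rec: "recf {char_fun z} \<tau>"
    using codes(1) unfolding \<tau>_def d_def[symmetric] by (intro recI recf_binary_digits)
  have null: "hausdorff_measure (real (\<tau> n) / 2 ^ n) B = 0" for n
    using \<tau>_bounds(1)[of n] by (intro hausdorff_null_above_dim) (simp add: d_def pos_less_divide_eq mult.commute)
  have QB: "Q i \<subseteq> B" for i using B(2) by blast
  have cov: "\<exists>c. cheap_cover D \<tau> n s c" for n s
    by (rule cheap_cover_exists[OF D(2) QB \<tau>_pos \<tau>_le null])
  define S where "S = scale D \<tau>"
  have S_rec: "recf {char_fun z} S" unfolding S_def by (rule recf_scale[OF D(1) \<tau>_rec cov])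
  define c where "c n = (LEAST c. cheap_cover D \<tau> n (S n) c)" for n
  have c: "cheap_cover D \<tau> n (S n) (c n)" for n unfolding c_def by (rule LeastI_ex[OF cov])
  have S: "S 0 = 0" "S (Suc n) = S n + pfst (c n) + (n + 4)\<^sup>2" for n
    by (simp_all add: S_def c_def)
  \<comment> \<open>Subtracting an integer from \<open>\<xi>\<close> does not affect \<open>A + \<xi> A\<close>, and the oracle provides binary digits.\<close>
  define \<xi>' where "\<xi>' = frac \<xi>"
  have \<xi>': "0 \<le> \<xi>'" "\<xi>' < 1" by (simp_all add: \<xi>'_def frac_ge_0 frac_lt_1)
  have irr': "\<xi>' \<notin> \<rat>"
  proof
    assume "\<xi>' \<in> \<rat>"
    then have "\<xi>' + of_int \<lfloor>\<xi>\<rfloor> \<in> \<rat>" by (intro Rats_add) auto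
    then show False using irr by (simp add: \<xi>'_def frac_def)
  qed
  define X where "X k = nat \<lfloor>2 ^ k * \<xi>'\<rfloor>" for k
  have X_rec: "recf {char_fun z} X" unfolding X_def \<xi>'_def by (rule recf_binary_digits[OF codes(2)])
  define \<alpha> \<beta> where "\<alpha> = dir_a X S" and "\<beta> = dir_b X S"
  interpret path_system S \<alpha> \<beta> \<xi>'
    unfolding \<alpha>_def \<beta>_def by (rule path_system_directions) (simp_all add: S \<xi>' X_def)
  \<comment> \<open>The subgroup, and its rational hull, that will be the extension.\<close>
  define G where "G = {b + v | b v. b \<in> B \<and> v \<in> path_group}"
  have G: "additive_subgroup_real G" unfolding G_def by (rule subgroup_sum[OF B(1) path_group_subgroup])
  define A where "A = rat_hull G"
  have A: "rat_subspace A" unfolding A_def by (rule rat_hull_subspace[OF G])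
  have zeroes: "0 \<in> B" "0 \<in> path_group"
    using B(1) path_group_subgroup by (simp_all add: additive_subgroup_real_def)
  have "B \<subseteq> G" unfolding G_def using zeroes(2) by force
  then have BA: "B \<subseteq> A" unfolding A_def using rat_hull_subset by blast
  have VA: "path_group \<subseteq> A"
  proof -
    have "path_group \<subseteq> G" unfolding G_def using zeroes(1) by force
    then show ?thesis unfolding A_def using rat_hull_subset by blast
  qed
  have sum: "{a + \<xi> * b | a b. a \<in> A \<and> b \<in> A} = UNIV"
  proof (rule rat_subspace_sum_UNIV[OF A, where k = "\<lfloor>\<xi>\<rfloor>"])
    fix y :: real assume "0 \<le> y" "y < 1"
    then obtain P where P: "P \<in> paths" "path_val \<alpha> P + \<xi>' * path_val \<beta> P = y" using greedy_expansion by blast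
    have "path_val \<alpha> P \<in> A" "path_val \<beta> P \<in> A" using path_val_in_group[OF P(1)] VA by blast+
    moreover have "\<xi> - of_int \<lfloor>\<xi>\<rfloor> = \<xi>'" by (simp add: \<xi>'_def frac_def)
    ultimately show "\<exists>a\<in>A. \<exists>b\<in>A. a + (\<xi> - of_int \<lfloor>\<xi>\<rfloor>) * b = y" using P(2) by metis
  qed
  have Sigma: "Sigma02 z A"
  proof -
    let ?T = "\<lambda>c. piece Q (pfst c) (pfst (psnd c)) (pfst (psnd (psnd c))) (psnd (psnd (psnd c)))"
    have "uniformly_Pi01 z ?T"
      using recz_dir[OF X_rec S_rec] by (intro pieces_uniformly_Pi01[OF D S_rec]) (simp_all add: \<alpha>_def \<beta>_def)
    moreover have "A = (\<Union>c. ?T c)"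
    proof (intro equalityI subsetI)
      fix y assume "y \<in> A"
      then obtain k b v where y: "real (Suc k) * y = b + v" "b \<in> B" "v \<in> path_group"
        unfolding A_def rat_hull_def G_def by blast
      obtain i where i: "b \<in> Q i" using y(2) B(2) by blast
      obtain m where m: "v \<in> path_sums m" using y(3) unfolding path_group_def by blast
      obtain l where l: "\<bar>b\<bar> \<le> real l" using real_arch_simple by blast
      have "y \<in> piece Q k i l m" using y(1) i m l unfolding piece_def by blast
      then have "y \<in> ?T (prod_encode (k, prod_encode (i, prod_encode (l, m))))" by simp
      then show "y \<in> (\<Union>c. ?T c)" by blast
    next
      fix y assume "y \<in> (\<Union>c. ?T c)"
      then obtain k i l m where "y \<in> piece Q k i l m" by blast
      then obtain b v where y: "real (Suc k) * y = b + v" "b \<in> B" "v \<in> path_group"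
        unfolding piece_def path_group_def using QB by blast
      then have "real (Suc k) * y \<in> G" unfolding G_def by blast
      then show "y \<in> A" unfolding A_def rat_hull_def by blast
    qed
    ultimately show ?thesis unfolding Sigma02_def by blast
  qed
  have "hausdorff_measure t A = 0" if t: "d < t" for t
  proof -
    have t0: "0 < t" using t d(1) by simp
    have ev: "\<forall>\<^sub>F n in sequentially. real (\<tau> n) / 2 ^ n \<le> t"
    proof -
      have "(\<lambda>n. (1/2::real) ^ n) \<longlonglongrightarrow> 0" by (intro LIMSEQ_power_zero) simp
      then have "\<forall>\<^sub>F n in sequentially. (1/2::real) ^ n < t - d" using t by (intro order_tendstoD(2)) auto
      then show ?thesis
      proof eventually_elim
        case (elim n)
        have "real (\<tau> n) / 2 ^ n \<le> (2 ^ n * d + 1) / 2 ^ n" using \<tau>_bounds(2)[of n] by (rule divide_right_mono) simp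
        also have "\<dots> = d + (1/2) ^ n" by (simp add: add_divide_distrib power_one_over)
        finally show ?case using elim by linarith
      qed
    qed
    have piece_null: "hausdorff_measure t (dim_piece Q k i l j L) = 0" if L: "distinct (map fst L)"
      for k i l j and L :: "(nat \<times> int \<times> int) list"
    proof (rule dim_piece_null[OF D(2) c _ \<tau>_le t0 ev])
      show "S n + pfst (c n) + (n + 4)\<^sup>2 \<le> S (Suc n)" for n by (simp add: S)
      fix M
      have "\<forall>e. \<exists>ab :: int \<times> int. fst (snd (L ! e)) * fst ab + snd (snd (L ! e)) * snd ab = 0
          \<and> 0 < of_int (fst ab) + \<xi>' * of_int (snd ab)"
        using irrational_direction[OF irr'] by simp
      from choice[OF this] obtain ab :: "nat \<Rightarrow> int \<times> int" where
        ab: "\<And>e. fst (snd (L ! e)) * fst (ab e) + snd (snd (L ! e)) * snd (ab e) = 0"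
          "\<And>e. 0 < of_int (fst (ab e)) + \<xi>' * of_int (snd (ab e))" by blast
      define L' where "L' = map (\<lambda>e. (fst (L ! e), ab e)) [0..<length L]"
      have L': "length L' = length L" "\<And>e. e < length L \<Longrightarrow> L' ! e = (fst (L ! e), ab e)"
        by (simp_all add: L'_def)
      have "map fst L' = map fst L" by (rule nth_equalityI) (simp_all add: L')
      with L have "distinct (map fst L')" by simp
      from directions_recur[OF \<xi>' X_def this, of "max M j" S j] obtain n where n: "max M j \<le> n"
        "\<forall>e<length L'. \<forall>p. p div 2 ^ (S n - S j) = fst (L' ! e) \<longrightarrow>
          dir_a X S n p = fst (snd (L' ! e)) \<and> dir_b X S n p = snd (snd (L' ! e))"
        using ab(2) L' by auto
      have "fst (snd (L ! e)) * \<alpha> n (P n) + snd (snd (L ! e)) * \<beta> n (P n) = 0"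
        if e: "e < length L" and P: "P \<in> paths" "P j = fst (L ! e)" for e P
      proof -
        have "P n div 2 ^ (S n - S j) = fst (L' ! e)" using path_div[OF P(1), of j n] n(1) P(2) L'(2)[OF e] by simp
        then have "\<alpha> n (P n) = fst (ab e) \<and> \<beta> n (P n) = snd (ab e)"
          using n(2) e L' unfolding \<alpha>_def \<beta>_def by simp
        then show ?thesis using ab(1)[of e] by simp
      qed
      with n(1) show "\<exists>n\<ge>M. \<forall>e<length L. \<forall>P\<in>paths. P j = fst (L ! e) \<longrightarrow>
         fst (snd (L ! e)) * \<alpha> n (P n) + snd (snd (L ! e)) * \<beta> n (P n) = 0"
        by (intro exI[of _ n]) simp
    qed
    \<comment> \<open>Countably many pieces suffice because prefixes, unlike paths, are natural numbers.\<close>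
    define E where "E x = (case x of (k, i, l, j, L) \<Rightarrow> if distinct (map fst L) then dim_piece Q k i l j L else {})"
      for x :: "nat \<times> nat \<times> nat \<times> nat \<times> (nat \<times> int \<times> int) list"
    have "hausdorff_measure t {} = 0"
      by (rule hausdorff_null_subset[OF piece_null[of "[]"]]) simp_all
    then have "hausdorff_measure t (E x) = 0" for x
      using piece_null by (cases x) (simp add: E_def)
    then have "hausdorff_measure t (\<Union>n. E (from_nat n)) = 0" by (intro hausdorff_null_UN)
    moreover have "A \<subseteq> (\<Union>n. E (from_nat n))"
    proof
      fix y assume "y \<in> A"
      then obtain k b v where y: "real (Suc k) * y = b + v" "b \<in> B" "v \<in> path_group"
        unfolding A_def rat_hull_def G_def by blast
      obtain i where i: "b \<in> Q i" using y(2) B(2) by blast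
      obtain l where l: "\<bar>b\<bar> \<le> real l" using real_arch_simple by blast
      obtain j L P where L: "distinct (map fst L)" "\<forall>e<length L. P e \<in> paths \<and> P e j = fst (L ! e)"
        "v = (\<Sum>e<length L. of_int (fst (snd (L ! e))) * path_val \<alpha> (P e)
          + of_int (snd (snd (L ! e))) * path_val \<beta> (P e))"
        using path_group_combination_list[OF y(3)] by blast
      have "y \<in> dim_piece Q k i l j L"
        unfolding dim_piece_def using i l L(2) y(1)[unfolded L(3)] by blast
      then have "y \<in> E (k, i, l, j, L)" using L(1) by (simp add: E_def)
      then have "y \<in> E (from_nat (to_nat (k, i, l, j, L)))" by simp
      then show "y \<in> (\<Union>n. E (from_nat n))" by blast
    qed
    ultimately show ?thesis by (rule hausdorff_null_subset)
  qed
  then have "hausdorff_dim A \<le> d" using d(1) by (intro hausdorff_dim_le)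
  moreover have "d \<le> hausdorff_dim A" unfolding d_def using BA by (rule hausdorff_dim_mono)
  ultimately have "hausdorff_dim A = d" by simp
  with A Sigma BA sum show ?thesis unfolding d_def by blast
qed

lemma recp_oracle: "recp {char_fun z} z"
proof -
  have z: "char_fun z = (\<lambda>n. Some (of_bool (z n)))" by (simp add: char_fun_def fun_eq_iff)
  show ?thesis unfolding recp_def recf_def z[symmetric] by (rule partial_recursive.given) simp
qed

lemma recp_relativize:
  assumes "recp {char_fun x} P" "recp G x" shows "recp G P"
proof -
  have x: "char_fun x = (\<lambda>n. Some (of_bool (x n)))" by (simp add: char_fun_def fun_eq_iff)
  have "partial_recursive G g" if "g \<in> {char_fun x}" for g
    using assms(2) that unfolding recp_def recf_def x[symmetric] by simp
  with assms(1) show ?thesis unfolding recp_def recf_def by (rule partial_recursive_relativize)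
qed

lemma recp_join_left: "recp {char_fun (x \<oplus>\<^sub>T y)} x"
proof -
  have "recp {char_fun (x \<oplus>\<^sub>T y)} (\<lambda>n. (x \<oplus>\<^sub>T y) (2 * n))"
    by (intro recp_comp[OF recp_oracle] recI)
  then show ?thesis by (simp add: oracle_join_def)
qed

lemma recp_join_right: "recp {char_fun (x \<oplus>\<^sub>T y)} y"
proof -
  have "recp {char_fun (x \<oplus>\<^sub>T y)} (\<lambda>n. (x \<oplus>\<^sub>T y) (2 * n + 1))"
    by (intro recp_comp[OF recp_oracle] recI)
  then show ?thesis by (simp add: oracle_join_def)
qed

lemma recp_join:
  assumes "recp G x" "recp G y" shows "recp G (x \<oplus>\<^sub>T y)"
proof -
  have "recp G (\<lambda>n. (even n \<and> x (n div 2)) \<or> (\<not> even n \<and> y (n div 2)))"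
    by (intro recI recp_comp[OF assms(1)] recp_comp[OF assms(2)])
  moreover have "(x \<oplus>\<^sub>T y) = (\<lambda>n. (even n \<and> x (n div 2)) \<or> (\<not> even n \<and> y (n div 2)))"
    by (rule ext) (simp add: oracle_join_def)
  ultimately show ?thesis by simp
qed

lemma computable_oracle_recp: "computable_oracle z \<longleftrightarrow> recp {} z"
proof -
  have z: "char_fun z = (\<lambda>n. Some (of_bool (z n)))" by (simp add: char_fun_def fun_eq_iff)
  show ?thesis unfolding computable_oracle_def recp_def recf_def z[symmetric] by simp
qed

lemma Sigma02_UNIV: "Sigma02 z UNIV"
proof -
  have "recp {char_fun z} (\<lambda>p. pfst p < pfst p)" by (intro recI)
  then have "ce_in z {n. \<exists>m. (\<lambda>a b. a < a) n (m :: nat)}" by (intro ce_in_Ex) simp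
  then have "ce_in z {}" by simp
  then have "uniformly_Pi01 z (\<lambda>_. UNIV)" unfolding uniformly_Pi01_def by (intro exI[of _ "{}"]) simp
  then show ?thesis unfolding Sigma02_def by (intro exI[of _ "\<lambda>_. UNIV"]) simp
qed

lemma Sigma02_extension:
  fixes B :: "real set" and \<xi> :: real
  assumes B: "additive_subgroup_real B" "Sigma02 x B" and irr: "\<xi> \<notin> \<rat>"
  shows "\<exists>A. rat_subspace A \<and> Sigma02 (x \<oplus>\<^sub>T real_code (hausdorff_dim B) \<oplus>\<^sub>T real_code \<xi>) A \<and> B \<subseteq> A
    \<and> hausdorff_dim A = hausdorff_dim B \<and> {a + \<xi> * b | a b. a \<in> A \<and> b \<in> A} = UNIV"
proof (cases "hausdorff_dim B < 1")
  case True
  define z where "z = x \<oplus>\<^sub>T real_code (hausdorff_dim B) \<oplus>\<^sub>T real_code \<xi>"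
  have x: "recp {char_fun z} x" unfolding z_def by (rule recp_join_left)
  have r: "recp {char_fun z} (real_code (hausdorff_dim B) \<oplus>\<^sub>T real_code \<xi>)" unfolding z_def by (rule recp_join_right)
  have rd: "recp {char_fun z} (real_code (hausdorff_dim B))" by (rule recp_relativize[OF recp_join_left r])
  have rx: "recp {char_fun z} (real_code \<xi>)" by (rule recp_relativize[OF recp_join_right r])
  obtain Q W where Q: "ce_in x W" "\<And>i. - Q i = (\<Union>n\<in>{n. prod_encode (i, n) \<in> W}. rat_interval n)" "B = (\<Union>i. Q i)"
    using B(2) unfolding Sigma02_def uniformly_Pi01_def by blast
  obtain D where D: "recp {char_fun x} (\<lambda>p. D (pfst p) (psnd p))" "\<And>n. n \<in> W \<longleftrightarrow> (\<exists>s. D n s)"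
    "\<And>n s t. D n s \<Longrightarrow> s \<le> t \<Longrightarrow> D n t"
    using ce_in_decidable_stages[OF Q(1)] by blast
  have "enumerates_complements D Q"
    unfolding enumerates_complements_def using D(3) Q(2) unfolding D(2) by blast
  from effective_extension[OF B(1) Q(3) recp_relativize[OF D(1) x] this rd rx True irr]
  show ?thesis unfolding z_def .
next
  case False
  have d: "hausdorff_dim (UNIV :: real set) = hausdorff_dim B"
    using False hausdorff_dim_le_1[of UNIV] hausdorff_dim_mono[of B UNIV] by simp
  have "z = z + \<xi> * 0" for z by simp
  then have "{a + \<xi> * b | a b. a \<in> UNIV \<and> b \<in> UNIV} = UNIV" by blast
  moreover have "rat_subspace UNIV" unfolding rat_subspace_iff by simp
  ultimately show ?thesis using d Sigma02_UNIV by (intro exI[of _ UNIV]) simp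
qed

lemma lightface_extension:
  fixes B :: "real set" and \<xi> :: real
  assumes B: "additive_subgroup_real B" "lightface_Sigma02 B" "hausdorff_dim B = 0"
    and irr: "\<xi> \<notin> \<rat>" and comp: "computable_real \<xi>"
  shows "\<exists>A. rat_subspace A \<and> lightface_Sigma02 A \<and> B \<subseteq> A
    \<and> hausdorff_dim A = 0 \<and> {a + \<xi> * b | a b. a \<in> A \<and> b \<in> A} = UNIV"
proof -
  obtain x where x: "computable_oracle x" "Sigma02 x B" using B(2) unfolding lightface_Sigma02_def by blast
  have "recp {} (\<lambda>n. n = int_encode 0)" "recp {} (\<lambda>n. n < n)" by (intro recI)+
  then have "recp {} (real_code 0)" unfolding real_code_def by (intro recp_join) simp_all
  then have "recp {} (x \<oplus>\<^sub>T real_code 0 \<oplus>\<^sub>T real_code \<xi>)"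
    using x(1) comp unfolding computable_real_def computable_oracle_recp by (intro recp_join)
  then have "computable_oracle (x \<oplus>\<^sub>T real_code 0 \<oplus>\<^sub>T real_code \<xi>)" unfolding computable_oracle_recp .
  with Sigma02_extension[OF B(1) x(2) irr] show ?thesis
    unfolding B(3) lightface_Sigma02_def by blast
qed

theorem mainTheorem5:
  fixes x :: "nat \<Rightarrow> bool" and B :: "real set" and d \<xi> :: real
  assumes "additive_subgroup_real B"
    and "d = hausdorff_dim B"
    and "\<xi> \<notin> \<rat>"
  shows
    "(Sigma02 x B \<longrightarrow>
       (\<exists>A. additive_subgroup_real A \<and> Sigma02 (x \<oplus>\<^sub>T real_code d \<oplus>\<^sub>T real_code \<xi>) A \<and>
            B \<subseteq> A \<and> hausdorff_dim A = d \<and> {a + \<xi> * b | a b. a \<in> A \<and> b \<in> A} = UNIV))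
     \<and> (lightface_Sigma02 B \<and> d = 0 \<and> computable_real \<xi> \<longrightarrow>
       (\<exists>A. additive_subgroup_real A \<and> lightface_Sigma02 A \<and>
            B \<subseteq> A \<and> hausdorff_dim A = 0 \<and> {a + \<xi> * b | a b. a \<in> A \<and> b \<in> A} = UNIV))
     \<and> (Sigma02 x B \<longrightarrow>
       (\<exists>A. rat_subspace A \<and> Sigma02 (x \<oplus>\<^sub>T real_code d \<oplus>\<^sub>T real_code \<xi>) A \<and>
            B \<subseteq> A \<and> hausdorff_dim A = d \<and> {a + \<xi> * b | a b. a \<in> A \<and> b \<in> A} = UNIV))
     \<and> (lightface_Sigma02 B \<and> d = 0 \<and> computable_real \<xi> \<longrightarrow>
       (\<exists>A. rat_subspace A \<and> lightface_Sigma02 A \<and>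
            B \<subseteq> A \<and> hausdorff_dim A = 0 \<and> {a + \<xi> * b | a b. a \<in> A \<and> b \<in> A} = UNIV))"
proof -
  have part3: "\<exists>A. rat_subspace A \<and> Sigma02 (x \<oplus>\<^sub>T real_code d \<oplus>\<^sub>T real_code \<xi>) A \<and>
            B \<subseteq> A \<and> hausdorff_dim A = d \<and> {a + \<xi> * b | a b. a \<in> A \<and> b \<in> A} = UNIV"
    if "Sigma02 x B"
    using Sigma02_extension[OF assms(1) that assms(3)] unfolding assms(2) .
  have part4: "\<exists>A. rat_subspace A \<and> lightface_Sigma02 A \<and>
            B \<subseteq> A \<and> hausdorff_dim A = 0 \<and> {a + \<xi> * b | a b. a \<in> A \<and> b \<in> A} = UNIV"
    if h: "lightface_Sigma02 B \<and> d = 0 \<and> computable_real \<xi>"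
  proof -
    have "hausdorff_dim B = 0" using h assms(2) by simp
    with h show ?thesis using lightface_extension[OF assms(1) _ _ assms(3)] by blast
  qed
  have part1: "\<exists>A. additive_subgroup_real A \<and> Sigma02 (x \<oplus>\<^sub>T real_code d \<oplus>\<^sub>T real_code \<xi>) A \<and>
            B \<subseteq> A \<and> hausdorff_dim A = d \<and> {a + \<xi> * b | a b. a \<in> A \<and> b \<in> A} = UNIV"
    if "Sigma02 x B"
    using part3[OF that] rat_subspace_subgroup by blast
  have part2: "\<exists>A. additive_subgroup_real A \<and> lightface_Sigma02 A \<and>
            B \<subseteq> A \<and> hausdorff_dim A = 0 \<and> {a + \<xi> * b | a b. a \<in> A \<and> b \<in> A} = UNIV"
    if "lightface_Sigma02 B \<and> d = 0 \<and> computable_real \<xi>"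
    using part4[OF that] rat_subspace_subgroup by blast
  show ?thesis using part1 part2 part3 part4 by simp
qed

end
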